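(* Let $\Bbbk$ be a field of characteristic zero, $d\ge3$, $m\ge1$, $\mathbf n=(n_1,\dots,n_d)\in\mathbb N^d$, $N=n_1\cdots n_d$, and $\mathbf r=(r_1,\dots,r_m)\in\mathbb N^m$ with all $r_k\ge2$. Suppose $R=r_1\cdots r_m$ lies in the range of applicability of the reshaped Kruskal criterion for $\mathbf n$. Then the variety $\sigma_{\mathbf r}(\mathcal S_{\mathbf n})$ has the expected dimension, i.e. $$\dim\sigma_{\mathbf r}(\mathcal S_{\mathbf n})=\min\Big\{\sum_{j=1}^m\dim\sigma_{r_j}(\mathcal S_{\mathbf n})-(m-1)\dim\mathcal S_{\mathbf n},\;N-1\Big\},$$ where all dimensions are dimensions of projective varieties.
   Context: $\mathcal S_{\mathbf n}\subset\mathbb P(\Bbbk^{n_1\times\cdots\times n_d})$ is the (projective) Segre variety of rank-$1$ tensors $\mathbf a_1\otimes\cdots\otimes\mathbf a_d$; its dimension is $\sum_{i=1}^d(n_i-1)$. For $r\in\mathbb N$, $\sigma_r(\mathcal S_{\mathbf n})$ is the $r$-th secant variety: the Zariski closure of the set of (classes of) tensors that are sums of at most $r$ rank-$1$ tensors. The variety $\sigma_{\mathbf r}(\mathcal S_{\mathbf n})$ is the Zariski closure of the set of (classes of nonzero) tensors of the form $\mathcal T_1\circledast\cdots\circledast\mathcal T_m$, where $\mathcal T_k$ has rank at most $r_k$ and $\circledast$ is the entrywise (Hadamard) product in the fixed coordinates of $\Bbbk^{n_1\times\cdots\times n_d}$. Range of applicability of the reshaped Kruskal criterion: $R$ lies in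 it if there is a partition $I\sqcup J\sqcup K=\{1,\dots,d\}$ such that, with $\Pi_X=\prod_{x\in X}n_x$, one has $\Pi_I\ge\Pi_J\ge\Pi_K\ge2$ and $R\le\Pi_I+\min\{\tfrac12\delta,\delta\}$, where $\delta=\Pi_J+\Pi_K-\Pi_I-2$. *)

theory Defs
  imports "HOL-Analysis.Analysis" "HOL-Library.Poly_Mapping"
begin

section \<open>Evaluation of multivariate polynomials\<close>

text \<open>
  A polynomial over \<open>'a\<close> with variables named by \<open>'v\<close> is an element of the monoid algebra
  \<open>('v \<Rightarrow>\<^sub>0 nat) \<Rightarrow>\<^sub>0 'a\<close>.
\<close>

type_synonym ('v, 'a) mpoly = "('v \<Rightarrow>\<^sub>0 nat) \<Rightarrow>\<^sub>0 'a"

definition mono_eval :: "('v \<Rightarrow> 'a::comm_semiring_1) \<Rightarrow> ('v \<Rightarrow>\<^sub>0 nat) \<Rightarrow> 'a" where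
  "mono_eval x m = (\<Prod>v\<in>Poly_Mapping.keys m. x v ^ Poly_Mapping.lookup m v)"

definition mono_degree :: "('v \<Rightarrow>\<^sub>0 nat) \<Rightarrow> nat" where
  "mono_degree m = (\<Sum>v\<in>Poly_Mapping.keys m. Poly_Mapping.lookup m v)"

definition poly_eval :: "('v \<Rightarrow> 'a::comm_semiring_1) \<Rightarrow> ('v, 'a) mpoly \<Rightarrow> 'a" where
  "poly_eval x f =
    (\<Sum>m\<in>Poly_Mapping.keys f. Poly_Mapping.lookup f m * mono_eval x m)"

definition homogeneous :: "('v, 'a::zero) mpoly \<Rightarrow> bool" where
  "homogeneous f \<longleftrightarrow> (\<exists>e. \<forall>m\<in>Poly_Mapping.keys f. mono_degree m = e)"

lemma mono_eval_superset:
  assumes "finite V" "Poly_Mapping.keys m \<subseteq> V"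
  shows "mono_eval x m = (\<Prod>v\<in>V. x v ^ Poly_Mapping.lookup m v)"
  unfolding mono_eval_def using assms
  by (intro prod.mono_neutral_left) (auto simp: in_keys_iff)

lemma mono_degree_superset:
  assumes "finite V" "Poly_Mapping.keys m \<subseteq> V"
  shows "mono_degree m = (\<Sum>v\<in>V. Poly_Mapping.lookup m v)"
  unfolding mono_degree_def using assms
  by (intro sum.mono_neutral_left) (auto simp: in_keys_iff)

lemma mono_eval_add: "mono_eval x (m + m') = mono_eval x m * mono_eval x m'"
proof -
  let ?V = "Poly_Mapping.keys m \<union> Poly_Mapping.keys m'"
  have "Poly_Mapping.keys (m + m') \<subseteq> ?V" by (rule keys_add)
  then show ?thesis
    by (simp add: mono_eval_superset[of ?V] lookup_add power_add prod.distrib)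
qed

lemma mono_degree_add: "mono_degree (m + m') = mono_degree m + mono_degree m'"
proof -
  let ?V = "Poly_Mapping.keys m \<union> Poly_Mapping.keys m'"
  have "Poly_Mapping.keys (m + m') \<subseteq> ?V" by (rule keys_add)
  then show ?thesis
    by (simp add: mono_degree_superset[of ?V] lookup_add sum.distrib)
qed

lemma mono_eval_scale: "mono_eval (\<lambda>v. c * x v) m = c ^ mono_degree m * mono_eval x m"
  by (simp add: mono_eval_def mono_degree_def power_mult_distrib prod.distrib power_sum)

lemma poly_eval_superset:
  assumes "finite M" "Poly_Mapping.keys f \<subseteq> M"
  shows "poly_eval x f = (\<Sum>m\<in>M. Poly_Mapping.lookup f m * mono_eval x m)"
  unfolding poly_eval_def using assms
  by (intro sum.mono_neutral_left) (auto simp: in_keys_iff)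

lemma poly_eval_add: "poly_eval x (f + g) = poly_eval x f + poly_eval x g"
proof -
  let ?M = "Poly_Mapping.keys f \<union> Poly_Mapping.keys g"
  have "Poly_Mapping.keys (f + g) \<subseteq> ?M" by (rule keys_add)
  then show ?thesis
    by (simp add: poly_eval_superset[of ?M] lookup_add algebra_simps sum.distrib)
qed

lemma poly_eval_zero: "poly_eval x 0 = 0"
  by (simp add: poly_eval_def)

lemma poly_eval_sum: "poly_eval x (sum F A) = (\<Sum>i\<in>A. poly_eval x (F i))"
  by (induction A rule: infinite_finite_induct) (simp_all add: poly_eval_add poly_eval_zero)

lemma poly_eval_single: "poly_eval x (Poly_Mapping.single m c) = c * mono_eval x m"
  by (simp add: poly_eval_def)

lemma mpoly_as_sum:
  "f = (\<Sum>m\<in>Poly_Mapping.keys f. Poly_Mapping.single m (Poly_Mapping.lookup f m))"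
  by (rule poly_mapping_eqI)
    (simp add: lookup_sum lookup_single when_def in_keys_iff)

lemma poly_eval_mult: "poly_eval x (f * g) = poly_eval x f * poly_eval x g"
proof -
  have "f * g = (\<Sum>m\<in>Poly_Mapping.keys f. \<Sum>k\<in>Poly_Mapping.keys g.
      Poly_Mapping.single (m + k) (Poly_Mapping.lookup f m * Poly_Mapping.lookup g k))"
    by (subst (1) mpoly_as_sum[of f], subst (1) mpoly_as_sum[of g])
      (simp add: sum_product mult_single)
  then have "poly_eval x (f * g) = (\<Sum>m\<in>Poly_Mapping.keys f. \<Sum>k\<in>Poly_Mapping.keys g.
      (Poly_Mapping.lookup f m * Poly_Mapping.lookup g k) * mono_eval x (m + k))"
    by (simp only: poly_eval_sum poly_eval_single)
  then show ?thesis
    by (simp add: mono_eval_add poly_eval_def sum_product ac_simps)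
qed

lemma homogeneous_mult:
  assumes "homogeneous f" "homogeneous g"
  shows "homogeneous (f * g)"
proof -
  from assms obtain a b where
    "\<forall>m\<in>Poly_Mapping.keys f. mono_degree m = a" "\<forall>m\<in>Poly_Mapping.keys g. mono_degree m = b"
    unfolding homogeneous_def by blast
  then have "\<forall>m\<in>Poly_Mapping.keys (f * g). mono_degree m = a + b"
    using keys_mult[of f g] by (fastforce simp: mono_degree_add)
  then show ?thesis unfolding homogeneous_def by blast
qed

lemma homogeneous_eval_scale:
  assumes "homogeneous f"
  obtains e where "\<And>c x. poly_eval (\<lambda>v. c * x v) f = c ^ e * poly_eval x f"
proof -
  from assms obtain e where e: "\<forall>m\<in>Poly_Mapping.keys f. mono_degree m = e"
    unfolding homogeneous_def by blast
  show ?thesis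
  proof (rule that)
    fix c x show "poly_eval (\<lambda>v. c * x v) f = c ^ e * poly_eval x f"
      unfolding poly_eval_def sum_distrib_left using e
      by (intro sum.cong) (auto simp: mono_eval_scale ac_simps)
  qed
qed


section \<open>Projective space and its Zariski topology\<close>

text \<open>
  For a coordinate set \<open>I\<close>, the vector space of functions \<open>I \<rightarrow> 'a\<close> is represented by the
  functions \<open>'v \<Rightarrow> 'a\<close> vanishing outside \<open>I\<close>. A projective point is the set of all
  nonzero multiples of a nonzero vector. Points are rational over \<open>'a\<close>, and Zariski closures are
  taken among rational points; \<open>'a\<close> need not be algebraically closed.
\<close>

definition coord_space :: "'v set \<Rightarrow> ('v \<Rightarrow> 'a::zero) set" where
  "coord_space I = {x. \<forall>v. v \<notin> I \<longrightarrow> x v = 0}"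

definition proj_class :: "('v \<Rightarrow> 'a::field) \<Rightarrow> ('v \<Rightarrow> 'a) set" where
  "proj_class x = {(\<lambda>v. c * x v) |c. c \<noteq> 0}"

definition projectivization :: "('v \<Rightarrow> 'a::field) set \<Rightarrow> ('v \<Rightarrow> 'a) set set" where
  "projectivization X = proj_class ` (X - {\<lambda>_. 0})"

abbreviation proj_space :: "'v set \<Rightarrow> ('v \<Rightarrow> 'a::field) set set" where
  "proj_space I \<equiv> projectivization (coord_space I)"

text \<open>
  Variables outside \<open>I\<close> may occur in the equations; they take the value 0 on \<open>coord_space I\<close>,
  so they do not enlarge the class of algebraic sets.
\<close>

definition proj_zeros :: "'v set \<Rightarrow> ('v, 'a::field) mpoly set \<Rightarrow> ('v \<Rightarrow> 'a) set set" where
  "proj_zeros I S = {P \<in> proj_space I. \<forall>x\<in>P. \<forall>f\<in>S. poly_eval x f = 0}"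

definition zariski :: "'v set \<Rightarrow> ('v \<Rightarrow> 'a::field) set topology" where
  "zariski I = topology (\<lambda>U. \<exists>S. (\<forall>f\<in>S. homogeneous f) \<and> U = proj_space I - proj_zeros I S)"

lemma proj_zeros_mult:
  fixes S T :: "('v, 'a::field) mpoly set"
  assumes S: "\<forall>f\<in>S. homogeneous f" and T: "\<forall>g\<in>T. homogeneous g"
  shows "proj_zeros I S \<union> proj_zeros I T = proj_zeros I {f * g |f g. f \<in> S \<and> g \<in> T}"
proof -
  have "P \<in> proj_zeros I S \<or> P \<in> proj_zeros I T"
    if P: "P \<in> proj_zeros I {f * g |f g. f \<in> S \<and> g \<in> T}" for P :: "('v \<Rightarrow> 'a) set"
  proof (rule ccontr)
    assume "\<not> ?thesis"
    with P obtain x y f g where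
      xy: "x \<in> P" "y \<in> P" "f \<in> S" "g \<in> T" "poly_eval x f \<noteq> 0" "poly_eval y g \<noteq> 0"
      unfolding proj_zeros_def by blast
    from P obtain z where "P = proj_class z"
      unfolding proj_zeros_def projectivization_def by blast
    with xy obtain a b where ab: "a \<noteq> 0" "x = (\<lambda>v. a * z v)" "y = (\<lambda>v. b * z v)"
      unfolding proj_class_def by blast
    define c where "c = b / a"
    from ab have y: "y = (\<lambda>v. c * x v)" by (simp add: c_def fun_eq_iff)
    obtain e where "poly_eval y g = c ^ e * poly_eval x g"
      using homogeneous_eval_scale[of g] T xy(4) unfolding y by metis
    with xy have "poly_eval x (f * g) \<noteq> 0" by (auto simp: poly_eval_mult)
    with P xy show False unfolding proj_zeros_def by blast
  qed
  moreover have "P \<in> proj_zeros I {f * g |f g. f \<in> S \<and> g \<in> T}"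
    if "P \<in> proj_zeros I S \<or> P \<in> proj_zeros I T" for P :: "('v \<Rightarrow> 'a) set"
    using that by (auto simp: proj_zeros_def poly_eval_mult)
  ultimately show ?thesis by blast
qed

lemma istopology_zariski:
  "istopology (\<lambda>U :: ('v \<Rightarrow> 'a::field) set set.
     \<exists>S. (\<forall>f\<in>S. homogeneous f) \<and> U = proj_space I - proj_zeros I S)"
  unfolding istopology_def
proof (intro conjI allI impI)
  fix U W :: "('v \<Rightarrow> 'a) set set"
  assume "\<exists>S. (\<forall>f\<in>S. homogeneous f) \<and> U = proj_space I - proj_zeros I S"
    and "\<exists>S. (\<forall>f\<in>S. homogeneous f) \<and> W = proj_space I - proj_zeros I S"
  then obtain S T where ST: "\<forall>f\<in>S. homogeneous f" "\<forall>f\<in>T. homogeneous f"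
    and "U = proj_space I - proj_zeros I S" "W = proj_space I - proj_zeros I T"
    by blast
  then have "U \<inter> W = proj_space I - (proj_zeros I S \<union> proj_zeros I T)" by blast
  then have "U \<inter> W = proj_space I - proj_zeros I {f * g |f g. f \<in> S \<and> g \<in> T}"
    by (simp only: proj_zeros_mult[OF ST])
  moreover have "\<forall>h\<in>{f * g |f g. f \<in> S \<and> g \<in> T}. homogeneous h"
    using ST homogeneous_mult by blast
  ultimately show "\<exists>S. (\<forall>f\<in>S. homogeneous f) \<and> U \<inter> W = proj_space I - proj_zeros I S"
    by blast
next
  fix K :: "('v \<Rightarrow> 'a) set set set"
  assume "\<forall>U\<in>K. \<exists>S. (\<forall>f\<in>S. homogeneous f) \<and> U = proj_space I - proj_zeros I S"
  then obtain S where
    S: "\<forall>U\<in>K. (\<forall>f\<in>S U. homogeneous f) \<and> U = proj_space I - proj_zeros I (S U)"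
    by metis
  have "\<Union>K = (\<Union>U\<in>K. proj_space I - proj_zeros I (S U))" using S by auto
  also have "\<dots> = proj_space I - proj_zeros I (\<Union>U\<in>K. S U)"
    unfolding proj_zeros_def by blast
  finally show "\<exists>S. (\<forall>f\<in>S. homogeneous f) \<and> \<Union>K = proj_space I - proj_zeros I S"
    using S by (intro exI[of _ "\<Union>U\<in>K. S U"]) auto
qed

lemma openin_zariski:
  "openin (zariski I) U \<longleftrightarrow>
    (\<exists>S. (\<forall>f\<in>S. homogeneous f) \<and> U = proj_space I - proj_zeros I S)"
  unfolding zariski_def topology_inverse'[OF istopology_zariski] ..

lemma topspace_zariski: "topspace (zariski I) = (proj_space I :: ('v \<Rightarrow> 'a::field) set set)"
proof (rule subset_antisym)
  show "topspace (zariski I) \<subseteq> (proj_space I :: ('v \<Rightarrow> 'a) set set)"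
    unfolding topspace_def openin_zariski by blast
  let ?one = "Poly_Mapping.single 0 1 :: ('v, 'a) mpoly"
  have one: "poly_eval x ?one = 1" for x :: "'v \<Rightarrow> 'a"
    by (simp only: poly_eval_single) (simp add: mono_eval_def)
  have "x \<in> proj_class x" for x :: "'v \<Rightarrow> 'a"
    unfolding proj_class_def by (auto intro: exI[of _ 1])
  with one have "proj_zeros I {?one} = {}"
    unfolding proj_zeros_def projectivization_def by fastforce
  moreover have "homogeneous ?one" by (simp add: homogeneous_def)
  ultimately have "openin (zariski I) (proj_space I :: ('v \<Rightarrow> 'a) set set)"
    unfolding openin_zariski by (intro exI[of _ "{?one}"]) simp
  then show "(proj_space I :: ('v \<Rightarrow> 'a) set set) \<subseteq> topspace (zariski I)"
    by (rule openin_subset)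
qed

lemma closedin_zariski:
  fixes C :: "('v \<Rightarrow> 'a::field) set set"
  shows "closedin (zariski I) C \<longleftrightarrow> (\<exists>S. (\<forall>f\<in>S. homogeneous f) \<and> C = proj_zeros I S)"
proof -
  have sub: "proj_zeros I S \<subseteq> proj_space I" for S :: "('v, 'a) mpoly set"
    unfolding proj_zeros_def by blast
  show ?thesis
    unfolding closedin_def topspace_zariski openin_zariski using sub by blast
qed


section \<open>Krull dimension\<close>

definition irreducible_space :: "'x topology \<Rightarrow> bool" where
  "irreducible_space X \<longleftrightarrow> topspace X \<noteq> {} \<and>
    (\<forall>A B. closedin X A \<and> closedin X B \<and> A \<union> B = topspace X \<longrightarrow>
       A = topspace X \<or> B = topspace X)"

text \<open>
  The value lies in \<open>ereal\<close> so that differences of dimensions can be formed without truncation.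
  The empty space has dimension \<open>-\<infinity>\<close>.
\<close>

definition krull_dim :: "'x topology \<Rightarrow> ereal" where
  "krull_dim X = Sup {ereal (real l) |l. \<exists>C :: nat \<Rightarrow> 'x set.
     (\<forall>i\<le>l. closedin X (C i) \<and> irreducible_space (subtopology X (C i))) \<and>
     (\<forall>i<l. C i \<subset> C (Suc i))}"


section \<open>Tensors\<close>

text \<open>
  The list \<open>ns = [n\<^sub>1, \<dots>, n\<^sub>d]\<close> is the format. All indices start at 0: the tensor factors
  are numbered by \<open>k < d\<close>, and the multi-index entry at \<open>k\<close> ranges over \<open>i < ns ! k\<close>.
\<close>

type_synonym 'a tensor = "nat list \<Rightarrow> 'a"

definition multi_indices :: "nat list \<Rightarrow> nat list set" where
  "multi_indices ns = {is. length is = length ns \<and> (\<forall>k<length ns. is ! k < ns ! k)}"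

definition outer_product :: "nat list \<Rightarrow> (nat \<Rightarrow> nat \<Rightarrow> 'a) \<Rightarrow> 'a::field tensor" where
  "outer_product ns a =
    (\<lambda>is. if is \<in> multi_indices ns then \<Prod>k<length ns. a k (is ! k) else 0)"

definition rank_one :: "nat list \<Rightarrow> 'a::field tensor \<Rightarrow> bool" where
  "rank_one ns T \<longleftrightarrow>
    (\<exists>a. (\<forall>k<length ns. \<exists>i<ns ! k. a k i \<noteq> 0) \<and> T = outer_product ns a)"

definition rank_at_most :: "nat list \<Rightarrow> nat \<Rightarrow> 'a::field tensor \<Rightarrow> bool" where
  "rank_at_most ns r T \<longleftrightarrow>
    (\<exists>s\<le>r. \<exists>A. (\<forall>j<s. rank_one ns (A j)) \<and> T = (\<lambda>is. \<Sum>j<s. A j is))"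

definition segre :: "nat list \<Rightarrow> 'a::field tensor set set" where
  "segre ns = projectivization {T. rank_one ns T}"

definition secant :: "nat list \<Rightarrow> nat \<Rightarrow> 'a::field tensor set set" where
  "secant ns r =
    zariski (multi_indices ns) closure_of projectivization {T. rank_at_most ns r T}"

text \<open>
  The list \<open>rs\<close> is meant to be nonempty: only then does the product vanish outside the index set,
  i.e. is it again a tensor of format \<open>ns\<close>.
\<close>

definition hadamard_secant :: "nat list \<Rightarrow> nat list \<Rightarrow> 'a::field tensor set set" where
  "hadamard_secant ns rs =
    zariski (multi_indices ns) closure_of projectivization
      {T. \<exists>Ts. (\<forall>k<length rs. rank_at_most ns (rs ! k) (Ts k)) \<and>
            T = (\<lambda>is. \<Prod>k<length rs. Ts k is)}"

definition var_dim :: "nat list \<Rightarrow> 'a::field tensor set set \<Rightarrow> ereal" where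
  "var_dim ns X = krull_dim (subtopology (zariski (multi_indices ns)) X)"

definition kruskal_range :: "nat list \<Rightarrow> nat \<Rightarrow> bool" where
  "kruskal_range ns R \<longleftrightarrow>
    (\<exists>I J K. I \<union> J \<union> K = {..<length ns} \<and>
       I \<inter> J = {} \<and> I \<inter> K = {} \<and> J \<inter> K = {} \<and>
       (let p = (\<lambda>X. \<Prod>x\<in>X. ns ! x);
            \<delta> = real (p J) + real (p K) - real (p I) - 2
        in p I \<ge> p J \<and> p J \<ge> p K \<and> p K \<ge> 2 \<and>
           real R \<le> real (p I) + min (\<delta> / 2) \<delta>))"

end

(*
  The Hadamard products are the image of a polynomial map phi. Normalizing the vectors and moving the
  first summand of each factor into the first factor leaves q free parameters without changing the
  closure of the image, where q is the expected dimension.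

  Upper bound: along a chain of l strict inclusions of irreducible closed sets there are (n+1)^l
  independent forms of degree O(n), while their pullbacks along phi are polynomials of degree O(n)
  in q variables; hence l <= q. Lower bound: if phi(p) and the q partial derivatives of phi at p are
  independent, then freeing the parameters one at a time gives a strict chain.

  The point p is chosen such that the R = r_1 ... r_m rank one terms of phi(p) are the tensors
  theta^(a+b+c), theta = 2^J with J < R, after flattening to three factors along the partition of
  the Kruskal criterion. Tangent vectors of the Segre variety at these points are independent:
  a product of three polynomials in theta, viewed as a functional, kills the tangent space at every
  point where two of the three vanish, and the numerical condition leaves just enough freedom to
  isolate each of the R points in this way.
*)
theory Submission
  imports Defs
begin

section \<open>Linear systems over a field\<close>

text \<open>Points are rational over a field that need not be algebraically closed, so transcendence
  degrees are replaced by counting forms and by restricting polynomials to lines. The number q is s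
  g - 1: here g = 1 + \<Sum>(n_i - 1) = dim S + 1 counts a coefficient and the entries of normalized
  vectors, s = \<Sum>r_k - (m - 1) counts the summands left after normalization, and the last 1 is
  the overall scalar. The cases \<open>[r]\<close> and \<open>[1]\<close> of the same computation
  give the secant and Segre dimensions, because the numerical condition passes from R to every r_k
  and to 1. Independence of q + 1 vectors in a space of dimension N shows that the minimum is its
  first argument. The obstacle is that the R rank one terms of a Hadamard product are built from few
  vectors and cannot be prescribed separately. Powers of 2 turn entrywise products into sums of
  exponents, and a mixed radix expansion over r_1, ..., r_m makes these exponents run through 0,
  ..., R - 1; further ones inside the three groups turn the flattened vectors into geometric
  progressions. Tangent spaces can only grow under flattening, so three factors suffice.\<close>

lemma exists_nontrivial_relation:
  fixes M :: "'b \<Rightarrow> 'c \<Rightarrow> 'a::field"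
  assumes "finite B" "finite A" "card B < card A"
  shows "\<exists>c. (\<exists>a\<in>A. c a \<noteq> 0) \<and> (\<forall>b\<in>B. (\<Sum>a\<in>A. c a * M a b) = 0)"
  using assms
proof (induction B arbitrary: A M rule: finite_induct)
  case empty
  then have "A \<noteq> {}" by auto
  then show ?case by (intro exI[of _ "\<lambda>_. 1"]) auto
next
  case (insert b B)
  show ?case
  proof (cases "\<forall>a\<in>A. M a b = 0")
    case True
    have "card B < card A" using insert by simp
    then obtain c where "\<exists>a\<in>A. c a \<noteq> 0" "\<forall>b\<in>B. (\<Sum>a\<in>A. c a * M a b) = 0"
      using insert.IH[OF insert.prems(1)] by blast
    with True show ?thesis by (intro exI[of _ c]) auto
  next
    case False
    then obtain a0 where a0: "a0 \<in> A" "M a0 b \<noteq> 0" by blast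
    \<comment> \<open>Elimination with pivot \<open>a0\<close>: every other vector is made to vanish
      at \<open>b\<close> by subtracting a multiple of it.\<close>
    define M' where "M' a b' = M a b' - M a b / M a0 b * M a0 b'" for a b'
    have "card B < card (A - {a0})" using insert a0 by simp
    then obtain c where c: "\<exists>a\<in>A - {a0}. c a \<noteq> 0" "\<forall>b\<in>B. (\<Sum>a\<in>A - {a0}. c a * M' a b) = 0"
      using insert.IH[of "A - {a0}" M'] insert.prems(1) by blast
    define s where "s = (\<Sum>a\<in>A - {a0}. c a * M a b) / M a0 b"
    define c' where "c' = c(a0 := - s)"
    have split: "(\<Sum>a\<in>A. c' a * M a b') = - s * M a0 b' + (\<Sum>a\<in>A - {a0}. c a * M a b')" for b'
      by (subst sum.remove[OF insert.prems(1) a0(1)]) (auto simp: c'_def intro!: sum.cong)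
    have "(\<Sum>a\<in>A. c' a * M a b') = 0" if b': "b' \<in> insert b B" for b'
    proof (cases "b' = b")
      case True
      then show ?thesis using a0 by (simp add: split s_def)
    next
      case False
      with b' c have "(\<Sum>a\<in>A - {a0}. c a * M' a b') = 0" by blast
      then have "(\<Sum>a\<in>A - {a0}. c a * M a b') = (\<Sum>a\<in>A - {a0}. c a * M a b / M a0 b * M a0 b')"
        by (simp add: M'_def algebra_simps sum_subtractf)
      also have "\<dots> = s * M a0 b'"
        by (simp add: s_def sum_divide_distrib sum_distrib_right)
      finally show ?thesis by (simp add: split)
    qed
    moreover have "\<exists>a\<in>A. c' a \<noteq> 0" using c(1) by (auto simp: c'_def)
    ultimately show ?thesis by blast
  qed
qed

text \<open>Independence of an indexed family, so equal vectors under different indices are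
  dependent; values outside \<open>X\<close> are ignored.\<close>

definition independent_family :: "'x set \<Rightarrow> 'b set \<Rightarrow> ('b \<Rightarrow> 'x \<Rightarrow> 'a::field) \<Rightarrow> bool" where
  "independent_family X B w \<longleftrightarrow>
    (\<forall>c. (\<forall>x\<in>X. (\<Sum>b\<in>B. c b * w b x) = 0) \<longrightarrow> (\<forall>b\<in>B. c b = 0))"

lemma independent_family_card_le:
  assumes "independent_family X B w" "finite X" "finite B"
  shows "card B \<le> card X"
proof (rule ccontr)
  assume "\<not> ?thesis"
  then obtain c where "\<exists>b\<in>B. c b \<noteq> 0" "\<forall>x\<in>X. (\<Sum>b\<in>B. c b * w b x) = 0"
    using exists_nontrivial_relation[of X B w] assms by auto
  with assms(1) show False unfolding independent_family_def by blast
qed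

lemma independent_family_subset:
  assumes "independent_family X B w" "finite B" "A \<subseteq> B"
  shows "independent_family X A w"
  unfolding independent_family_def
proof (intro allI impI)
  fix c assume c: "\<forall>x\<in>X. (\<Sum>b\<in>A. c b * w b x) = 0"
  define c' where "c' b = (if b \<in> A then c b else 0)" for b
  have "(\<Sum>b\<in>B. c' b * w b x) = (\<Sum>b\<in>A. c b * w b x)" for x
    using assms by (intro sum.mono_neutral_cong_right) (auto simp: c'_def)
  with c assms(1) have "\<forall>b\<in>B. c' b = 0" unfolding independent_family_def by metis
  with assms show "\<forall>b\<in>A. c b = 0" by (auto simp: c'_def split: if_splits)
qed

text \<open>The dual functionals grow with the family. The new vector minus its components along the
  old ones is nonzero somewhere on \<open>X\<close>; evaluation there, corrected to kill the old
  vectors and rescaled, is the new functional, and a multiple of it corrects each old one.\<close>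

lemma independent_family_dual:
  assumes "finite B" "finite X" "independent_family X B w"
  shows "\<exists>L. \<forall>b\<in>B. \<forall>b'\<in>B. (\<Sum>x\<in>X. L b x * w b' x) = (if b = b' then 1 else 0)"
  using assms(1,3)
proof (induction B rule: finite_induct)
  case (insert b B)
  then have "independent_family X B w"
    using independent_family_subset[of X "insert b B" w B] by auto
  with insert obtain L where
    L: "\<And>a a'. a \<in> B \<Longrightarrow> a' \<in> B \<Longrightarrow> (\<Sum>x\<in>X. L a x * w a' x) = (if a = a' then 1 else 0)"
    by blast
  define e where "e a = (\<Sum>x\<in>X. L a x * w b x)" for a
  define w' where "w' x = w b x - (\<Sum>a\<in>B. e a * w a x)" for x
  have "\<exists>x\<in>X. w' x \<noteq> 0"
  proof (rule ccontr)
    assume "\<not> ?thesis"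
    moreover have "(\<Sum>a\<in>insert b B. (if a = b then 1 else - e a) * w a x) = w' x" for x
    proof -
      have "(\<Sum>a\<in>B. (if a = b then 1 else - e a) * w a x) = (\<Sum>a\<in>B. - (e a * w a x))"
        using insert.hyps by (intro sum.cong) auto
      then show ?thesis using insert.hyps by (simp add: w'_def sum_negf)
    qed
    ultimately have "\<forall>x\<in>X. (\<Sum>a\<in>insert b B. (if a = b then 1 else - e a) * w a x) = 0"
      by auto
    then show False
      using insert.prems[unfolded independent_family_def, rule_format,
          of "\<lambda>a. if a = b then 1 else - e a" b] by auto
  qed
  then obtain x0 where x0: "x0 \<in> X" "w' x0 \<noteq> 0" by blast
  define M where "M x = ((if x = x0 then 1 else 0) - (\<Sum>a\<in>B. w a x0 * L a x)) / w' x0" for x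
  have M: "(\<Sum>x\<in>X. M x * v x) = (v x0 - (\<Sum>a\<in>B. w a x0 * (\<Sum>x\<in>X. L a x * v x))) / w' x0" for v
  proof -
    have "(\<Sum>x\<in>X. M x * v x) =
        (\<Sum>x\<in>X. (if x = x0 then v x else 0) - (\<Sum>a\<in>B. w a x0 * L a x * v x)) / w' x0"
      unfolding sum_divide_distrib M_def
      by (intro sum.cong) (auto simp: algebra_simps sum_distrib_right sum_distrib_left)
    also have "(\<Sum>x\<in>X. (if x = x0 then v x else 0) - (\<Sum>a\<in>B. w a x0 * L a x * v x)) =
        v x0 - (\<Sum>x\<in>X. \<Sum>a\<in>B. w a x0 * L a x * v x)"
      using x0 assms(2) by (simp add: sum_subtractf)
    also have "(\<Sum>x\<in>X. \<Sum>a\<in>B. w a x0 * L a x * v x) = (\<Sum>a\<in>B. w a x0 * (\<Sum>x\<in>X. L a x * v x))"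
      by (subst sum.swap) (simp add: sum_distrib_left mult.assoc)
    finally show ?thesis .
  qed
  have Mb: "(\<Sum>x\<in>X. M x * w b x) = 1"
    using x0 by (simp add: M w'_def e_def[symmetric] mult.commute)
  have Ma: "(\<Sum>x\<in>X. M x * w a x) = 0" if "a \<in> B" for a
  proof -
    have "(\<Sum>a'\<in>B. w a' x0 * (\<Sum>x\<in>X. L a' x * w a x)) = (\<Sum>a'\<in>B. if a' = a then w a x0 else 0)"
      using that by (intro sum.cong) (auto simp: L)
    also have "\<dots> = w a x0" using that insert by simp
    finally show ?thesis by (simp add: M)
  qed
  define L' where "L' a x = (if a = b then M x else L a x - e a * M x)" for a x
  have "(\<Sum>x\<in>X. L' a x * w a' x) = (if a = a' then 1 else 0)"
    if "a \<in> insert b B" "a' \<in> insert b B" for a a'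
  proof (cases "a = b")
    case True
    then show ?thesis using that insert.hyps by (auto simp: L'_def Ma Mb)
  next
    case False
    with that have a: "a \<in> B" by simp
    have "(\<Sum>x\<in>X. L' a x * w a' x) = (\<Sum>x\<in>X. L a x * w a' x) - e a * (\<Sum>x\<in>X. M x * w a' x)"
      using False by (simp add: L'_def algebra_simps sum_subtractf sum_distrib_left)
    then show ?thesis using that False a
      using insert.hyps by (cases "a' = b") (auto simp: Mb Ma L e_def)
  qed
  then show ?case by blast
qed auto

section \<open>Functions that are polynomial along lines\<close>

text \<open>The degree bound is uniform over all lines, and on coordinate lines it bounds the degree
  in each variable; no explicit polynomial in the parameters has to be carried along.\<close>

definition line_poly :: "nat \<Rightarrow> (('v \<Rightarrow> 'a::field_char_0) \<Rightarrow> 'a) \<Rightarrow> bool" where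
  "line_poly D g \<longleftrightarrow>
    (\<forall>u h. \<exists>P. degree P \<le> D \<and> (\<forall>t. g (\<lambda>v. u v + t * h v) = poly P t))"

lemma line_poly_mono: "line_poly D g \<Longrightarrow> D \<le> D' \<Longrightarrow> line_poly D' g"
  unfolding line_poly_def by (meson order_trans)

lemma line_poly_const: "line_poly 0 (\<lambda>_. c)"
  unfolding line_poly_def by (intro allI exI[of _ "[:c:]"]) auto

lemma line_poly_coord: "line_poly 1 (\<lambda>u. u v)"
  unfolding line_poly_def
proof (intro allI)
  fix u h :: "'a \<Rightarrow> 'b"
  show "\<exists>P. degree P \<le> 1 \<and> (\<forall>t. u v + t * h v = poly P t)"
    by (intro exI[of _ "[:u v, h v:]"]) auto
qed

lemma line_poly_add:
  assumes "line_poly D f" "line_poly D g"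
  shows "line_poly D (\<lambda>u. f u + g u)"
  unfolding line_poly_def
proof (intro allI)
  fix u h
  obtain P Q where "degree P \<le> D" "\<forall>t. f (\<lambda>v. u v + t * h v) = poly P t"
    "degree Q \<le> D" "\<forall>t. g (\<lambda>v. u v + t * h v) = poly Q t"
    using assms unfolding line_poly_def by metis
  then show "\<exists>P. degree P \<le> D \<and>
      (\<forall>t. f (\<lambda>v. u v + t * h v) + g (\<lambda>v. u v + t * h v) = poly P t)"
    by (intro exI[of _ "P + Q"]) (auto intro: degree_add_le)
qed

lemma line_poly_mult:
  assumes "line_poly D f" "line_poly E g"
  shows "line_poly (D + E) (\<lambda>u. f u * g u)"
  unfolding line_poly_def
proof (intro allI)
  fix u h
  obtain P Q where "degree P \<le> D" "\<forall>t. f (\<lambda>v. u v + t * h v) = poly P t"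
    "degree Q \<le> E" "\<forall>t. g (\<lambda>v. u v + t * h v) = poly Q t"
    using assms unfolding line_poly_def by metis
  then show "\<exists>P. degree P \<le> D + E \<and>
      (\<forall>t. f (\<lambda>v. u v + t * h v) * g (\<lambda>v. u v + t * h v) = poly P t)"
    by (intro exI[of _ "P * Q"]) (auto intro: order_trans[OF degree_mult_le] add_mono)
qed

lemma line_poly_cmult: "line_poly D f \<Longrightarrow> line_poly D (\<lambda>u. c * f u)"
  using line_poly_mult[OF line_poly_const[of c], of D f] by simp

lemma line_poly_sum:
  "(\<And>i. i \<in> A \<Longrightarrow> line_poly D (f i)) \<Longrightarrow> line_poly D (\<lambda>u. \<Sum>i\<in>A. f i u)"
  by (induction A rule: infinite_finite_induct)
    (auto intro: line_poly_add line_poly_mono[OF line_poly_const])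

lemma line_poly_prod:
  "(\<And>i. i \<in> A \<Longrightarrow> line_poly (D i) (f i)) \<Longrightarrow> line_poly (\<Sum>i\<in>A. D i) (\<lambda>u. \<Prod>i\<in>A. f i u)"
  by (induction A rule: infinite_finite_induct)
    (auto intro: line_poly_mult line_poly_const)

lemma line_poly_power: "line_poly D f \<Longrightarrow> line_poly (n * D) (\<lambda>u. f u ^ n)"
  by (induction n) (auto intro: line_poly_mult line_poly_const)

section \<open>Vanishing and linear dependence of polynomial functions on affine charts\<close>

definition affine_chart :: "('v \<Rightarrow> 'a) \<Rightarrow> 'v set \<Rightarrow> ('v \<Rightarrow> 'a) set" where
  "affine_chart p V = {u. \<forall>v. v \<notin> V \<longrightarrow> u v = p v}"

lemma affine_chart_base: "p \<in> affine_chart p V"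
  by (simp add: affine_chart_def)

lemma affine_chart_mono: "V \<subseteq> W \<Longrightarrow> affine_chart p V \<subseteq> affine_chart p W"
  by (auto simp: affine_chart_def)

text \<open>Variable by variable: on a coordinate line \<open>g\<close> is a polynomial of degree at
  most \<open>D\<close> with the roots 0, ..., \<open>D\<close>, which are \<open>D + 1\<close>
  distinct elements in characteristic zero.\<close>

lemma line_poly_grid_zero:
  fixes g :: "('v \<Rightarrow> 'a::field_char_0) \<Rightarrow> 'a"
  assumes "finite V" "line_poly D g"
    and "\<And>u. u \<in> affine_chart p V \<Longrightarrow> (\<forall>v\<in>V. \<exists>i\<le>D. u v = of_nat i) \<Longrightarrow> g u = 0"
    and "u \<in> affine_chart p V"
  shows "g u = 0"
  using assms(1,3,4)
proof (induction V arbitrary: p u rule: finite_induct)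
  case empty
  then show ?case by auto
next
  case (insert v V)
  have root: "g (u(v := of_nat i)) = 0" if "i \<le> D" for i
  proof (rule insert.IH)
    show "u(v := of_nat i) \<in> affine_chart (p(v := of_nat i)) V"
      using insert.prems(2) insert.hyps by (auto simp: affine_chart_def)
    fix u' assume u': "u' \<in> affine_chart (p(v := of_nat i)) V" "\<forall>v\<in>V. \<exists>i\<le>D. u' v = of_nat i"
    then have "u' v = of_nat i" using insert.hyps by (auto simp: affine_chart_def)
    moreover have "u' \<in> affine_chart p (insert v V)"
      using u'(1) by (auto simp: affine_chart_def)
    ultimately show "g u' = 0" using u' that by (intro insert.prems(1)) auto
  qed
  obtain P where P: "degree P \<le> D" and
    "\<And>t. g (\<lambda>w. (u(v := 0)) w + t * (if w = v then 1 else 0)) = poly P t"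
    using assms(2) unfolding line_poly_def by metis
  moreover have "(\<lambda>w. (u(v := 0)) w + t * (if w = v then 1 else 0)) = u(v := t)" for t
    by auto
  ultimately have eq: "g (u(v := t)) = poly P t" for t by metis
  have "P = 0"
  proof (rule ccontr)
    assume "P \<noteq> 0"
    have "of_nat ` {..D} \<subseteq> {x. poly P x = 0}" using root by (auto simp: eq[symmetric])
    then have "card (of_nat ` {..D} :: 'a set) \<le> card {x. poly P x = 0}"
      using poly_roots_finite[OF \<open>P \<noteq> 0\<close>] by (rule card_mono[rotated])
    also have "\<dots> \<le> degree P" using \<open>P \<noteq> 0\<close> by (rule card_poly_roots_bound)
    finally show False using P by (simp add: card_image)
  qed
  then show ?case using eq[of "u v"] by simp
qed

text \<open>On the chart a function of degree at most \<open>D\<close> is determined by its values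
  on a grid of at most \<open>(D + 1) ^ card V\<close> points. A larger family has a relation on the
  grid, which then holds on the whole chart.\<close>

lemma line_poly_family_dependent:
  fixes g :: "'b \<Rightarrow> ('v \<Rightarrow> 'a::field_char_0) \<Rightarrow> 'a"
  assumes "finite V" "finite A" "\<And>a. a \<in> A \<Longrightarrow> line_poly D (g a)"
    and "(D + 1) ^ card V < card A"
  shows "\<exists>c. (\<exists>a\<in>A. c a \<noteq> 0) \<and> (\<forall>u\<in>affine_chart p V. (\<Sum>a\<in>A. c a * g a u) = 0)"
proof -
  define G where "G = (\<lambda>i v. if v \<in> V then of_nat (i v) else p v) ` (PiE V (\<lambda>_. {..D}))"
  have fin: "finite (PiE V (\<lambda>_. {..D}))" using assms(1) by (intro finite_PiE) auto
  have "card G \<le> card (PiE V (\<lambda>_. {..D}))" unfolding G_def using fin by (rule card_image_le)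
  also have "\<dots> = (D + 1) ^ card V" using assms(1) by (simp add: card_PiE)
  finally have "card G < card A" using assms(4) by simp
  moreover have "finite G" using fin by (simp add: G_def)
  ultimately obtain c where c: "\<exists>a\<in>A. c a \<noteq> 0" "\<forall>u\<in>G. (\<Sum>a\<in>A. c a * g a u) = 0"
    using exists_nontrivial_relation[of G A g] assms(2) by blast
  have "(\<Sum>a\<in>A. c a * g a u) = 0" if "u \<in> affine_chart p V" for u
  proof (rule line_poly_grid_zero[OF assms(1), where g = "\<lambda>u. \<Sum>a\<in>A. c a * g a u"])
    show "line_poly D (\<lambda>u. \<Sum>a\<in>A. c a * g a u)"
      using assms(3) by (intro line_poly_sum line_poly_cmult)
    show "u \<in> affine_chart p V" by fact
    fix u assume u: "u \<in> affine_chart p V" "\<forall>v\<in>V. \<exists>i\<le>D. u v = of_nat i"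
    then obtain i where i: "\<And>v. v \<in> V \<Longrightarrow> i v \<le> D \<and> u v = of_nat (i v)" by metis
    have "u = (\<lambda>v. if v \<in> V then of_nat (restrict i V v) else p v)"
      using u(1) i by (auto simp: affine_chart_def)
    then have "u \<in> G" unfolding G_def using i by (intro image_eqI[of _ _ "restrict i V"]) auto
    then show "(\<Sum>a\<in>A. c a * g a u) = 0" using c by blast
  qed
  with c show ?thesis by blast
qed

text \<open>On the line that starts at \<open>u\<close> for t = 0 and reaches \<open>w\<close> for t
  = 1 both functions are univariate polynomials with product zero, and the first is not
  zero.\<close>

lemma line_poly_zero_divisor:
  fixes f g :: "('v \<Rightarrow> 'a::field_char_0) \<Rightarrow> 'a"
  assumes "line_poly D f" "line_poly E g"
    and zero: "\<And>u. u \<in> affine_chart p V \<Longrightarrow> f u * g u = 0"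
    and u: "u \<in> affine_chart p V" "f u \<noteq> 0" and w: "w \<in> affine_chart p V"
  shows "g w = 0"
proof -
  obtain P Q where P: "\<And>t. f (\<lambda>v. u v + t * (w v - u v)) = poly P t"
    and Q: "\<And>t. g (\<lambda>v. u v + t * (w v - u v)) = poly Q t"
    using assms(1,2) unfolding line_poly_def by metis
  have "(\<lambda>v. u v + t * (w v - u v)) \<in> affine_chart p V" for t
    using u w by (auto simp: affine_chart_def)
  then have "poly (P * Q) t = 0" for t using zero by (simp add: P[symmetric] Q[symmetric])
  then have "P * Q = 0" using poly_all_0_iff_0 by blast
  moreover have "P \<noteq> 0" using P[of 0] u by auto
  ultimately have "poly Q 1 = 0" by simp
  then show ?thesis using Q[of 1] by simp
qed

section \<open>Mixed radix expansions\<close>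

text \<open>A positional system with radices \<open>n i\<close>: \<open>w\<close> holds the place
  values and \<open>dig\<close> the digits, and the induction adds \<open>j\<close> as the most
  significant place. It numbers the rank one terms of a Hadamard product as well as the
  multi-indices within a group of tensor factors.\<close>

lemma mixed_radix:
  fixes n :: "'i \<Rightarrow> nat"
  assumes "finite A"
  shows "\<exists>w dig. (\<forall>a < prod n A. (\<Sum>i\<in>A. w i * dig i a) = a \<and> (\<forall>i\<in>A. dig i a < n i)) \<and>
    (\<forall>x. (\<forall>i\<in>A. x i < n i) \<longrightarrow> (\<exists>a < prod n A. \<forall>i\<in>A. dig i a = x i))"
  using assms
proof (induction A rule: finite_induct)
  case empty
  show ?case by auto
next
  case (insert j A)
  define N where "N = prod n A"
  obtain w dig where wd: "\<And>a. a < N \<Longrightarrow> (\<Sum>i\<in>A. w i * dig i a) = a"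
      "\<And>a i. a < N \<Longrightarrow> i \<in> A \<Longrightarrow> dig i a < n i"
    and ex: "\<And>x. (\<forall>i\<in>A. x i < n i) \<Longrightarrow> \<exists>a < N. \<forall>i\<in>A. dig i a = x i"
    using insert.IH unfolding N_def by blast
  define w' where "w' = w(j := N)"
  define dig' where "dig' i a = (if i = j then a div N else dig i (a mod N))" for i a
  have prodj: "prod n (insert j A) = n j * N" using insert by (simp add: N_def)
  show ?case unfolding prodj
  proof (intro exI[of _ w'] exI[of _ dig'] conjI allI impI ballI)
    fix a assume a: "a < n j * N"
    then have N: "N > 0" by (cases N) auto
    have "(\<Sum>i\<in>A. w' i * dig' i a) = (\<Sum>i\<in>A. w i * dig i (a mod N))"
      using insert.hyps by (intro sum.cong) (auto simp: w'_def dig'_def)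
    then show "(\<Sum>i\<in>insert j A. w' i * dig' i a) = a"
      using insert.hyps wd(1)[of "a mod N"] N by (simp add: w'_def dig'_def)
    fix i assume "i \<in> insert j A"
    then show "dig' i a < n i"
      using N wd(2)[of "a mod N" i] a by (auto simp: dig'_def less_mult_imp_div_less)
  next
    fix x assume x: "\<forall>i\<in>insert j A. x i < n i"
    then obtain a where a: "a < N" "\<forall>i\<in>A. dig i a = x i" using ex[of x] by auto
    have "x j * N + a < Suc (x j) * N" using a by simp
    also have "\<dots> \<le> n j * N" using x by (intro mult_right_mono) auto
    finally have "x j * N + a < n j * N" .
    moreover have "\<forall>i\<in>insert j A. dig' i (x j * N + a) = x i"
      using a by (auto simp: dig'_def)
    ultimately show "\<exists>a < n j * N. \<forall>i\<in>insert j A. dig' i a = x i" by blast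
  qed
qed

text \<open>The place values of a positional system separate bounded tuples; they supply the
  exponents of a Kronecker substitution.\<close>

lemma mixed_radix_inj:
  fixes n :: "'i \<Rightarrow> nat"
  assumes "finite A"
  shows "\<exists>w :: 'i \<Rightarrow> nat. \<forall>x y. (\<forall>i\<in>A. x i < n i) \<longrightarrow> (\<forall>i\<in>A. y i < n i) \<longrightarrow>
    (\<Sum>i\<in>A. w i * x i) = (\<Sum>i\<in>A. w i * y i) \<longrightarrow> (\<forall>i\<in>A. x i = y i)"
proof -
  obtain w dig where wd: "\<And>a. a < prod n A \<Longrightarrow> (\<Sum>i\<in>A. w i * dig i a) = a"
    and ex: "\<And>x. (\<forall>i\<in>A. x i < n i) \<Longrightarrow> \<exists>a < prod n A. \<forall>i\<in>A. dig i a = x i"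
    using mixed_radix[OF assms, of n] 
    apply (elim exE conjE)
    subgoal for w dig by (rule that[of w dig]) blast+
    done
  have dig: "dig j (\<Sum>i\<in>A. w i * x i) = x j" if x: "\<forall>i\<in>A. x i < n i" and j: "j \<in> A" for x j
  proof -
    obtain a where a: "a < prod n A" "\<forall>i\<in>A. dig i a = x i" using ex[OF x] by blast
    then have "(\<Sum>i\<in>A. w i * x i) = (\<Sum>i\<in>A. w i * dig i a)" by (intro sum.cong) auto
    then have "(\<Sum>i\<in>A. w i * x i) = a" using wd[OF a(1)] by (rule trans)
    then show ?thesis using a(2) j by simp
  qed
  show ?thesis
  proof (intro exI[of _ w] allI impI ballI)
    fix x y j
    assume x: "\<forall>i\<in>A. x i < n i" and y: "\<forall>i\<in>A. y i < n i"
      and eq: "(\<Sum>i\<in>A. w i * x i) = (\<Sum>i\<in>A. w i * y i)" and j: "j \<in> A"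
    show "x j = y j" using dig[OF x j] dig[OF y j] unfolding eq by simp
  qed
qed

section \<open>Forms\<close>

text \<open>\<open>homogeneous\<close> with the degree named, because the counting takes place in a
  single degree; 0 has every degree.\<close>

definition form :: "nat \<Rightarrow> ('v, 'a::zero) mpoly \<Rightarrow> bool" where
  "form e f \<longleftrightarrow> (\<forall>m\<in>Poly_Mapping.keys f. mono_degree m = e)"

lemma homogeneous_iff_form: "homogeneous f \<longleftrightarrow> (\<exists>e. form e f)"
  by (simp add: homogeneous_def form_def)

lemma form_mult: "form a f \<Longrightarrow> form b g \<Longrightarrow> form (a + b) (f * g)"
  unfolding form_def using keys_mult[of f g] by (fastforce simp: mono_degree_add)

lemma form_add: "form e f \<Longrightarrow> form e g \<Longrightarrow> form e (f + g)"
  unfolding form_def using keys_add[of f g] by blast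

lemma form_zero: "form e 0"
  by (simp add: form_def)

lemma form_sum: "(\<And>i. i \<in> A \<Longrightarrow> form e (f i)) \<Longrightarrow> form e (\<Sum>i\<in>A. f i)"
  by (induction A rule: infinite_finite_induct) (auto intro: form_add form_zero)

lemma form_single: "form (mono_degree m) (Poly_Mapping.single m c)"
  by (auto simp: form_def)

lemma form_const: "form 0 (Poly_Mapping.single 0 c)"
  using form_single[of 0 c] by (simp add: mono_degree_def)

lemma form_const_mult: "form e f \<Longrightarrow> form e (Poly_Mapping.single 0 c * f)"
  using form_mult[OF form_const] by fastforce

lemma form_one: "form 0 (1 :: ('v, 'a::field) mpoly)"
  using form_const[of "1 :: 'a"] by (simp add: single_one)

lemma form_power:
  fixes f :: "('v, 'a::field) mpoly"
  shows "form e f \<Longrightarrow> form (n * e) (f ^ n)"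
  by (induction n) (auto intro: form_one form_mult)

lemma form_prod:
  fixes f :: "'i \<Rightarrow> ('v, 'a::field) mpoly"
  shows "(\<And>i. i \<in> A \<Longrightarrow> form (e i) (f i)) \<Longrightarrow> form (\<Sum>i\<in>A. e i) (\<Prod>i\<in>A. f i)"
  by (induction A rule: infinite_finite_induct) (auto intro: form_one form_mult)

lemma poly_eval_const_mult: "poly_eval x (Poly_Mapping.single 0 c * f) = c * poly_eval x f"
  by (simp only: poly_eval_mult poly_eval_single) (simp add: mono_eval_def)

lemma poly_eval_one: "poly_eval x 1 = 1"
  unfolding single_one[symmetric] by (simp only: poly_eval_single) (simp add: mono_eval_def)

lemma poly_eval_power: "poly_eval x (f ^ n) = poly_eval x f ^ n"
  by (induction n) (simp_all add: poly_eval_mult poly_eval_one)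

lemma poly_eval_prod: "poly_eval x (\<Prod>i\<in>A. f i) = (\<Prod>i\<in>A. poly_eval x (f i))"
  by (induction A rule: infinite_finite_induct) (simp_all add: poly_eval_mult poly_eval_one)

lemma form_eval_scale:
  assumes "form e f"
  shows "poly_eval (\<lambda>v. c * x v) f = c ^ e * poly_eval x f"
  unfolding poly_eval_def sum_distrib_left using assms
  by (intro sum.cong) (auto simp: form_def mono_eval_scale ac_simps)

definition linear_form :: "'v set \<Rightarrow> ('v \<Rightarrow> 'a) \<Rightarrow> ('v, 'a::field) mpoly" where
  "linear_form I L = (\<Sum>v\<in>I. Poly_Mapping.single (Poly_Mapping.single v 1) (L v))"

lemma form_linear_form: "form 1 (linear_form I L)"
proof -
  have "form 1 (Poly_Mapping.single (Poly_Mapping.single v 1) (L v))" for v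
    using form_single[of "Poly_Mapping.single v 1" "L v"] by (simp add: mono_degree_def)
  then show ?thesis unfolding linear_form_def by (intro form_sum)
qed

lemma poly_eval_linear_form: "poly_eval x (linear_form I L) = (\<Sum>v\<in>I. L v * x v)"
  unfolding linear_form_def poly_eval_sum poly_eval_single by (simp add: mono_eval_def)

text \<open>The last conjunct makes the form a test for parameters that a parametrization sends to
  the zero vector, which is no projective point.\<close>

lemma exists_coordinate_form:
  fixes x :: "'v \<Rightarrow> 'a::field"
  assumes "x \<noteq> (\<lambda>_. 0)"
  shows "\<exists>f :: ('v, 'a) mpoly. form 1 f \<and> poly_eval x f \<noteq> 0 \<and> poly_eval (\<lambda>_. 0) f = 0"
proof -
  obtain v where "x v \<noteq> 0" using assms by auto
  then show ?thesis
    by (intro exI[of _ "linear_form {v} (\<lambda>_. 1)"])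
      (auto simp only: form_linear_form poly_eval_linear_form, auto)
qed

lemma line_poly_poly_eval:
  assumes "\<And>v. line_poly \<delta> (\<lambda>u. \<phi> u v)" "form e f"
  shows "line_poly (e * \<delta>) (\<lambda>u. poly_eval (\<phi> u) f)"
proof -
  have "line_poly (e * \<delta>) (\<lambda>u. mono_eval (\<phi> u) m)" if "m \<in> Poly_Mapping.keys f" for m
  proof -
    have "e * \<delta> = (\<Sum>v\<in>Poly_Mapping.keys m. Poly_Mapping.lookup m v * \<delta>)"
      using that assms(2) by (auto simp: form_def mono_degree_def sum_distrib_right)
    then show ?thesis
      unfolding mono_eval_def by (auto intro!: line_poly_prod line_poly_power assms(1))
  qed
  then show ?thesis unfolding poly_eval_def by (intro line_poly_sum line_poly_cmult)
qed

section \<open>Projective varieties given by a parametrization\<close>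

lemma closedin_subtopology_zariski:
  "closedin (subtopology (zariski I) X) C \<longleftrightarrow>
    (\<exists>S. (\<forall>f\<in>S. homogeneous f) \<and> C = X \<inter> proj_zeros I S)"
  unfolding closedin_subtopology closedin_zariski by blast

lemma proj_space_point_nonzero:
  assumes "P \<in> proj_space I" "x \<in> P"
  shows "x \<noteq> (\<lambda>_. 0)"
  using assms unfolding projectivization_def proj_class_def by (auto simp: fun_eq_iff)

lemma proj_space_point_nonempty:
  assumes "P \<in> proj_space I"
  shows "\<exists>x. x \<in> P"
  using assms unfolding projectivization_def proj_class_def by (auto intro: exI[of _ 1])

text \<open>The zero loci of \<open>f\<close> and \<open>g\<close> are closed in \<open>C\<close>
  and cover it. The one of \<open>f\<close> misses the point of \<open>x0\<close>, so by
  irreducibility the one of \<open>g\<close> is all of \<open>C\<close>.\<close>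

lemma irreducible_zero_divisor:
  fixes C :: "('v \<Rightarrow> 'a::field) set set"
  assumes "C \<subseteq> proj_space I" "irreducible_space (subtopology (zariski I) C)"
    and "form a f" "form b g" "\<And>x. x \<in> \<Union>C \<Longrightarrow> poly_eval x f * poly_eval x g = 0"
    and "x0 \<in> \<Union>C" "poly_eval x0 f \<noteq> 0" "x \<in> \<Union>C"
  shows "poly_eval x g = 0"
proof -
  have hom: "homogeneous f" "homogeneous g" using assms homogeneous_iff_form by blast+
  have top: "topspace (subtopology (zariski I) C) = C"
    using assms(1) by (auto simp: topspace_zariski)
  have "proj_zeros I {f} \<union> proj_zeros I {g} = proj_zeros I {f' * g' |f' g'. f' \<in> {f} \<and> g' \<in> {g}}"
    using hom by (intro proj_zeros_mult) auto
  then have "proj_zeros I {f} \<union> proj_zeros I {g} = proj_zeros I {f * g}" by simp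
  moreover have "C \<subseteq> proj_zeros I {f * g}"
    using assms(1,5) by (auto simp: proj_zeros_def poly_eval_mult)
  ultimately have un: "(C \<inter> proj_zeros I {f}) \<union> (C \<inter> proj_zeros I {g}) = C" by blast
  have cl: "closedin (subtopology (zariski I) C) (C \<inter> proj_zeros I {f})"
    "closedin (subtopology (zariski I) C) (C \<inter> proj_zeros I {g})"
    unfolding closedin_subtopology_zariski using hom by (metis singletonD)+
  have "C \<inter> proj_zeros I {f} \<noteq> C"
  proof
    assume "C \<inter> proj_zeros I {f} = C"
    then show False using assms(6,7) by (auto simp: proj_zeros_def)
  qed
  then have "C \<inter> proj_zeros I {g} = C"
    using assms(2) cl un unfolding irreducible_space_def top by blast
  then show ?thesis using assms(8) by (auto simp: proj_zeros_def)
qed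

section \<open>Upper bound: Hilbert functions along chains of irreducible closed sets\<close>

definition bounded_lists :: "nat \<Rightarrow> nat \<Rightarrow> nat list set" where
  "bounded_lists l n = {a. set a \<subseteq> {..n} \<and> length a = l}"

lemma finite_bounded_lists: "finite (bounded_lists l n)"
  unfolding bounded_lists_def by (rule finite_lists_length_eq) simp

lemma card_bounded_lists: "card (bounded_lists l n) = (n + 1) ^ l"
  unfolding bounded_lists_def by (subst card_lists_length_eq) auto

lemma sum_bounded_lists_Suc:
  "(\<Sum>a\<in>bounded_lists (Suc l) n. F a) = (\<Sum>b\<le>n. \<Sum>a\<in>bounded_lists l n. F (b # a))"
proof -
  have "bij_betw (\<lambda>(b, a). b # a) ({..n} \<times> bounded_lists l n) (bounded_lists (Suc l) n)"
    by (rule bij_betwI[where g = "\<lambda>a. (hd a, tl a)"])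
      (auto simp: bounded_lists_def length_Suc_conv)
  from sum.reindex_bij_betw[OF this, of F] show ?thesis
    by (simp add: sum.cartesian_product case_prod_unfold)
qed

text \<open>
  If \<open>f\<close> vanishes on \<open>C l\<close> but not on \<open>C (Suc l)\<close>, then the products of powers of \<open>f\<close> with forms
  independent on \<open>C l\<close> are independent on \<open>C (Suc l)\<close>; so the Hilbert function of \<open>C l\<close> grows at
  least like \<open>n\<^sup>l\<close>.
\<close>

lemma chain_independent_forms:
  fixes C :: "nat \<Rightarrow> ('v \<Rightarrow> 'a::field) set set"
  assumes X: "X \<subseteq> proj_space I"
    and "\<And>i. i \<le> l \<Longrightarrow> closedin (subtopology (zariski I) X) (C i)"
    and "\<And>i. i \<le> l \<Longrightarrow> irreducible_space (subtopology (zariski I) (C i))"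
    and "\<And>i. i < l \<Longrightarrow> C i \<subset> C (Suc i)"
  shows "\<exists>K. \<forall>n M. n * K \<le> M \<longrightarrow> (\<exists>g :: nat list \<Rightarrow> ('v, 'a) mpoly.
    (\<forall>a\<in>bounded_lists l n. form M (g a)) \<and>
    independent_family (\<Union>(C l)) (bounded_lists l n) (\<lambda>a x. poly_eval x (g a)))"
  using assms(2-)
proof (induction l)
  case 0
  then have "C 0 \<subseteq> X" by (auto simp: closedin_subtopology_zariski)
  have "topspace (subtopology (zariski I) (C 0)) \<noteq> {}"
    using 0 by (auto simp: irreducible_space_def)
  then obtain P where P: "P \<in> C 0" "P \<in> proj_space I" by (auto simp: topspace_zariski)
  then obtain x where x: "x \<in> P" using proj_space_point_nonempty by blast
  then obtain f :: "('v, 'a) mpoly" where f: "form 1 f" "poly_eval x f \<noteq> 0"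
    using exists_coordinate_form proj_space_point_nonzero P by metis
  have "form M (f ^ M)" for M using form_power[OF f(1), of M] by simp
  moreover have "independent_family (\<Union>(C 0)) (bounded_lists 0 n) (\<lambda>a x. poly_eval x (f ^ M))" for n M
  proof -
    have "bounded_lists 0 n = {[]}" by (auto simp: bounded_lists_def)
    then show ?thesis
      using P x f(2) unfolding independent_family_def by (auto simp: poly_eval_power)
  qed
  \<comment> \<open>There is only the empty list to serve, and the powers of a linear form that is
    nonzero at a point of \<open>C 0\<close> reach every degree, so \<open>K = 0\<close>
    works.\<close>
  ultimately show ?case by (intro exI[of _ 0] allI impI exI[of _ "\<lambda>_. f ^ _"]) auto
next
  case (Suc l)
  have sub: "C i \<subseteq> X" if "i \<le> Suc l" for i
    using Suc.prems(1)[OF that] by (auto simp: closedin_subtopology_zariski)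
  have "\<exists>K. \<forall>n M. n * K \<le> M \<longrightarrow> (\<exists>g :: nat list \<Rightarrow> ('v, 'a) mpoly.
    (\<forall>a\<in>bounded_lists l n. form M (g a)) \<and>
    independent_family (\<Union>(C l)) (bounded_lists l n) (\<lambda>a x. poly_eval x (g a)))"
    by (rule Suc.IH) (use Suc.prems in auto)
  then obtain K where K: "\<And>n M. n * K \<le> M \<Longrightarrow> \<exists>g :: nat list \<Rightarrow> ('v, 'a) mpoly.
    (\<forall>a\<in>bounded_lists l n. form M (g a)) \<and>
    independent_family (\<Union>(C l)) (bounded_lists l n) (\<lambda>a x. poly_eval x (g a))" by blast
  obtain S where S: "\<forall>f\<in>S. homogeneous f" "C l = X \<inter> proj_zeros I S"
    using Suc.prems(1)[of l] by (auto simp: closedin_subtopology_zariski)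
  obtain P where P: "P \<in> C (Suc l)" "P \<notin> C l" using Suc.prems(3)[of l] by auto
  then obtain f x0 where f: "f \<in> S" "x0 \<in> P" "poly_eval x0 f \<noteq> 0"
    using S sub[of "Suc l"] X unfolding proj_zeros_def by auto
  have x0: "x0 \<in> \<Union>(C (Suc l))" using f P by blast
  have fzero: "poly_eval x f = 0" if "x \<in> \<Union>(C l)" for x
    using that f S by (auto simp: proj_zeros_def)
  obtain e where e: "form e f" using S f homogeneous_iff_form by blast
  have "\<exists>g :: nat list \<Rightarrow> ('v, 'a) mpoly.
    (\<forall>a\<in>bounded_lists (Suc l) n. form M (g a)) \<and>
    independent_family (\<Union>(C (Suc l))) (bounded_lists (Suc l) n) (\<lambda>a x. poly_eval x (g a))"
    if M: "n * (K + e) \<le> M" for n M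
  proof -
    \<comment> \<open>The slope \<open>K + e\<close> leaves room: after the factor
      \<open>f ^ b\<close> the remaining degree is still at least \<open>n * K\<close>, as the
      induction hypothesis asks.\<close>
    have be: "b * e \<le> M \<and> n * K \<le> M - b * e" if "b \<le> n" for b
    proof -
      have "b * e \<le> n * e" using that by (rule mult_right_mono) simp
      moreover have "n * K + n * e \<le> M" using M by (simp add: distrib_left)
      ultimately show ?thesis by linarith
    qed
    then have "\<forall>b\<in>{..n}. \<exists>g :: nat list \<Rightarrow> ('v, 'a) mpoly.
        (\<forall>a\<in>bounded_lists l n. form (M - b * e) (g a)) \<and>
        independent_family (\<Union>(C l)) (bounded_lists l n) (\<lambda>a x. poly_eval x (g a))"
      using K by auto
    then obtain g :: "nat \<Rightarrow> nat list \<Rightarrow> ('v, 'a) mpoly" where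
      g: "\<And>b a. b \<le> n \<Longrightarrow> a \<in> bounded_lists l n \<Longrightarrow> form (M - b * e) (g b a)"
      and ind: "\<And>b. b \<le> n \<Longrightarrow>
        independent_family (\<Union>(C l)) (bounded_lists l n) (\<lambda>a x. poly_eval x (g b a))"
      by (metis atMost_iff)
    define g' where "g' a = f ^ hd a * g (hd a) (tl a)" for a
    have "form M (g' a)" if mem: "a \<in> bounded_lists (Suc l) n" for a
    proof -
      obtain b a' where a: "a = b # a'" "b \<le> n" "a' \<in> bounded_lists l n"
        using mem by (auto simp: bounded_lists_def length_Suc_conv)
      have "form (b * e + (M - b * e)) (g' a)"
        using form_mult[OF form_power[OF e] g] a by (simp add: g'_def)
      then show ?thesis using be a by simp
    qed
    moreover have "independent_family (\<Union>(C (Suc l))) (bounded_lists (Suc l) n) (\<lambda>a x. poly_eval x (g' a))"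
      unfolding independent_family_def
    proof (intro allI impI ballI)
      fix c a
      assume c: "\<forall>x\<in>\<Union>(C (Suc l)). (\<Sum>a\<in>bounded_lists (Suc l) n. c a * poly_eval x (g' a)) = 0"
        and a: "a \<in> bounded_lists (Suc l) n"
      define G where "G b = (\<Sum>a\<in>bounded_lists l n. Poly_Mapping.single 0 (c (b # a)) * g b a)" for b
      have Gform: "form (M - b * e) (G b)" if "b \<le> n" for b
        unfolding G_def using g that by (intro form_sum form_const_mult)
      have Geval: "poly_eval x (G b) = (\<Sum>a\<in>bounded_lists l n. c (b # a) * poly_eval x (g b a))" for x b
        by (simp add: G_def poly_eval_sum poly_eval_const_mult)
      have total: "(\<Sum>b\<le>n. poly_eval x f ^ b * poly_eval x (G b)) = 0" if "x \<in> \<Union>(C (Suc l))" for x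
        using bspec[OF c that] unfolding sum_bounded_lists_Suc Geval
        by (simp add: g'_def poly_eval_mult poly_eval_power sum_distrib_left ac_simps)
      \<comment> \<open>The \<open>G b\<close> are the coefficients of a polynomial in
        \<open>f\<close>. Once the lower ones vanish, \<open>f ^ b\<close> can be cancelled on the
        irreducible set \<open>C (Suc l)\<close>; on \<open>C l\<close>, where \<open>f\<close> is
        zero, only \<open>G b\<close> remains.\<close>
      have step: "\<forall>a\<in>bounded_lists l n. c (b # a) = 0" if "b \<le> n" for b
        using that
      proof (induction b rule: less_induct)
        case (less b)
        define H where "H = (\<Sum>j\<le>n - b. f ^ j * G (j + b))"
        have lower: "poly_eval x (G j) = 0" if "j < b" for j x
          using less that by (simp add: Geval)
        have fH: "poly_eval x (f ^ b) * poly_eval x H = 0" if x: "x \<in> \<Union>(C (Suc l))" for x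
        proof -
          have "(\<Sum>j\<le>n. poly_eval x f ^ j * poly_eval x (G j)) =
              (\<Sum>j\<in>{b..n}. poly_eval x f ^ j * poly_eval x (G j))"
            by (intro sum.mono_neutral_right) (auto simp: lower)
          also have "\<dots> = (\<Sum>j\<in>{0..n - b}. poly_eval x f ^ (j + b) * poly_eval x (G (j + b)))"
            using less.prems by (subst sum.shift_bounds_cl_nat_ivl[symmetric]) simp
          also have "\<dots> = poly_eval x (f ^ b) * poly_eval x H"
            by (simp add: H_def poly_eval_power poly_eval_sum poly_eval_mult sum_distrib_left
              power_add ac_simps atMost_atLeast0)
          finally show ?thesis using total[OF x] by simp
        qed
        have Hform: "form (M - b * e) H"
          unfolding H_def
        proof (rule form_sum)
          fix j assume j: "j \<in> {..n - b}"
          then have "j + b \<le> n" using less.prems by simp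
          then have "form (j * e + (M - (j + b) * e)) (f ^ j * G (j + b))" "(j + b) * e \<le> M"
            using form_mult[OF form_power[OF e] Gform] be by auto
          then show "form (M - b * e) (f ^ j * G (j + b))" by (simp add: algebra_simps)
        qed
        have "poly_eval x H = 0" if "x \<in> \<Union>(C (Suc l))" for x
          by (rule irreducible_zero_divisor[of "C (Suc l)" I _ "f ^ b" _ H x0])
            (use sub[of "Suc l"] X Suc.prems(2)[of "Suc l"] form_power[OF e] Hform fH x0 f that
              in \<open>auto simp: poly_eval_power\<close>)
        then have "poly_eval x H = 0" if "x \<in> \<Union>(C l)" for x
          using that Suc.prems(3)[of l] by blast
        moreover have "poly_eval x H = poly_eval x (G b)" if "x \<in> \<Union>(C l)" for x
        proof -
          have "poly_eval x H = (\<Sum>j\<le>n - b. 0 ^ j * poly_eval x (G (j + b)))"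
            using fzero[OF that] by (simp add: H_def poly_eval_sum poly_eval_mult poly_eval_power)
          also have "\<dots> = (\<Sum>j\<in>{0}. 0 ^ j * poly_eval x (G (j + b)))"
            by (intro sum.mono_neutral_right) (auto simp: power_0_left)
          finally show ?thesis by simp
        qed
        ultimately have "\<forall>x\<in>\<Union>(C l). (\<Sum>a\<in>bounded_lists l n. c (b # a) * poly_eval x (g b a)) = 0"
          by (simp add: Geval)
        with ind[OF less.prems] show ?case
          unfolding independent_family_def by (auto dest: spec[of _ "\<lambda>a. c (b # a)"])
      qed
      obtain b a' where "a = b # a'" "b \<le> n" "a' \<in> bounded_lists l n"
        using a by (auto simp: bounded_lists_def length_Suc_conv)
      then show "c a = 0" using step by blast
    qed
    ultimately show ?thesis by blast
  qed
  then show ?case by blast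
qed

text \<open>Growth of order q loses to growth of order l. With \<open>n = (K + 1) ^ q\<close> the
  constant factor \<open>(K + 1) ^ q\<close> is itself bounded by one more power of
  \<open>n + 1\<close>.\<close>

lemma exists_dominating_power:
  fixes K q l :: nat
  assumes "q < l"
  shows "\<exists>n. (n * K + 1) ^ q < (n + 1) ^ l"
proof -
  define n where "n = (K + 1) ^ q"
  have "(n * K + 1) ^ q \<le> ((K + 1) * (n + 1)) ^ q" by (intro power_mono) auto
  also have "\<dots> = n * (n + 1) ^ q" unfolding power_mult_distrib by (simp only: n_def)
  also have "\<dots> < (n + 1) ^ Suc q" by simp
  also have "\<dots> \<le> (n + 1) ^ l" using assms by (intro power_increasing) auto
  finally show ?thesis by blast
qed

text \<open>\<open>dense\<close> puts \<open>X\<close> into the Zariski closure of the image: it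
  carries a relation among pullbacks back to \<open>X\<close>, where it contradicts the independence
  of the forms on the largest member of the chain. The degree of \<phi> enters only through the
  constant \<open>K * \<delta>\<close>, which the growth comparison absorbs.\<close>

lemma krull_dim_le_card_parameters:
  fixes \<phi> :: "('w \<Rightarrow> 'a::field_char_0) \<Rightarrow> 'v \<Rightarrow> 'a"
  assumes X: "X \<subseteq> proj_space I" and V: "finite V"
    and \<phi>: "\<And>v. line_poly \<delta> (\<lambda>u. \<phi> u v)"
    and dense: "\<And>e f x. form e f \<Longrightarrow> (\<And>u. u \<in> affine_chart p V \<Longrightarrow> poly_eval (\<phi> u) f = 0) \<Longrightarrow>
      x \<in> \<Union>X \<Longrightarrow> poly_eval x f = 0"
  shows "krull_dim (subtopology (zariski I) X) \<le> ereal (real (card V))"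
  unfolding krull_dim_def
proof (rule Sup_least, clarsimp)
  fix l :: nat and C
  assume cl: "\<forall>i\<le>l. closedin (subtopology (zariski I) X) (C i) \<and>
      irreducible_space (subtopology (subtopology (zariski I) X) (C i))"
    and mono: "\<forall>i<l. C i \<subset> C (Suc i)"
  have sub: "C i \<subseteq> X" if "i \<le> l" for i
    using cl that by (auto simp: closedin_subtopology_zariski)
  have irr: "irreducible_space (subtopology (zariski I) (C i))" if "i \<le> l" for i
  proof -
    have "X \<inter> C i = C i" using sub[OF that] by blast
    then show ?thesis using cl that by (metis subtopology_subtopology)
  qed
  obtain K where K: "\<And>n M. n * K \<le> M \<Longrightarrow> \<exists>g :: nat list \<Rightarrow> ('v, 'a) mpoly.
    (\<forall>a\<in>bounded_lists l n. form M (g a)) \<and>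
    independent_family (\<Union>(C l)) (bounded_lists l n) (\<lambda>a x. poly_eval x (g a))"
    using chain_independent_forms[OF X, of l C] cl irr mono by blast
  show "l \<le> card V"
  proof (rule ccontr)
    assume "\<not> l \<le> card V"
    then obtain n where n: "(n * (K * \<delta>) + 1) ^ card V < (n + 1) ^ l"
      using exists_dominating_power[of "card V" l "K * \<delta>"] by auto
    obtain g :: "nat list \<Rightarrow> ('v, 'a) mpoly" where
      g: "\<And>a. a \<in> bounded_lists l n \<Longrightarrow> form (n * K) (g a)"
      and ind: "independent_family (\<Union>(C l)) (bounded_lists l n) (\<lambda>a x. poly_eval x (g a))"
      using K[of n "n * K"] by auto
    have "line_poly (n * (K * \<delta>)) (\<lambda>u. poly_eval (\<phi> u) (g a))" if "a \<in> bounded_lists l n" for a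
      using line_poly_poly_eval[OF \<phi> g[OF that]] by (simp add: mult.assoc)
    from line_poly_family_dependent[OF V finite_bounded_lists, of l n "n * (K * \<delta>)"
        "\<lambda>a u. poly_eval (\<phi> u) (g a)" p, OF this]
    obtain c where c: "\<exists>a\<in>bounded_lists l n. c a \<noteq> 0"
      "\<forall>u\<in>affine_chart p V. (\<Sum>a\<in>bounded_lists l n. c a * poly_eval (\<phi> u) (g a)) = 0"
      using n unfolding card_bounded_lists by blast
    define f where "f = (\<Sum>a\<in>bounded_lists l n. Poly_Mapping.single 0 (c a) * g a)"
    have eval: "poly_eval x f = (\<Sum>a\<in>bounded_lists l n. c a * poly_eval x (g a))" for x
      by (simp add: f_def poly_eval_sum poly_eval_const_mult)
    have "form (n * K) f" unfolding f_def using g by (intro form_sum form_const_mult)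
    moreover have "poly_eval (\<phi> u) f = 0" if "u \<in> affine_chart p V" for u
      using that c(2) by (simp add: eval)
    ultimately have "poly_eval x f = 0" if "x \<in> \<Union>X" for x
      using that by (rule dense)
    then have "\<forall>x\<in>\<Union>(C l). (\<Sum>a\<in>bounded_lists l n. c a * poly_eval x (g a)) = 0"
      using sub[of l] by (auto simp: eval)
    then have "\<forall>a\<in>bounded_lists l n. c a = 0"
      using ind unfolding independent_family_def by blast
    then show False using c(1) by blast
  qed
qed

section \<open>Lower bound: strict chains obtained by freeing parameters\<close>

text \<open>Kronecker substitution: setting \<open>h i\<close> to \<open>t ^ w i\<close> sends
  distinct monomials with exponents up to \<open>n\<close> to distinct powers of t, and a univariate
  polynomial that vanishes everywhere is zero.\<close>

lemma monomials_independent: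
  fixes c :: "('i \<Rightarrow> nat) \<Rightarrow> 'a::field_char_0"
  assumes "finite V" and B: "finite B" "B \<subseteq> PiE V (\<lambda>_. {..n})"
    and zero: "\<And>h. (\<And>i. i \<notin> V \<Longrightarrow> h i = 0) \<Longrightarrow> (\<Sum>a\<in>B. c a * (\<Prod>i\<in>V. h i ^ a i)) = 0"
    and b: "b \<in> B"
  shows "c b = 0"
proof -
  obtain w :: "'i \<Rightarrow> nat" where
    w: "\<And>x y. (\<forall>i\<in>V. x i < Suc n) \<Longrightarrow> (\<forall>i\<in>V. y i < Suc n) \<Longrightarrow>
      (\<Sum>i\<in>V. w i * x i) = (\<Sum>i\<in>V. w i * y i) \<Longrightarrow> (\<forall>i\<in>V. x i = y i)"
    using mixed_radix_inj[OF assms(1), of "\<lambda>_. Suc n"] by blast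
  define N where "N a = (\<Sum>i\<in>V. w i * a i)" for a
  have inj: "a = b" if "a \<in> B" "N a = N b" for a
  proof -
    have mem: "a \<in> PiE V (\<lambda>_. {..n})" "b \<in> PiE V (\<lambda>_. {..n})" using that b B(2) by blast+
    then have "\<forall>i\<in>V. a i < Suc n" "\<forall>i\<in>V. b i < Suc n" by (auto simp: less_Suc_eq_le PiE_mem)
    then have "\<forall>i\<in>V. a i = b i" using that(2) unfolding N_def by (intro w)
    then show ?thesis using mem by (metis PiE_ext)
  qed
  define Q where "Q = (\<Sum>a\<in>B. monom (c a) (N a))"
  have "poly Q t = 0" for t
  proof -
    have "poly Q t = (\<Sum>a\<in>B. c a * (\<Prod>i\<in>V. (if i \<in> V then t ^ w i else 0) ^ a i))"
      by (simp add: Q_def poly_sum poly_monom N_def power_sum power_mult)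
    also have "\<dots> = 0" by (rule zero) simp
    finally show ?thesis .
  qed
  then have "Q = 0" using poly_all_0_iff_0 by blast
  then have "0 = coeff Q (N b)" by simp
  also have "\<dots> = (\<Sum>a\<in>B. if a = b then c a else 0)"
    unfolding Q_def coeff_sum using inj by (intro sum.cong) auto
  also have "\<dots> = c b" using B(1) b by simp
  finally show ?thesis by simp
qed

text \<open>
  A first order expansion of \<open>g\<close> at \<open>p\<close> along the directions supported on \<open>V\<close>, with partial
  derivatives \<open>D\<close>.
\<close>

definition has_jet :: "('w \<Rightarrow> 'a::field_char_0) \<Rightarrow> 'w set \<Rightarrow> (('w \<Rightarrow> 'a) \<Rightarrow> 'a) \<Rightarrow> ('w \<Rightarrow> 'a) \<Rightarrow> bool" where
  "has_jet p V g D \<longleftrightarrow> (\<forall>h. (\<forall>w. w \<notin> V \<longrightarrow> h w = 0) \<longrightarrow>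
    (\<exists>P. (\<forall>s. g (\<lambda>w. p w + s * h w) = poly P s) \<and> coeff P 0 = g p \<and>
      coeff P 1 = (\<Sum>w\<in>V. h w * D w)))"

lemma has_jet_const: "has_jet p V (\<lambda>_. c) (\<lambda>_. 0)"
  unfolding has_jet_def
proof (intro allI impI)
  fix h :: "'a \<Rightarrow> 'b" show "\<exists>P. (\<forall>s. c = poly P s) \<and> coeff P 0 = c \<and> coeff P 1 = (\<Sum>w\<in>V. h w * 0)"
    by (intro exI[of _ "[:c:]"]) auto
qed

lemma has_jet_coord:
  assumes "finite V"
  shows "has_jet p V (\<lambda>u. u v) (\<lambda>w. if w = v then 1 else 0)"
  unfolding has_jet_def
proof (intro allI impI)
  fix h :: "'a \<Rightarrow> 'b" assume "\<forall>w. w \<notin> V \<longrightarrow> h w = 0"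
  then show "\<exists>P. (\<forall>s. p v + s * h v = poly P s) \<and> coeff P 0 = p v \<and>
      coeff P 1 = (\<Sum>w\<in>V. h w * (if w = v then 1 else 0))"
    using assms by (intro exI[of _ "[:p v, h v:]"]) (auto simp: if_distrib cong: if_cong)
qed

lemma has_jet_add:
  assumes "has_jet p V f D" "has_jet p V g E"
  shows "has_jet p V (\<lambda>u. f u + g u) (\<lambda>w. D w + E w)"
  unfolding has_jet_def
proof (intro allI impI)
  fix h :: "'a \<Rightarrow> 'b" assume h: "\<forall>w. w \<notin> V \<longrightarrow> h w = 0"
  obtain P where "\<forall>s. f (\<lambda>w. p w + s * h w) = poly P s" "coeff P 0 = f p"
      "coeff P 1 = (\<Sum>w\<in>V. h w * D w)"
    using assms(1) h unfolding has_jet_def by blast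
  moreover obtain Q where "\<forall>s. g (\<lambda>w. p w + s * h w) = poly Q s" "coeff Q 0 = g p"
      "coeff Q 1 = (\<Sum>w\<in>V. h w * E w)"
    using assms(2) h unfolding has_jet_def by blast
  ultimately show "\<exists>P. (\<forall>s. f (\<lambda>w. p w + s * h w) + g (\<lambda>w. p w + s * h w) = poly P s) \<and>
      coeff P 0 = f p + g p \<and> coeff P 1 = (\<Sum>w\<in>V. h w * (D w + E w))"
    by (intro exI[of _ "P + Q"]) (auto simp: sum.distrib distrib_left)
qed

lemma has_jet_mult:
  assumes "has_jet p V f D" "has_jet p V g E"
  shows "has_jet p V (\<lambda>u. f u * g u) (\<lambda>w. D w * g p + f p * E w)"
  unfolding has_jet_def
proof (intro allI impI)
  fix h :: "'a \<Rightarrow> 'b" assume h: "\<forall>w. w \<notin> V \<longrightarrow> h w = 0"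
  obtain P where P: "\<forall>s. f (\<lambda>w. p w + s * h w) = poly P s" "coeff P 0 = f p"
      "coeff P 1 = (\<Sum>w\<in>V. h w * D w)"
    using assms(1) h unfolding has_jet_def by blast
  obtain Q where Q: "\<forall>s. g (\<lambda>w. p w + s * h w) = poly Q s" "coeff Q 0 = g p"
      "coeff Q 1 = (\<Sum>w\<in>V. h w * E w)"
    using assms(2) h unfolding has_jet_def by blast
  have "coeff (P * Q) 1 = coeff P 1 * coeff Q 0 + coeff P 0 * coeff Q 1"
    by (simp add: coeff_mult)
  also have "\<dots> = (\<Sum>w\<in>V. h w * (D w * g p + f p * E w))"
    unfolding P Q by (simp add: sum.distrib distrib_left sum_distrib_left sum_distrib_right ac_simps)
  finally have "coeff (P * Q) 1 = (\<Sum>w\<in>V. h w * (D w * g p + f p * E w))" .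
  moreover have "coeff (P * Q) 0 = f p * g p" using P Q by (simp add: coeff_mult)
  ultimately show "\<exists>P. (\<forall>s. f (\<lambda>w. p w + s * h w) * g (\<lambda>w. p w + s * h w) = poly P s) \<and>
      coeff P 0 = f p * g p \<and> coeff P 1 = (\<Sum>w\<in>V. h w * (D w * g p + f p * E w))"
    using P(1) Q(1) by (intro exI[of _ "P * Q"]) auto
qed

lemma has_jet_cmult: "has_jet p V f D \<Longrightarrow> has_jet p V (\<lambda>u. c * f u) (\<lambda>w. c * D w)"
  using has_jet_mult[OF has_jet_const[of p V c], of f D] by simp

lemma has_jet_sum:
  "(\<And>i. i \<in> A \<Longrightarrow> has_jet p V (f i) (D i)) \<Longrightarrow>
    has_jet p V (\<lambda>u. \<Sum>i\<in>A. f i u) (\<lambda>w. \<Sum>i\<in>A. D i w)"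
  by (induction A rule: infinite_finite_induct) (simp_all add: has_jet_add has_jet_const)

lemma has_jet_prod:
  assumes "finite A" "\<And>i. i \<in> A \<Longrightarrow> has_jet p V (f i) (D i)"
  shows "has_jet p V (\<lambda>u. \<Prod>i\<in>A. f i u) (\<lambda>w. \<Sum>i\<in>A. D i w * (\<Prod>j\<in>A - {i}. f j p))"
  using assms
proof (induction A rule: finite_induct)
  case empty
  then show ?case by (simp add: has_jet_const)
next
  case (insert x A)
  have "(\<Sum>i\<in>insert x A. D i w * (\<Prod>j\<in>insert x A - {i}. f j p)) =
      D x w * (\<Prod>j\<in>A. f j p) + f x p * (\<Sum>i\<in>A. D i w * (\<Prod>j\<in>A - {i}. f j p))" for w
  proof -
    have "D i w * (\<Prod>j\<in>insert x A - {i}. f j p) = f x p * (D i w * (\<Prod>j\<in>A - {i}. f j p))"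
      if "i \<in> A" for i
    proof -
      have "insert x A - {i} = insert x (A - {i})" using insert.hyps that by auto
      then show ?thesis using insert.hyps by simp
    qed
    then have "(\<Sum>i\<in>A. D i w * (\<Prod>j\<in>insert x A - {i}. f j p)) =
        f x p * (\<Sum>i\<in>A. D i w * (\<Prod>j\<in>A - {i}. f j p))"
      unfolding sum_distrib_left by (intro sum.cong) auto
    moreover have "insert x A - {x} = A" using insert.hyps by auto
    ultimately show ?thesis using insert.hyps by simp
  qed
  moreover have "has_jet p V (\<lambda>u. f x u * (\<Prod>i\<in>A. f i u))
      (\<lambda>w. D x w * (\<Prod>j\<in>A. f j p) + f x p * (\<Sum>i\<in>A. D i w * (\<Prod>j\<in>A - {i}. f j p)))"
    using insert by (intro has_jet_mult) auto
  ultimately show ?case using insert.hyps by simp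
qed

text \<open>
  The vectors \<open>\<phi> p\<close> and \<open>D w\<close> (\<open>w \<in> V\<close>) are indexed by \<open>None\<close> and \<open>Some w\<close>. In coordinates dual to
  them the lowest order terms of the \<open>\<phi> (p + s h)\<close> are the coordinates of \<open>h\<close>, so that no relation
  among monomials in these coordinates can hold on the larger chart.
\<close>

lemma exists_form_separating_charts:
  fixes \<phi> :: "('w \<Rightarrow> 'a::field_char_0) \<Rightarrow> 'v \<Rightarrow> 'a"
  assumes V: "finite V" and I: "finite I"
    and \<phi>: "\<And>v. line_poly \<delta> (\<lambda>u. \<phi> u v)"
    and jet: "\<And>v. v \<in> I \<Longrightarrow> has_jet p V (\<lambda>u. \<phi> u v) (\<lambda>w. D w v)"
    and ind: "independent_family I (insert None (Some ` V)) (case_option (\<phi> p) D)"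
    and W: "W \<subset> V'" "V' \<subseteq> V"
  shows "\<exists>e f. form e f \<and> (\<forall>u\<in>affine_chart p W. poly_eval (\<phi> u) f = 0) \<and>
    (\<exists>u\<in>affine_chart p V'. poly_eval (\<phi> u) f \<noteq> 0)"
proof -
  have V': "finite V'" using W(2) V by (rule finite_subset)
  have cardW: "card W < card V'" using W(1) V' by (rule psubset_card_mono[rotated])
  define k where "k = card V'"
  \<comment> \<open>With this \<open>n\<close> the monomials with one variable for each element of
    \<open>V'\<close> and exponents up to \<open>n\<close> outnumber the grid that controls their
    pullbacks to the smaller chart.\<close>
  obtain n where n: "(n * (k * \<delta>) + 1) ^ card W < (n + 1) ^ k"
    using exists_dominating_power[of "card W" k "k * \<delta>"] cardW by (auto simp: k_def)
  define A where "A = PiE V' (\<lambda>_. {..n})"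
  have A: "finite A" "card A = (n + 1) ^ k"
    using V' by (auto simp: A_def k_def card_PiE intro: finite_PiE)
  obtain L where L: "\<And>b b'. b \<in> insert None (Some ` V) \<Longrightarrow> b' \<in> insert None (Some ` V) \<Longrightarrow>
      (\<Sum>x\<in>I. L b x * case_option (\<phi> p) D b' x) = (if b = b' then 1 else 0)"
    using independent_family_dual[OF _ I ind] V by blast
  define M where "M = n * k"
  define deg where "deg a = (\<Sum>w\<in>V'. a w)" for a :: "'w \<Rightarrow> nat"
  have deg: "deg a \<le> M" if "a \<in> A" for a
  proof -
    have "(\<Sum>w\<in>V'. a w) \<le> (\<Sum>w\<in>V'. n)" using that by (intro sum_mono) (auto simp: A_def PiE_mem)
    then show ?thesis by (simp add: deg_def M_def k_def mult.commute)
  qed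
  \<comment> \<open>The linear form dual to \<open>\<phi> p\<close> has value 1 there and serves as
    homogenizing variable: it brings every monomial to degree \<open>M\<close>.\<close>
  define g where "g a = linear_form I (L None) ^ (M - deg a) *
      (\<Prod>w\<in>V'. linear_form I (L (Some w)) ^ a w)" for a
  have gform: "form M (g a)" if "a \<in> A" for a
  proof -
    have "form ((M - deg a) * 1 + (\<Sum>w\<in>V'. a w * 1)) (g a)"
      unfolding g_def by (intro form_mult form_power form_prod form_linear_form)
    then show ?thesis using deg[OF that] by (simp add: deg_def)
  qed
  have "line_poly (n * (k * \<delta>)) (\<lambda>u. poly_eval (\<phi> u) (g a))" if "a \<in> A" for a
    using line_poly_poly_eval[OF \<phi> gform[OF that]] by (simp add: M_def mult.assoc)
  moreover have "finite W" using W V' by (meson finite_subset psubset_imp_subset)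
  ultimately have "\<exists>c. (\<exists>a\<in>A. c a \<noteq> 0) \<and>
      (\<forall>u\<in>affine_chart p W. (\<Sum>a\<in>A. c a * poly_eval (\<phi> u) (g a)) = 0)"
    using n A by (intro line_poly_family_dependent[where D = "n * (k * \<delta>)"]) auto
  then obtain c where c: "\<exists>a\<in>A. c a \<noteq> 0"
    "\<And>u. u \<in> affine_chart p W \<Longrightarrow> (\<Sum>a\<in>A. c a * poly_eval (\<phi> u) (g a)) = 0" by blast
  define f where "f = (\<Sum>a\<in>A. Poly_Mapping.single 0 (c a) * g a)"
  have eval: "poly_eval x f = (\<Sum>a\<in>A. c a * poly_eval x (g a))" for x
    by (simp add: f_def poly_eval_sum poly_eval_const_mult)
  have "form M f" unfolding f_def using gform by (intro form_sum form_const_mult)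
  moreover have "\<exists>u\<in>affine_chart p V'. poly_eval (\<phi> u) f \<noteq> 0"
  proof (rule ccontr)
    assume "\<not> ?thesis"
    then have zero: "poly_eval (\<phi> u) f = 0" if "u \<in> affine_chart p V'" for u using that by blast
    define A' where "A' = {a \<in> A. c a \<noteq> 0}"
    have A': "finite A'" "A' \<noteq> {}" using A c by (auto simp: A'_def)
    \<comment> \<open>Along p + s h a monomial of degree e is divisible by the e-th power of s, so
      the monomials of lowest degree alone give the leading coefficient.\<close>
    define \<mu> where "\<mu> = Min (deg ` A')"
    have \<mu>: "\<mu> \<le> deg a" if "a \<in> A'" for a using A' that by (simp add: \<mu>_def)
    have "\<mu> \<in> deg ` A'" unfolding \<mu>_def using A' by (intro Min_in) auto
    then obtain b where b: "b \<in> A'" "deg b = \<mu>" by auto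
    define B where "B = {a \<in> A'. deg a = \<mu>}"
    have low: "(\<Sum>a\<in>B. c a * (\<Prod>w\<in>V'. h w ^ a w)) = 0" if h: "\<And>w. w \<notin> V' \<Longrightarrow> h w = 0" for h
    proof -
      define J where "J b x = (\<Sum>v\<in>I. L b v * x v)" for b x
      have "\<exists>Q. (\<forall>s. J b (\<phi> (\<lambda>w. p w + s * h w)) = poly Q s) \<and> coeff Q 0 = J b (\<phi> p) \<and>
          coeff Q 1 = (\<Sum>w\<in>V. h w * J b (D w))" for b
      proof -
        have "has_jet p V (\<lambda>u. J b (\<phi> u)) (\<lambda>w. J b (D w))"
          unfolding J_def using jet by (intro has_jet_sum has_jet_cmult)
        moreover have "\<forall>w. w \<notin> V \<longrightarrow> h w = 0" using h W by blast
        ultimately show ?thesis unfolding has_jet_def by blast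
      qed
      then obtain Q where Q: "\<And>b s. J b (\<phi> (\<lambda>w. p w + s * h w)) = poly (Q b) s"
        "\<And>b. coeff (Q b) 0 = J b (\<phi> p)" "\<And>b. coeff (Q b) 1 = (\<Sum>w\<in>V. h w * J b (D w))"
        by metis
      have JD: "J (Some w) (D w') = (if w = w' then 1 else 0)" if "w \<in> V" "w' \<in> V" for w w'
        using L[of "Some w" "Some w'"] that by (simp add: J_def)
      have J0: "J (Some w) (\<phi> p) = 0" if "w \<in> V" for w
        using L[of "Some w" None] that by (simp add: J_def)
      have J00: "J None (\<phi> p) = 1"
        using L[of None None] by (simp add: J_def)
      have QN: "poly (Q None) 0 = 1" using Q(2)[of None] J00 by (simp add: poly_0_coeff_0)
      \<comment> \<open>The coordinate dual to \<open>D w\<close> vanishes at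
        \<open>\<phi> p\<close> and has derivative \<open>h w\<close> along the line: a factor s
        splits off and leaves the value \<open>h w\<close> at s = 0.\<close>
      have "\<exists>R. Q (Some w) = [:0, 1:] * R \<and> poly R 0 = h w" if w: "w \<in> V'" for w
      proof -
        have wV: "w \<in> V" using w W by blast
        obtain a R where R: "Q (Some w) = pCons a R" by (cases "Q (Some w)")
        have "a = 0" using Q(2)[of "Some w"] R J0[OF wV] by simp
        moreover have "poly R 0 = coeff (Q (Some w)) 1" by (simp add: R poly_0_coeff_0)
        moreover have "(\<Sum>w'\<in>V. h w' * J (Some w) (D w')) = (\<Sum>w'\<in>V. if w' = w then h w else 0)"
          using wV by (intro sum.cong) (auto simp: JD)
        ultimately have "poly R 0 = h w" using wV V Q(3)[of "Some w"] by simp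
        with \<open>a = 0\<close> show ?thesis by (intro exI[of _ R]) (simp add: R)
      qed
      then obtain R where R: "\<And>w. w \<in> V' \<Longrightarrow> Q (Some w) = [:0, 1:] * R w"
          "\<And>w. w \<in> V' \<Longrightarrow> poly (R w) 0 = h w" by metis
      define T where "T a = smult (c a) (Q None ^ (M - deg a) * (\<Prod>w\<in>V'. R w ^ a w))" for a
      have summand: "c a * poly_eval (\<phi> (\<lambda>w. p w + s * h w)) (g a) = poly ([:0, 1:] ^ deg a * T a) s" for a s
      proof -
        have "(\<Prod>w\<in>V'. poly (Q (Some w)) s ^ a w) = (\<Prod>w\<in>V'. s ^ a w * poly (R w) s ^ a w)"
          by (intro prod.cong) (auto simp: R(1) power_mult_distrib)
        also have "\<dots> = s ^ deg a * (\<Prod>w\<in>V'. poly (R w) s ^ a w)"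
          by (simp add: prod.distrib deg_def power_sum)
        finally show ?thesis
          by (simp add: g_def poly_eval_mult poly_eval_power poly_eval_prod poly_eval_linear_form
              T_def poly_prod poly_power flip: J_def Q(1))
      qed
      define S where "S = (\<Sum>a\<in>A'. [:0, 1:] ^ (deg a - \<mu>) * T a)"
      have "poly ([:0, 1:] ^ \<mu> * S) s = 0" for s
      proof -
        have "(\<lambda>w. p w + s * h w) \<in> affine_chart p V'" using h by (auto simp: affine_chart_def)
        then have "0 = (\<Sum>a\<in>A. c a * poly_eval (\<phi> (\<lambda>w. p w + s * h w)) (g a))"
          using zero by (simp add: eval)
        also have "\<dots> = (\<Sum>a\<in>A'. c a * poly_eval (\<phi> (\<lambda>w. p w + s * h w)) (g a))"
          using A by (intro sum.mono_neutral_right) (auto simp: A'_def)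
        also have "\<dots> = (\<Sum>a\<in>A'. poly ([:0, 1:] ^ \<mu> * ([:0, 1:] ^ (deg a - \<mu>) * T a)) s)"
        proof (intro sum.cong refl)
          fix a assume "a \<in> A'"
          then have "deg a = \<mu> + (deg a - \<mu>)" using \<mu> by simp
          then show "c a * poly_eval (\<phi> (\<lambda>w. p w + s * h w)) (g a) =
              poly ([:0, 1:] ^ \<mu> * ([:0, 1:] ^ (deg a - \<mu>) * T a)) s"
            unfolding summand by (metis power_add mult.assoc)
        qed
        also have "\<dots> = poly ([:0, 1:] ^ \<mu> * S) s"
          unfolding S_def sum_distrib_left poly_sum ..
        finally show ?thesis by simp
      qed
      then have "[:0, 1:] ^ \<mu> * S = 0" using poly_all_0_iff_0 by blast
      then have "S = 0" by simp
      \<comment> \<open>At s = 0 the factor \<open>0 ^ (deg a - \<mu>)\<close> is 1 exactly for the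
        exponents in \<open>B\<close>.\<close>
      then have "0 = (\<Sum>a\<in>A'. 0 ^ (deg a - \<mu>) * poly (T a) 0)"
        by (auto simp: S_def poly_sum dest: arg_cong[of _ _ "\<lambda>P. poly P 0"])
      also have "\<dots> = (\<Sum>a\<in>B. poly (T a) 0)"
        using A' \<mu> by (intro sum.mono_neutral_cong_right) (auto simp: B_def power_0_left intro: antisym)
      also have "\<dots> = (\<Sum>a\<in>B. c a * (\<Prod>w\<in>V'. h w ^ a w))"
        by (intro sum.cong) (auto simp: T_def QN poly_prod R(2))
      finally show ?thesis by simp
    qed
    have "c b = 0"
    proof (rule monomials_independent[OF V'])
      show "finite B" using A' by (simp add: B_def)
      show "B \<subseteq> PiE V' (\<lambda>_. {..n})" "b \<in> B" using b by (auto simp: B_def A'_def A_def)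
      fix h :: "'w \<Rightarrow> 'a" assume "\<And>w. w \<notin> V' \<Longrightarrow> h w = 0"
      then show "(\<Sum>a\<in>B. c a * (\<Prod>w\<in>V'. h w ^ a w)) = 0" by (rule low)
    qed
    then show False using b by (simp add: A'_def)
  qed
  ultimately show ?thesis using c(2) by (metis eval)
qed

text \<open>The members of the chain are the closures in \<open>X\<close> of the images of charts
  with the first i parameters free. They are irreducible because functions that are polynomial along
  lines have no zero divisors, and the separating forms make the inclusions strict.\<close>

lemma card_parameters_le_krull_dim:
  fixes \<phi> :: "('w \<Rightarrow> 'a::field_char_0) \<Rightarrow> 'v \<Rightarrow> 'a"
  assumes X: "X \<subseteq> proj_space I" and V: "finite V" and I: "finite I"
    and \<phi>: "\<And>v. line_poly \<delta> (\<lambda>u. \<phi> u v)"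
    and image: "projectivization (\<phi> ` affine_chart p V) \<subseteq> X"
    and jet: "\<And>v. v \<in> I \<Longrightarrow> has_jet p V (\<lambda>u. \<phi> u v) (\<lambda>w. D w v)"
    and ind: "independent_family I (insert None (Some ` V)) (case_option (\<phi> p) D)"
  shows "ereal (real (card V)) \<le> krull_dim (subtopology (zariski I) X)"
proof -
  define vanish where "vanish W = {f. homogeneous f \<and> (\<forall>u\<in>affine_chart p W. poly_eval (\<phi> u) f = 0)}"
    for W
  define Z where "Z W = X \<inter> proj_zeros I (vanish W)" for W
  have p0: "\<phi> p \<noteq> (\<lambda>_. 0)"
  proof
    assume "\<phi> p = (\<lambda>_. 0)"
    then have "\<forall>x\<in>I. (\<Sum>b\<in>insert None (Some ` V). (if b = None then 1 else 0) * case_option (\<phi> p) D b x) = 0"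
      using V by (simp add: sum.reindex)
    then show False
      using ind[unfolded independent_family_def, rule_format, of "\<lambda>b. if b = None then 1 else 0" None] by auto
  qed
  \<comment> \<open>Multiplying by \<open>h0\<close> discards the parameters with
    \<open>\<phi> u = 0\<close>, which define no point, without making a nonzero function vanish
    identically.\<close>
  obtain h0 :: "('v, 'a) mpoly" where h0: "form 1 h0" "poly_eval (\<phi> p) h0 \<noteq> 0" "poly_eval (\<lambda>_. 0) h0 = 0"
    using exists_coordinate_form[OF p0] by blast
  have self: "x \<in> proj_class x" for x :: "'v \<Rightarrow> 'a"
    unfolding proj_class_def by (auto intro: exI[of _ 1])
  have point: "proj_class (\<phi> u) \<in> Z W"
    if "W \<subseteq> V" "u \<in> affine_chart p W" "\<phi> u \<noteq> (\<lambda>_. 0)" for W u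
  proof -
    have "proj_class (\<phi> u) \<in> X"
      using image that affine_chart_mono[of W V] unfolding projectivization_def by blast
    moreover have "poly_eval x f = 0" if x: "x \<in> proj_class (\<phi> u)" and f: "f \<in> vanish W" for x f
    proof -
      obtain c where "x = (\<lambda>v. c * \<phi> u v)" using x by (auto simp: proj_class_def)
      then show ?thesis
        using f \<open>u \<in> affine_chart p W\<close> by (auto simp: vanish_def homogeneous_iff_form form_eval_scale)
    qed
    ultimately show ?thesis using X by (auto simp: Z_def proj_zeros_def)
  qed
  have lp: "\<exists>E. line_poly E (\<lambda>u. poly_eval (\<phi> u) f)" if hom: "homogeneous f" for f
  proof -
    obtain e where "form e f" using hom homogeneous_iff_form by blast
    then show ?thesis using line_poly_poly_eval[of \<delta> \<phi> e f] \<phi> by blast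
  qed
  have Zsub: "Z W \<subseteq> X" for W by (auto simp: Z_def)
  have closed: "closedin (subtopology (zariski I) X) (Z W)" for W
    unfolding closedin_subtopology_zariski Z_def
    by (intro exI[of _ "vanish W"]) (simp add: vanish_def)
  have irr: "irreducible_space (subtopology (subtopology (zariski I) X) (Z W))" if W: "W \<subseteq> V" for W
  proof -
    have "X \<inter> Z W = Z W" using Zsub by blast
    then have eq: "subtopology (subtopology (zariski I) X) (Z W) = subtopology (zariski I) (Z W)"
      by (simp add: subtopology_subtopology)
    have top: "topspace (subtopology (zariski I) (Z W)) = Z W"
      using Zsub X by (auto simp: topspace_zariski)
    have ne: "Z W \<noteq> {}" using point[OF W affine_chart_base p0] by blast
    have "A = Z W \<or> B = Z W"
      if AB: "closedin (subtopology (zariski I) (Z W)) A" "closedin (subtopology (zariski I) (Z W)) B"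
        "A \<union> B = Z W" for A B
    proof (rule ccontr)
      assume not: "\<not> ?thesis"
      have sep: "\<exists>f u. homogeneous f \<and> u \<in> affine_chart p W \<and> poly_eval (\<phi> u) f \<noteq> 0 \<and>
          (\<forall>P\<in>A. \<forall>x\<in>P. poly_eval x f = 0)"
        if A: "closedin (subtopology (zariski I) (Z W)) A" "A \<noteq> Z W" for A
      proof -
        obtain S where S: "\<forall>f\<in>S. homogeneous f" "A = Z W \<inter> proj_zeros I S"
          using A(1) unfolding closedin_subtopology_zariski by blast
        obtain P where "P \<in> Z W" "P \<notin> A" using A S by blast
        then obtain f x where f: "f \<in> S" "x \<in> P" "poly_eval x f \<noteq> 0"
          using S Zsub X unfolding proj_zeros_def by blast
        then have "f \<notin> vanish W" using \<open>P \<in> Z W\<close> by (auto simp: Z_def proj_zeros_def)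
        then show ?thesis using S f by (auto simp: vanish_def proj_zeros_def)
      qed
      obtain f u1 where f: "homogeneous f" "u1 \<in> affine_chart p W" "poly_eval (\<phi> u1) f \<noteq> 0"
          "\<forall>P\<in>A. \<forall>x\<in>P. poly_eval x f = 0" using sep AB(1) not by blast
      obtain g u2 where g: "homogeneous g" "u2 \<in> affine_chart p W" "poly_eval (\<phi> u2) g \<noteq> 0"
          "\<forall>P\<in>B. \<forall>x\<in>P. poly_eval x g = 0" using sep AB(2) not by blast
      have gh: "homogeneous (g * h0)" "homogeneous h0"
        using g(1) h0(1) homogeneous_iff_form homogeneous_mult by blast+
      obtain E1 E2 E3 where E: "line_poly E1 (\<lambda>u. poly_eval (\<phi> u) f)"
        "line_poly E2 (\<lambda>u. poly_eval (\<phi> u) (g * h0))" "line_poly E3 (\<lambda>u. poly_eval (\<phi> u) g)"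
        using lp f(1) gh g(1) by meson
      obtain E4 where E4: "line_poly E4 (\<lambda>u. poly_eval (\<phi> u) h0)" using lp gh by blast
      have "poly_eval (\<phi> u) f * poly_eval (\<phi> u) (g * h0) = 0" if u: "u \<in> affine_chart p W" for u
      proof (cases "\<phi> u = (\<lambda>_. 0)")
        case True
        then show ?thesis using h0 by (simp add: poly_eval_mult)
      next
        case False
        then have "proj_class (\<phi> u) \<in> A \<union> B" using point[OF W u] \<open>A \<union> B = Z W\<close> by blast
        then show ?thesis using f(4) g(4) self by (auto simp: poly_eval_mult)
      qed
      from line_poly_zero_divisor[OF E(1,2) this f(2,3)]
      have "poly_eval (\<phi> u) g * poly_eval (\<phi> u) h0 = 0" if "u \<in> affine_chart p W" for u
        using that by (simp add: poly_eval_mult)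
      from line_poly_zero_divisor[OF E(3) E4 this g(2,3) affine_chart_base] h0(2)
      show False by blast
    qed
    then show ?thesis unfolding eq irreducible_space_def top using ne by blast
  qed
  have mono: "Z W \<subset> Z W'" if W: "W \<subset> W'" "W' \<subseteq> V" for W W'
  proof
    have "vanish W' \<subseteq> vanish W"
      using affine_chart_mono[of W W' p] W by (auto simp: vanish_def)
    then show "Z W \<subseteq> Z W'" by (auto simp: Z_def proj_zeros_def)
    obtain e f u where f: "form e f" "\<forall>u\<in>affine_chart p W. poly_eval (\<phi> u) f = 0"
        "u \<in> affine_chart p W'" "poly_eval (\<phi> u) f \<noteq> 0"
      using exists_form_separating_charts[OF V I \<phi> jet ind W] by blast
    have "\<exists>u\<in>affine_chart p W'. poly_eval (\<phi> u) h0 \<noteq> 0 \<and> poly_eval (\<phi> u) f \<noteq> 0"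
    proof (rule ccontr)
      assume "\<not> ?thesis"
      then have *: "poly_eval (\<phi> u) f * poly_eval (\<phi> u) h0 = 0" if "u \<in> affine_chart p W'" for u
        using that by auto
      show False
        using line_poly_zero_divisor[OF line_poly_poly_eval[OF \<phi> f(1)]
            line_poly_poly_eval[OF \<phi> h0(1)] * f(3,4) affine_chart_base] h0(2) by blast
    qed
    then obtain u where u: "u \<in> affine_chart p W'" "poly_eval (\<phi> u) h0 \<noteq> 0" "poly_eval (\<phi> u) f \<noteq> 0"
      by blast
    then have "\<phi> u \<noteq> (\<lambda>_. 0)" using h0(3) by metis
    then have "proj_class (\<phi> u) \<in> Z W'" using point W u(1) by blast
    moreover have "proj_class (\<phi> u) \<notin> Z W"
    proof -
      have "f \<in> vanish W" using f homogeneous_iff_form by (auto simp: vanish_def)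
      then show ?thesis using u(3) self[of "\<phi> u"] by (auto simp: Z_def proj_zeros_def)
    qed
    ultimately show "Z W \<noteq> Z W'" by blast
  qed
  obtain e where e: "bij_betw e {0..<card V} V"
    using ex_bij_betw_nat_finite[OF V] by blast
  have sub: "e ` {..<i} \<subseteq> V" if "i \<le> card V" for i
    using e that by (auto simp: bij_betw_def)
  have "e ` {..<i} \<subset> e ` {..<Suc i}" if "i < card V" for i
  proof -
    have "e i \<notin> e ` {..<i}"
      using e that by (auto simp: bij_betw_def dest!: inj_onD)
    then show ?thesis by auto
  qed
  then have "\<forall>i<card V. Z (e ` {..<i}) \<subset> Z (e ` {..<Suc i})"
    using mono sub by (simp add: Suc_leI)
  then have "\<exists>C. (\<forall>i\<le>card V. closedin (subtopology (zariski I) X) (C i) \<and>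
      irreducible_space (subtopology (subtopology (zariski I) X) (C i))) \<and>
      (\<forall>i<card V. C i \<subset> C (Suc i))"
    using closed irr sub by (intro exI[of _ "\<lambda>i. Z (e ` {..<i})"]) auto
  then show ?thesis
    unfolding krull_dim_def by (intro Sup_upper) blast
qed

section \<open>An infinitesimal form of Kruskal's criterion\<close>

lemma lagrange_basis:
  fixes \<theta> :: "nat \<Rightarrow> 'a::field"
  assumes "finite T" "inj \<theta>" "T \<noteq> {}"
  shows "\<exists>\<L>. (\<forall>t\<in>T. degree (\<L> t) < card T \<and> (\<forall>s\<in>T. poly (\<L> t) (\<theta> s) = (if s = t then 1 else 0))) \<and>
    (\<forall>f. degree f < card T \<longrightarrow> f = (\<Sum>t\<in>T. smult (poly f (\<theta> t)) (\<L> t)))"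
proof -
  define N where "N t = (\<Prod>s\<in>T - {t}. [:- \<theta> s, 1:])" for t
  define \<L> where "\<L> t = smult (inverse (poly (N t) (\<theta> t))) (N t)" for t
  have deg: "degree (\<L> t) < card T" if "t \<in> T" for t
  proof -
    have "degree (N t) \<le> (\<Sum>s\<in>T - {t}. degree [:- \<theta> s, 1:])"
      unfolding N_def by (rule degree_prod_sum_le[unfolded o_def]) (use assms in auto)
    also have "\<dots> = card T - 1" using that assms by simp
    finally show ?thesis using that assms(1) card_gt_0_iff[of T]
      by (auto simp: \<L>_def intro: le_less_trans[OF degree_smult_le])
  qed
  have N0: "poly (N t) (\<theta> t) \<noteq> 0" for t
    using assms by (auto simp: N_def poly_prod inj_eq)
  have \<L>: "poly (\<L> t) (\<theta> s) = (if s = t then 1 else 0)" if "s \<in> T" for s t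
    using that N0[of t] assms(1) by (auto simp: \<L>_def) (auto simp: N_def poly_prod)
  have "f = (\<Sum>t\<in>T. smult (poly f (\<theta> t)) (\<L> t))" if f: "degree f < card T" for f
  proof (rule ccontr)
    define d where "d = f - (\<Sum>t\<in>T. smult (poly f (\<theta> t)) (\<L> t))"
    assume "\<not> ?thesis"
    then have d0: "d \<noteq> 0" by (simp add: d_def)
    have "degree (\<Sum>t\<in>T. smult (poly f (\<theta> t)) (\<L> t)) < card T"
      using deg assms by (intro degree_sum_less) (auto simp: card_gt_0_iff intro: le_less_trans[OF degree_smult_le])
    then have "degree d < card T" unfolding d_def using f by (intro degree_diff_less)
    moreover have "poly d (\<theta> s) = 0" if "s \<in> T" for s
      using that assms(1) by (simp add: d_def poly_sum \<L> if_distrib cong: if_cong)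
    then have "card (\<theta> ` T) \<le> card {x. poly d x = 0}"
      using poly_roots_finite[OF d0] by (intro card_mono) auto
    then have "card T \<le> card {x. poly d x = 0}"
      using assms(2) by (simp add: card_image inj_on_subset)
    ultimately show False using card_poly_roots_bound[OF d0] by simp
  qed
  then show ?thesis using deg \<L> by (intro exI[of _ \<L>]) blast
qed

text \<open>The coefficients of \<open>f\<close> applied to the vector with entries
  \<open>x ^ a * \<rho> a\<close>: a tangent direction at (1, x, x^2, ...) written relative to that
  point. A constant \<rho> is the radial direction.\<close>

definition weighted_eval :: "nat \<Rightarrow> 'a::field \<Rightarrow> (nat \<Rightarrow> 'a) \<Rightarrow> 'a poly \<Rightarrow> 'a" where
  "weighted_eval n x \<rho> f = (\<Sum>a<n. coeff f a * x ^ a * \<rho> a)"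

lemma weighted_eval_sum_smult:
  "weighted_eval n x \<rho> (\<Sum>t\<in>T. smult (c t) (f t)) = (\<Sum>t\<in>T. c t * weighted_eval n x \<rho> (f t))"
  unfolding weighted_eval_def coeff_sum sum_distrib_right sum_distrib_left
  by (subst sum.swap) (simp add: ac_simps)

lemma weighted_eval_const:
  assumes "degree f < n"
  shows "weighted_eval n x (\<lambda>_. c) f = c * poly f x"
proof -
  have "poly f x = (\<Sum>a<n. coeff f a * x ^ a)"
    unfolding poly_altdef using assms
    by (intro sum.mono_neutral_left) (auto simp: coeff_eq_0)
  then show ?thesis by (simp add: weighted_eval_def sum_distrib_left ac_simps)
qed

definition vanishing_poly :: "(nat \<Rightarrow> 'a::field) \<Rightarrow> nat set \<Rightarrow> 'a poly" where
  "vanishing_poly \<theta> N = (\<Prod>j\<in>N. [:- \<theta> j, 1:])"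

lemma degree_vanishing_poly: "degree (vanishing_poly \<theta> N) \<le> card N"
  unfolding vanishing_poly_def
  by (cases "finite N") (use degree_prod_sum_le[of N "\<lambda>j. [:- \<theta> j, 1:]"] in \<open>auto simp: o_def\<close>)

lemma poly_vanishing_poly_eq_0_iff:
  "finite N \<Longrightarrow> inj \<theta> \<Longrightarrow> poly (vanishing_poly \<theta> N) (\<theta> j) = 0 \<longleftrightarrow> j \<in> N"
  by (auto simp: vanishing_poly_def poly_prod inj_eq)

text \<open>
  The product functional with coefficients \<open>coeff f a * coeff g b * coeff h c\<close> kills the tangent
  space at every point \<open>j\<close> where two of the three polynomials vanish.
\<close>

lemma isolate_summand:
  fixes \<theta> :: "nat \<Rightarrow> 'a::field"
  assumes zero: "\<And>a b c. a < P \<Longrightarrow> b < Q \<Longrightarrow> c < S \<Longrightarrow>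
      (\<Sum>j<R. \<theta> j ^ (a + b + c) * (\<rho> j a + \<sigma> j b + \<tau> j c)) = 0"
    and deg: "degree f < P" "degree g < Q" "degree h < S" and j0: "j0 < R"
    and "\<And>j. j < R \<Longrightarrow> j \<noteq> j0 \<Longrightarrow>
      poly f (\<theta> j) = 0 \<and> poly g (\<theta> j) = 0 \<or> poly f (\<theta> j) = 0 \<and> poly h (\<theta> j) = 0 \<or>
      poly g (\<theta> j) = 0 \<and> poly h (\<theta> j) = 0"
  shows "weighted_eval P (\<theta> j0) (\<rho> j0) f * poly g (\<theta> j0) * poly h (\<theta> j0) +
    poly f (\<theta> j0) * weighted_eval Q (\<theta> j0) (\<sigma> j0) g * poly h (\<theta> j0) +
    poly f (\<theta> j0) * poly g (\<theta> j0) * weighted_eval S (\<theta> j0) (\<tau> j0) h = 0"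
proof -
  \<comment> \<open>\<open>E j\<close> is the product functional applied to the \<open>j\<close>-th
    tangent vector.\<close>
  define E where "E j = weighted_eval P (\<theta> j) (\<rho> j) f * poly g (\<theta> j) * poly h (\<theta> j) +
    poly f (\<theta> j) * weighted_eval Q (\<theta> j) (\<sigma> j) g * poly h (\<theta> j) +
    poly f (\<theta> j) * poly g (\<theta> j) * weighted_eval S (\<theta> j) (\<tau> j) h" for j
  have triple: "(\<Sum>a<P. \<Sum>b<Q. \<Sum>c<S. F a * G b * H c) = (\<Sum>a<P. F a) * (\<Sum>b<Q. G b) * (\<Sum>c<S. H c)"
    for F G H :: "nat \<Rightarrow> 'a"
    by (simp only: sum_distrib_left[symmetric] sum_distrib_right[symmetric])
  have ev: "poly f x = (\<Sum>a<P. coeff f a * x ^ a)" "poly g x = (\<Sum>a<Q. coeff g a * x ^ a)"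
    "poly h x = (\<Sum>a<S. coeff h a * x ^ a)" for x
    using weighted_eval_const[OF deg(1), of x 1] weighted_eval_const[OF deg(2), of x 1]
      weighted_eval_const[OF deg(3), of x 1] by (simp_all add: weighted_eval_def)
  have E: "E j = (\<Sum>a<P. \<Sum>b<Q. \<Sum>c<S. coeff f a * coeff g b * coeff h c *
      (\<theta> j ^ (a + b + c) * (\<rho> j a + \<sigma> j b + \<tau> j c)))" for j
    unfolding E_def weighted_eval_def ev triple[symmetric] sum.distrib[symmetric]
    by (intro sum.cong refl) (simp add: power_add algebra_simps)
  have "(\<Sum>j<R. E j) = (\<Sum>a<P. \<Sum>b<Q. \<Sum>c<S. \<Sum>j<R. coeff f a * coeff g b * coeff h c *
      (\<theta> j ^ (a + b + c) * (\<rho> j a + \<sigma> j b + \<tau> j c)))"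
    unfolding E by (simp only: sum.swap[of _ _ "{..<R}"])
  also have "\<dots> = 0"
    unfolding sum_distrib_left[symmetric] using zero by (intro sum.neutral ballI) simp
  finally have "(\<Sum>j<R. E j) = 0" .
  moreover have "E j = 0" if "j < R" "j \<noteq> j0" for j
    using assms(6)[OF that] by (auto simp: E_def)
  then have "(\<Sum>j<R. E j) = (\<Sum>j\<in>{j0}. E j)"
    using j0 by (intro sum.mono_neutral_right) auto
  ultimately show ?thesis by (simp add: E_def)
qed

text \<open>For \<open>t\<close> other than \<open>j0\<close> the Lagrange polynomial
  \<open>\<L> t\<close> vanishes at \<open>\<theta> j0\<close>, so the isolated summand keeps only
  its term with \<rho> and the weighted evaluation of \<open>\<L> t\<close> is zero. The functional
  is then a multiple of evaluation at \<open>\<theta> j0\<close>, and monomials show that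
  \<open>\<rho> j0\<close> is constant: the direction is radial.\<close>

lemma tangent_factor_constant:
  fixes \<theta> :: "nat \<Rightarrow> 'a::field"
  assumes inj: "inj \<theta>" and nz: "\<And>j. \<theta> j \<noteq> 0"
    and zero: "\<And>a b c. a < P \<Longrightarrow> b < Q \<Longrightarrow> c < S \<Longrightarrow>
      (\<Sum>j<R. \<theta> j ^ (a + b + c) * (\<rho> j a + \<sigma> j b + \<tau> j c)) = 0"
    and pos: "P > 0" "Q > 0" "S > 0"
    and range: "(R - P) + (R - Q) + (R - S) + 2 \<le> R" and j0: "j0 < R"
  shows "\<exists>\<kappa>. \<forall>a<P. \<rho> j0 a = \<kappa>"
proof -
  \<comment> \<open>As many of the first \<open>R\<close> nodes as possible are used for
    interpolation; if \<open>P\<close> exceeds \<open>R\<close>, further nodes fill up.\<close>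
  have "\<exists>T. finite T \<and> card T = P \<and> j0 \<in> T \<and> card ({..<R} - T) = R - P"
  proof (cases "P \<le> R")
    case True
    then obtain T where T: "{j0} \<subseteq> T" "T \<subseteq> {..<R}" "card T = P"
      using exists_subset_between[of "{j0}" P "{..<R}"] pos j0 by auto
    then have "finite T" using finite_subset by blast
    then show ?thesis using T by (intro exI[of _ T]) (simp add: card_Diff_subset)
  next
    case False
    then show ?thesis using j0 by (intro exI[of _ "{..<P}"]) auto
  qed
  then obtain T where T: "finite T" "card T = P" "j0 \<in> T" "card ({..<R} - T) = R - P" by blast
  then have "T \<noteq> {}" by blast
  from lagrange_basis[OF T(1) inj this] obtain \<L> where
    deg: "\<And>t. t \<in> T \<Longrightarrow> degree (\<L> t) < P" and
    \<L>: "\<And>s t. t \<in> T \<Longrightarrow> s \<in> T \<Longrightarrow> poly (\<L> t) (\<theta> s) = (if s = t then 1 else 0)" and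
    expand: "\<And>f. degree f < P \<Longrightarrow> f = (\<Sum>t\<in>T. smult (poly f (\<theta> t)) (\<L> t))"
    unfolding T(2) by blast
  have vanish: "weighted_eval P (\<theta> j0) (\<rho> j0) (\<L> t) = 0" if t: "t \<in> T" "t \<noteq> j0" for t
  proof -
    \<comment> \<open>On \<open>N\<close> the polynomial \<open>\<L> t\<close> need not vanish, so
      \<open>g\<close> and \<open>h\<close> both must; on \<open>U\<close> it vanishes and one of
      them is enough. Their degrees force \<open>g\<close> to omit \<open>R - Q\<close> nodes and
      \<open>h\<close> to omit \<open>R - S\<close>, and these must be disjoint parts of
      \<open>U\<close>. Since \<open>U\<close> loses \<open>j0\<close> and at most
      \<open>(R - P) + 1\<close> further nodes, \<open>range\<close> is the condition
      needed.\<close>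
    define N where "N = ({..<R} - T) \<union> ({..<R} \<inter> {t})"
    define U where "U = {..<R} - {j0} - N"
    have j0N: "j0 \<notin> N" using T t by (auto simp: N_def)
    have "card N \<le> card ({..<R} - T) + card ({..<R} \<inter> {t})" unfolding N_def by (rule card_Un_le)
    also have "\<dots> \<le> (R - P) + 1" using T card_mono[of "{t}" "{..<R} \<inter> {t}"] by simp
    finally have "card N \<le> (R - P) + 1" .
    moreover have "card U = R - 1 - card N"
      unfolding U_def using j0 j0N by (subst card_Diff_subset) (auto simp: N_def)
    ultimately have U: "(R - Q) + (R - S) \<le> card U" using range by linarith
    then obtain A where A: "A \<subseteq> U" "card A = R - Q"
      using obtain_subset_with_card_n[of "R - Q" U] by auto
    have finU: "finite U" by (simp add: U_def)
    then have finA: "finite A" using A finite_subset by blast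
    define g where "g = vanishing_poly \<theta> ({..<R} - {j0} - A)"
    define h where "h = vanishing_poly \<theta> ({..<R} - {j0} - (U - A))"
    have UR: "U \<subseteq> {..<R} - {j0}" by (auto simp: U_def)
    have "card ({..<R} - {j0} - A) = R - 1 - (R - Q)"
      using A UR finA j0 by (subst card_Diff_subset) auto
    then have dg: "degree g < Q"
      using degree_vanishing_poly[of \<theta> "{..<R} - {j0} - A"] pos j0 unfolding g_def by linarith
    have "card (U - A) \<ge> R - S" using A finA U by (simp add: card_Diff_subset)
    moreover have "card ({..<R} - {j0} - (U - A)) = R - 1 - card (U - A)"
      using UR finU j0 by (subst card_Diff_subset) auto
    ultimately have dh: "degree h < S"
      using degree_vanishing_poly[of \<theta> "{..<R} - {j0} - (U - A)"] pos j0 unfolding h_def by linarith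
    have g0: "poly g (\<theta> j) = 0 \<longleftrightarrow> j < R \<and> j \<noteq> j0 \<and> j \<notin> A" for j
      using inj by (simp add: g_def poly_vanishing_poly_eq_0_iff)
    have h0: "poly h (\<theta> j) = 0 \<longleftrightarrow> j < R \<and> j \<noteq> j0 \<and> j \<notin> U - A" for j
      using inj by (simp add: h_def poly_vanishing_poly_eq_0_iff)
    have f0: "poly (\<L> t) (\<theta> j) = 0" if "j \<in> U" for j
      using that t by (subst \<L>) (auto simp: U_def N_def)
    have "poly (\<L> t) (\<theta> j) = 0 \<and> poly g (\<theta> j) = 0 \<or> poly (\<L> t) (\<theta> j) = 0 \<and> poly h (\<theta> j) = 0 \<or>
      poly g (\<theta> j) = 0 \<and> poly h (\<theta> j) = 0" if "j < R" "j \<noteq> j0" for j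
      using that f0[of j] A(1) unfolding g0 h0 by blast
    from isolate_summand[OF zero deg[OF t(1)] dg dh j0 this]
    have "weighted_eval P (\<theta> j0) (\<rho> j0) (\<L> t) * poly g (\<theta> j0) * poly h (\<theta> j0) = 0"
      using \<L>[OF t(1) T(3)] t by simp
    then show ?thesis using g0[of j0] h0[of j0] by simp
  qed
  have "\<rho> j0 a = weighted_eval P (\<theta> j0) (\<rho> j0) (\<L> j0)" if a: "a < P" for a
  proof -
    have "degree (monom (1 :: 'a) a) < P" using a by (simp add: degree_monom_eq)
    then have "weighted_eval P (\<theta> j0) (\<rho> j0) (monom 1 a) =
        (\<Sum>t\<in>T. poly (monom 1 a) (\<theta> t) * weighted_eval P (\<theta> j0) (\<rho> j0) (\<L> t))"
      using expand[of "monom 1 a"] weighted_eval_sum_smult by metis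
    also have "\<dots> = (\<Sum>t\<in>{j0}. poly (monom 1 a) (\<theta> t) * weighted_eval P (\<theta> j0) (\<rho> j0) (\<L> t))"
      using T vanish by (intro sum.mono_neutral_right) auto
    also have "\<dots> = \<theta> j0 ^ a * weighted_eval P (\<theta> j0) (\<rho> j0) (\<L> j0)" by (simp add: poly_monom)
    finally have "\<theta> j0 ^ a * \<rho> j0 a = \<theta> j0 ^ a * weighted_eval P (\<theta> j0) (\<rho> j0) (\<L> j0)"
      using a by (simp add: weighted_eval_def if_distrib[of "\<lambda>x. x * _"] cong: if_cong)
    then show ?thesis using nz by simp
  qed
  then show ?thesis by blast
qed

text \<open>Each factor contributes a constant, and one more functional shows that the constants add
  up to 0: the other \<open>R - 1\<close> nodes are split into \<open>A\<close>, \<open>B\<close>,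
  \<open>C\<close> and each polynomial vanishes off its own block, so two of the three vanish at
  every other node and none at \<open>\<theta> j0\<close>. The case \<open>R = 1\<close> has no
  other nodes and serves the Segre variety.\<close>

lemma tangent_spaces_independent:
  fixes \<theta> :: "nat \<Rightarrow> 'a::field"
  assumes inj: "inj \<theta>" and nz: "\<And>j. \<theta> j \<noteq> 0"
    and zero: "\<And>a b c. a < P \<Longrightarrow> b < Q \<Longrightarrow> c < S \<Longrightarrow>
      (\<Sum>j<R. \<theta> j ^ (a + b + c) * (\<rho> j a + \<sigma> j b + \<tau> j c)) = 0"
    and pos: "P > 0" "Q > 0" "S > 0"
    and range: "R = 1 \<or> (R - P) + (R - Q) + (R - S) + 2 \<le> R"
    and j0: "j0 < R" and abc: "a < P" "b < Q" "c < S"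
  shows "\<rho> j0 a + \<sigma> j0 b + \<tau> j0 c = 0"
proof (cases "R = 1")
  case True
  then show ?thesis using zero[OF abc] j0 nz[of 0] by simp
next
  case False
  with range have rng: "(R - P) + (R - Q) + (R - S) + 2 \<le> R" by blast
  have "\<exists>\<kappa>. \<forall>a<P. \<rho> j0 a = \<kappa>"
    by (rule tangent_factor_constant[OF inj nz zero pos rng j0])
  moreover have "\<exists>\<kappa>. \<forall>b<Q. \<sigma> j0 b = \<kappa>"
  proof (rule tangent_factor_constant[OF inj nz _ pos(2,1,3) _ j0])
    fix b a c assume "b < Q" "a < P" "c < S"
    then show "(\<Sum>j<R. \<theta> j ^ (b + a + c) * (\<sigma> j b + \<rho> j a + \<tau> j c)) = 0"
      using zero[of a b c] by (simp add: ac_simps)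
  qed (use rng in linarith)
  moreover have "\<exists>\<kappa>. \<forall>c<S. \<tau> j0 c = \<kappa>"
  proof (rule tangent_factor_constant[OF inj nz _ pos(3,1,2) _ j0])
    fix c a b assume "c < S" "a < P" "b < Q"
    then show "(\<Sum>j<R. \<theta> j ^ (c + a + b) * (\<tau> j c + \<rho> j a + \<sigma> j b)) = 0"
      using zero[of a b c] by (simp add: ac_simps)
  qed (use rng in linarith)
  ultimately obtain \<kappa> \<mu> \<nu> where const: "\<And>a. a < P \<Longrightarrow> \<rho> j0 a = \<kappa>" "\<And>b. b < Q \<Longrightarrow> \<sigma> j0 b = \<mu>"
    "\<And>c. c < S \<Longrightarrow> \<tau> j0 c = \<nu>" by blast
  define V where "V = {..<R} - {j0}"
  have cV: "card V = R - 1" "finite V" using j0 by (auto simp: V_def)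
  have "R - P \<le> card V" using cV rng by linarith
  then obtain A where A: "A \<subseteq> V" "card A = R - P" "finite A"
    using obtain_subset_with_card_n by metis
  have cVA: "card (V - A) = R - 1 - (R - P)" using A cV by (simp add: card_Diff_subset)
  then have "R - Q \<le> card (V - A)" using rng by linarith
  then obtain B where B: "B \<subseteq> V - A" "card B = R - Q" "finite B"
    using obtain_subset_with_card_n by metis
  define C where "C = V - A - B"
  have cC: "card C = R - 1 - (R - P) - (R - Q)" using cVA B by (simp add: C_def card_Diff_subset)
  define v where "v N = vanishing_poly \<theta> (V - N)" for N
  have dv: "degree (v N) \<le> R - 1 - card N" if "N \<subseteq> V" for N
    using degree_vanishing_poly[of \<theta> "V - N"] that cV
    by (simp add: v_def card_Diff_subset finite_subset[OF that])
  have v0: "poly (v N) (\<theta> j) = 0 \<longleftrightarrow> j \<in> V \<and> j \<notin> N" for N j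
    using inj cV by (simp add: v_def poly_vanishing_poly_eq_0_iff)
  have bound: "degree (v N) < n" if "N \<subseteq> V" "R - n \<le> card N" "n > 0" for N n
  proof -
    have "degree (v N) \<le> R - 1 - (R - n)" using dv[OF that(1)] that(2) by linarith
    then show ?thesis using that(3) j0 by linarith
  qed
  have "B \<subseteq> V" "C \<subseteq> V" "R - S \<le> card C" using B rng unfolding cC by (auto simp: C_def)
  then have deg: "degree (v A) < P" "degree (v B) < Q" "degree (v C) < S"
    using A B pos by (auto intro: bound)
  have two: "poly (v A) (\<theta> j) = 0 \<and> poly (v B) (\<theta> j) = 0 \<or> poly (v A) (\<theta> j) = 0 \<and> poly (v C) (\<theta> j) = 0 \<or>
      poly (v B) (\<theta> j) = 0 \<and> poly (v C) (\<theta> j) = 0" if j: "j < R" "j \<noteq> j0" for j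
  proof -
    have "j \<in> V" using j by (simp add: V_def)
    moreover have "j \<notin> A \<and> j \<notin> B \<or> j \<notin> A \<and> j \<notin> C \<or> j \<notin> B \<and> j \<notin> C"
      using B(1) unfolding C_def by blast
    ultimately show ?thesis unfolding v0 by blast
  qed
  from isolate_summand[OF zero deg j0 two]
  have "weighted_eval P (\<theta> j0) (\<rho> j0) (v A) * poly (v B) (\<theta> j0) * poly (v C) (\<theta> j0) +
    poly (v A) (\<theta> j0) * weighted_eval Q (\<theta> j0) (\<sigma> j0) (v B) * poly (v C) (\<theta> j0) +
    poly (v A) (\<theta> j0) * poly (v B) (\<theta> j0) * weighted_eval S (\<theta> j0) (\<tau> j0) (v C) = 0" .
  moreover have "weighted_eval P (\<theta> j0) (\<rho> j0) (v A) = \<kappa> * poly (v A) (\<theta> j0)"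
    using weighted_eval_const[OF deg(1), of "\<theta> j0" \<kappa>] const by (simp add: weighted_eval_def)
  moreover have "weighted_eval Q (\<theta> j0) (\<sigma> j0) (v B) = \<mu> * poly (v B) (\<theta> j0)"
    using weighted_eval_const[OF deg(2), of "\<theta> j0" \<mu>] const by (simp add: weighted_eval_def)
  moreover have "weighted_eval S (\<theta> j0) (\<tau> j0) (v C) = \<nu> * poly (v C) (\<theta> j0)"
    using weighted_eval_const[OF deg(3), of "\<theta> j0" \<nu>] const by (simp add: weighted_eval_def)
  ultimately have "(\<kappa> + \<mu> + \<nu>) * (poly (v A) (\<theta> j0) * poly (v B) (\<theta> j0) * poly (v C) (\<theta> j0)) = 0"
    by (simp add: algebra_simps)
  moreover have "j0 \<notin> V" by (simp add: V_def)
  ultimately show ?thesis using const abc v0 by simp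
qed

section \<open>Parametrizing Hadamard products of low rank tensors\<close>

lemma multi_indices_Cons:
  "multi_indices (n # ns) = (\<lambda>(x, xs). x # xs) ` ({..<n} \<times> multi_indices ns)"
proof (intro set_eqI iffI)
  fix xs assume "xs \<in> multi_indices (n # ns)"
  then have xs: "length xs = Suc (length ns)" "\<And>k. k < Suc (length ns) \<Longrightarrow> xs ! k < (n # ns) ! k"
    by (auto simp: multi_indices_def)
  then obtain y ys where "xs = y # ys" by (cases xs) auto
  with xs(1) xs(2)[of 0] xs(2)[of "Suc k" for k] show "xs \<in> (\<lambda>(x, xs). x # xs) ` ({..<n} \<times> multi_indices ns)"
    by (auto simp: multi_indices_def)
qed (auto simp: multi_indices_def nth_Cons split: nat.split)

lemma finite_multi_indices: "finite (multi_indices ns)"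
  and card_multi_indices: "card (multi_indices ns) = prod_list ns"
proof -
  have "finite (multi_indices ns) \<and> card (multi_indices ns) = prod_list ns"
  proof (induction ns)
    case Nil
    have "multi_indices [] = {[]}" by (auto simp: multi_indices_def)
    then show ?case by simp
  next
    case (Cons n ns)
    moreover have "inj_on (\<lambda>(x, xs). x # xs) ({..<n} \<times> multi_indices ns)"
      by (auto simp: inj_on_def)
    ultimately show ?case unfolding multi_indices_Cons
      by (auto simp: card_image)
  qed
  then show "finite (multi_indices ns)" "card (multi_indices ns) = prod_list ns" by auto
qed

text \<open>
  The parameter \<open>(k, j, i, l)\<close> with \<open>i < length ns\<close> is the \<open>l\<close>-th entry of the \<open>i\<close>-th vector of the
  \<open>j\<close>-th rank one summand of the \<open>k\<close>-th Hadamard factor; \<open>(k, j, length ns, 0)\<close> is a coefficient in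
  front of this summand.
\<close>

type_synonym param = "nat \<times> nat \<times> nat \<times> nat"

definition rank_sum :: "nat list \<Rightarrow> (param \<Rightarrow> 'a::field) \<Rightarrow> nat \<Rightarrow> nat \<Rightarrow> 'a tensor" where
  "rank_sum ns u k r is =
    (\<Sum>j<r. u (k, j, length ns, 0) * (\<Prod>i<length ns. u (k, j, i, is ! i)))"

text \<open>The cut-off keeps the value in \<open>coord_space\<close>: parameters read at an index
  out of range are arbitrary.\<close>

definition hadamard_param :: "nat list \<Rightarrow> nat list \<Rightarrow> (param \<Rightarrow> 'a::field) \<Rightarrow> 'a tensor" where
  "hadamard_param ns rs u is =
    (if is \<in> multi_indices ns then \<Prod>k<length rs. rank_sum ns u k (rs ! k) is else 0)"

definition factor_params :: "nat list \<Rightarrow> (nat \<times> nat) set" where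
  "factor_params ns = insert (length ns, 0) {(i, l). i < length ns \<and> l < ns ! i}"

definition all_params :: "nat list \<Rightarrow> nat list \<Rightarrow> param set" where
  "all_params ns rs = {(k, j, i, l). k < length rs \<and> j < rs ! k \<and> (i, l) \<in> factor_params ns}"

text \<open>The pairs with \<open>j = 0\<close> and \<open>k\<close> nonzero are missing because the
  first summand of a later factor is fixed to be the all-ones tensor.\<close>

definition summand_indices :: "nat list \<Rightarrow> (nat \<times> nat) set" where
  "summand_indices rs = {(k, j). k < length rs \<and> j < rs ! k \<and> (k = 0 \<or> j \<noteq> 0)}"

text \<open>For positive \<open>ns ! i\<close> this set has dim S + 1 elements: a coefficient, and
  the entries of each vector after its leading 1.\<close>

definition free_factor_params :: "nat list \<Rightarrow> (nat \<times> nat) set" where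
  "free_factor_params ns = insert (length ns, 0) {(i, l). i < length ns \<and> 0 < l \<and> l < ns ! i}"

text \<open>
  Normalization: vectors have leading entry 1, the first summand of every factor but the first is
  the all-ones tensor, and the coefficient of the first summand of the first factor is 1.
\<close>

definition free_params :: "nat list \<Rightarrow> nat list \<Rightarrow> param set" where
  "free_params ns rs = {(k, j, i, l). (k, j) \<in> summand_indices rs \<and> (i, l) \<in> free_factor_params ns}
    - {(0, 0, length ns, 0)}"

lemma finite_factor_params: "finite (factor_params ns)"
proof -
  have "{(i, l). i < length ns \<and> l < ns ! i} = Sigma {..<length ns} (\<lambda>i. {..<ns ! i})" by auto
  then show ?thesis by (simp add: factor_params_def)
qed

lemma finite_all_params: "finite (all_params ns rs)"
proof -
  have "all_params ns rs = (\<lambda>((k, j), (i, l)). (k, j, i, l)) `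
      (Sigma {..<length rs} (\<lambda>k. {..<rs ! k}) \<times> factor_params ns)"
    by (auto simp: all_params_def image_iff)
  then show ?thesis by (simp add: finite_factor_params)
qed

lemma free_params_subset: "free_params ns rs \<subseteq> all_params ns rs"
  by (auto simp: free_params_def all_params_def summand_indices_def free_factor_params_def
      factor_params_def)

lemma finite_free_params: "finite (free_params ns rs)"
  using free_params_subset finite_all_params by (rule finite_subset)

lemma card_summand_indices:
  assumes "length rs \<ge> 1" "\<forall>k<length rs. rs ! k \<ge> 1"
  shows "real (card (summand_indices rs)) = (\<Sum>k<length rs. real (rs ! k)) - (real (length rs) - 1)"
proof -
  have "summand_indices rs = Sigma {..<length rs} (\<lambda>k. if k = 0 then {..<rs ! 0} else {1..<rs ! k})"
    by (auto simp: summand_indices_def split: if_splits)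
  then have "card (summand_indices rs) = (\<Sum>k<length rs. if k = 0 then rs ! 0 else rs ! k - 1)"
    by (simp add: if_distrib[of card] cong: if_cong)
  then have "real (card (summand_indices rs)) =
      (\<Sum>k<length rs. real (rs ! k) - 1 + (if k = 0 then 1 else 0))"
    unfolding of_nat_sum using assms(2) by (auto intro!: sum.cong simp: of_nat_diff)
  also have "\<dots> = (\<Sum>k<length rs. real (rs ! k)) - (real (length rs) - 1)"
  proof -
    have "(\<Sum>k<length rs. if k = 0 then 1 else 0 :: real) = 1"
      using assms(1) by (subst sum.delta) auto
    then show ?thesis by (simp add: sum.distrib sum_subtractf)
  qed
  finally show ?thesis .
qed

text \<open>The parameter missing from the product is the coefficient whose normalization accounts
  for the overall scalar.\<close>

lemma card_free_params:
  assumes "length rs \<ge> 1" "rs ! 0 \<ge> 1"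
  shows "card (free_params ns rs) + 1 = card (summand_indices rs) * card (free_factor_params ns)"
proof -
  let ?f = "\<lambda>((k, j), (i, l)). (k, j, i, l) :: param"
  let ?A = "{(k, j, i, l). (k, j) \<in> summand_indices rs \<and> (i, l) \<in> free_factor_params ns}"
  have A: "?A = ?f ` (summand_indices rs \<times> free_factor_params ns)"
    by force
  have "inj_on ?f (summand_indices rs \<times> free_factor_params ns)" by (auto simp: inj_on_def)
  then have card: "card ?A = card (summand_indices rs) * card (free_factor_params ns)"
    unfolding A by (simp add: card_image card_cartesian_product)
  have "(0, 0, length ns, 0) \<in> ?A"
    using assms by (auto simp: summand_indices_def free_factor_params_def)
  moreover have "finite ?A"
  proof -
    have "?A \<subseteq> insert (0, 0, length ns, 0) (free_params ns rs)" by (auto simp: free_params_def)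
    then show ?thesis using finite_free_params[of ns rs] by (metis finite_insert finite_subset)
  qed
  ultimately have "Suc (card (free_params ns rs)) = card ?A"
    unfolding free_params_def by (intro card_Suc_Diff1)
  then show ?thesis using card by simp
qed

section \<open>Degree of the parametrization and reduction to normalized parameters\<close>

lemma line_poly_hadamard_param:
  "line_poly (length rs * (1 + length ns)) (\<lambda>u :: param \<Rightarrow> 'a::field_char_0. hadamard_param ns rs u is)"
proof (cases "is \<in> multi_indices ns")
  case True
  have "line_poly (1 + (\<Sum>i<length ns. 1))
      (\<lambda>u :: param \<Rightarrow> 'a. u (k, j, length ns, 0) * (\<Prod>i<length ns. u (k, j, i, is ! i)))" for k j
    by (intro line_poly_mult line_poly_coord line_poly_prod)
  then have "line_poly (\<Sum>k<length rs. 1 + length ns)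
      (\<lambda>u :: param \<Rightarrow> 'a. \<Prod>k<length rs. rank_sum ns u k (rs ! k) is)"
    unfolding rank_sum_def by (intro line_poly_prod line_poly_sum) simp
  with True show ?thesis by (simp add: hadamard_param_def)
next
  case False
  then show ?thesis by (simp add: hadamard_param_def line_poly_mono[OF line_poly_const])
qed

text \<open>
  Dividing the factors by their first summands and moving these quotients into the first factor does
  not change the product.
\<close>

lemma hadamard_param_normalize:
  fixes u :: "param \<Rightarrow> 'a::field"
  assumes rs: "length rs \<ge> 1" "\<forall>k<length rs. rs ! k \<ge> 1" and ns: "\<forall>i<length ns. ns ! i \<ge> 1"
    and nz: "\<And>v. v \<in> all_params ns rs \<Longrightarrow> u v \<noteq> 0"
  shows "\<exists>c u'. u' \<in> affine_chart (\<lambda>_. 1) (free_params ns rs) \<and>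
    hadamard_param ns rs u = (\<lambda>is. c * hadamard_param ns rs u' is)"
proof -
  let ?d = "length ns" and ?m = "length rs"
  \<comment> \<open>At every position the \<open>\<sigma> k\<close> multiply to 1 over the factors
    \<open>k\<close>, so rescaling by them does not change the Hadamard product; it turns the first
    summand of each later factor into the all-ones tensor.\<close>
  define \<sigma> where "\<sigma> k i l = (if k = 0 then \<Prod>k'\<in>{1..<?m}. u (k', 0, i, l) else inverse (u (k, 0, i, l)))"
    for k i l
  define A where "A k j i l = \<sigma> k i l * u (k, j, i, l)" for k j i l
  \<comment> \<open>\<open>\<gamma> 0\<close> is the coefficient that the first summand of the first
    factor acquires; pulled out, it becomes the scalar \<open>c\<close>.\<close>
  define \<gamma> where "\<gamma> k = (if k = 0 then A 0 0 ?d 0 * (\<Prod>i<?d. A 0 0 i 0) else 1)" for k :: nat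
  \<comment> \<open>Every vector is divided by its leading entry, and the leading entries are
    collected in the coefficient.\<close>
  define u' where "u' = (\<lambda>(k, j, i, l). if (k, j, i, l) \<in> all_params ns rs
     then (if i < ?d then A k j i l / A k j i 0 else A k j ?d 0 * (\<Prod>i<?d. A k j i 0) / \<gamma> k) else 1)"
  have \<sigma>nz: "\<sigma> k i l \<noteq> 0" if "(i, l) \<in> factor_params ns" "k < ?m" for k i l
  proof -
    have "u (k, 0, i, l) \<noteq> 0" if "k < ?m" for k
      using that \<open>(i, l) \<in> _\<close> rs by (intro nz) (auto simp: all_params_def)
    then show ?thesis using that by (auto simp: \<sigma>_def)
  qed
  have \<sigma>prod: "(\<Prod>k<?m. \<sigma> k i l) = 1" if "(i, l) \<in> factor_params ns" for i l
  proof -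
    have *: "u (k, 0, i, l) \<noteq> 0" if "k < ?m" for k
      using that \<open>(i, l) \<in> _\<close> rs by (intro nz) (auto simp: all_params_def)
    have "{..<?m} = insert 0 {1..<?m}" using rs by auto
    then have "(\<Prod>k<?m. \<sigma> k i l) = \<sigma> 0 i l * (\<Prod>k\<in>{1..<?m}. \<sigma> k i l)" by simp
    also have "\<dots> = (\<Prod>k\<in>{1..<?m}. u (k, 0, i, l) * inverse (u (k, 0, i, l)))"
      unfolding prod.distrib by (auto simp: \<sigma>_def intro!: prod.cong)
    also have "\<dots> = 1" using * by (intro prod.neutral) auto
    finally show ?thesis .
  qed
  have Anz: "A k j i l \<noteq> 0" if "(k, j, i, l) \<in> all_params ns rs" for k j i l
    using that nz[OF that] \<sigma>nz by (auto simp: A_def all_params_def)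
  have A1: "A k 0 i l = 1" if "(k, 0, i, l) \<in> all_params ns rs" "k \<noteq> 0" for k i l
    using that nz[of "(k, 0, i, l)"] by (simp add: A_def \<sigma>_def)
  have lead: "(k, j, i, 0) \<in> all_params ns rs" if "k < ?m" "j < rs ! k" "i \<le> ?d" for k j i
    using that ns[rule_format, of i] by (auto simp: all_params_def factor_params_def)
  have \<gamma>nz: "\<gamma> k \<noteq> 0" for k
  proof -
    have "0 < length rs" "0 < rs ! 0" using rs by (auto simp: Suc_le_eq)
    then have "A 0 0 i 0 \<noteq> 0" if "i \<le> ?d" for i using that Anz lead by blast
    then show ?thesis by (auto simp: \<gamma>_def)
  qed
  have "u' \<in> affine_chart (\<lambda>_. 1) (free_params ns rs)"
    unfolding affine_chart_def
  proof (intro CollectI allI impI)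
    fix v assume v: "v \<notin> free_params ns rs"
    obtain k j i l where kjil: "v = (k, j, i, l)" by (cases v) auto
    show "u' v = 1"
    proof (cases "v \<in> all_params ns rs")
      case False
      then show ?thesis by (simp add: u'_def kjil)
    next
      case True
      then have k: "k < ?m" "j < rs ! k" and il: "(i, l) \<in> factor_params ns"
        by (auto simp: all_params_def kjil)
      show ?thesis
      proof (cases "i < ?d")
        case True
        then have "l = 0 \<or> k \<noteq> 0 \<and> j = 0"
          using v k il
          by (auto simp: kjil free_params_def summand_indices_def free_factor_params_def factor_params_def)
        then show ?thesis
        proof
          assume "l = 0"
          then show ?thesis using True Anz[OF lead[OF k, of i]] by (simp add: u'_def kjil)
        next
          assume "k \<noteq> 0 \<and> j = 0"
          then show ?thesis
            using True \<open>v \<in> all_params ns rs\<close> A1[of k i l] A1[of k i 0] lead[OF k, of i]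
            by (simp add: u'_def kjil)
        qed
      next
        case False
        then have il: "i = ?d" "l = 0" using il by (auto simp: factor_params_def)
        then have "j = 0"
          using v k by (auto simp: kjil free_params_def summand_indices_def free_factor_params_def)
        show ?thesis
        proof (cases "k = 0")
          case True
          then show ?thesis using \<gamma>nz[of 0] \<open>j = 0\<close> il by (simp add: u'_def kjil \<gamma>_def)
        next
          case False
          have "A k 0 i 0 = 1" if "i \<le> ?d" for i
            using A1[OF lead] that k False \<open>j = 0\<close> by simp
          then show ?thesis using \<open>j = 0\<close> il False by (simp add: u'_def kjil \<gamma>_def)
        qed
      qed
    qed
  qed
  moreover have "hadamard_param ns rs u = (\<lambda>is. (\<Prod>k<?m. \<gamma> k) * hadamard_param ns rs u' is)"
  proof
    fix is' :: "nat list"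
    show "hadamard_param ns rs u is' = (\<Prod>k<?m. \<gamma> k) * hadamard_param ns rs u' is'"
    proof (cases "is' \<in> multi_indices ns")
      case True
      then have idx: "(i, is' ! i) \<in> factor_params ns" if "i < ?d" for i
        using that by (auto simp: multi_indices_def factor_params_def)
      have d: "(?d, 0) \<in> factor_params ns" by (simp add: factor_params_def)
      \<comment> \<open>The rescaling multiplies the entry of the \<open>k\<close>-th tensor at
        \<open>is'\<close> by \<open>E k\<close>, the same for all of its summands.\<close>
      define E where "E k = \<sigma> k ?d 0 * (\<Prod>i<?d. \<sigma> k i (is' ! i))" for k
      have "(\<Prod>k<?m. E k) = (\<Prod>k<?m. \<sigma> k ?d 0) * (\<Prod>i<?d. \<Prod>k<?m. \<sigma> k i (is' ! i))"
        unfolding E_def prod.distrib by (subst (2) prod.swap) simp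
      then have E: "(\<Prod>k<?m. E k) = 1" using idx d by (simp add: \<sigma>prod)
      have "E k * rank_sum ns u k (rs ! k) is' = \<gamma> k * rank_sum ns u' k (rs ! k) is'" if k: "k < ?m" for k
        unfolding rank_sum_def sum_distrib_left
      proof (rule sum.cong[OF refl])
        fix j assume "j \<in> {..<rs ! k}"
        then have j: "j < rs ! k" by simp
        have mem: "(k, j, i, is' ! i) \<in> all_params ns rs" if "i < ?d" for i
          using that k j idx by (simp add: all_params_def)
        have "E k * (u (k, j, ?d, 0) * (\<Prod>i<?d. u (k, j, i, is' ! i))) =
            A k j ?d 0 * (\<Prod>i<?d. A k j i (is' ! i))"
          by (simp add: E_def A_def prod.distrib ac_simps)
        also have "\<dots> = A k j ?d 0 * (\<Prod>i<?d. A k j i 0) * (\<Prod>i<?d. A k j i (is' ! i) / A k j i 0)"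
        proof -
          have "(\<Prod>i<?d. A k j i 0) \<noteq> 0" using Anz lead[OF k j] by simp
          then show ?thesis by (simp add: prod_dividef)
        qed
        also have "\<dots> = \<gamma> k * (u' (k, j, ?d, 0) * (\<Prod>i<?d. u' (k, j, i, is' ! i)))"
          using \<gamma>nz[of k] mem lead[OF k j, of ?d] by (simp add: u'_def)
        finally show "E k * (u (k, j, ?d, 0) * (\<Prod>i<?d. u (k, j, i, is' ! i))) =
            \<gamma> k * (u' (k, j, ?d, 0) * (\<Prod>i<?d. u' (k, j, i, is' ! i)))" .
      qed
      then have "(\<Prod>k<?m. E k * rank_sum ns u k (rs ! k) is') = (\<Prod>k<?m. \<gamma> k * rank_sum ns u' k (rs ! k) is')"
        by (intro prod.cong) auto
      then show ?thesis using True E by (simp add: hadamard_param_def prod.distrib)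
    qed (simp add: hadamard_param_def)
  qed
  ultimately show ?thesis by blast
qed

text \<open>Normalization divides by parameters and reaches only those without zero coordinates.
  Multiplied by the product of all coordinates the pullback vanishes everywhere, and that product is
  not zero at the all-ones point.\<close>

lemma form_zero_on_chart_imp_zero:
  fixes f :: "(nat list, 'a::field_char_0) mpoly"
  assumes rs: "length rs \<ge> 1" "\<forall>k<length rs. rs ! k \<ge> 1" and ns: "\<forall>i<length ns. ns ! i \<ge> 1"
    and f: "form e f"
    and zero: "\<And>u. u \<in> affine_chart (\<lambda>_. 1) (free_params ns rs) \<Longrightarrow> poly_eval (hadamard_param ns rs u) f = 0"
  shows "poly_eval (hadamard_param ns rs u) f = 0"
proof -
  have lp: "line_poly (\<Sum>v\<in>all_params ns rs. 1) (\<lambda>u :: param \<Rightarrow> 'a. \<Prod>v\<in>all_params ns rs. u v)"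
    by (intro line_poly_prod line_poly_coord)
  have lf: "line_poly (e * (length rs * (1 + length ns))) (\<lambda>u. poly_eval (hadamard_param ns rs u) f)"
    by (intro line_poly_poly_eval line_poly_hadamard_param f)
  have prod: "(\<Prod>v\<in>all_params ns rs. u v) * poly_eval (hadamard_param ns rs u) f = 0" for u :: "param \<Rightarrow> 'a"
  proof (cases "\<forall>v\<in>all_params ns rs. u v \<noteq> 0")
    case True
    then obtain c u' where "u' \<in> affine_chart (\<lambda>_. 1) (free_params ns rs)"
      "hadamard_param ns rs u = (\<lambda>is. c * hadamard_param ns rs u' is)"
      using hadamard_param_normalize[OF rs ns] by blast
    then show ?thesis using zero f by (simp add: form_eval_scale)
  next
    case False
    then show ?thesis using finite_all_params by auto
  qed
  show ?thesis
    by (rule line_poly_zero_divisor[OF lp lf prod, where p = u and V = UNIV and u = "\<lambda>_. 1"])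
      (auto simp: affine_chart_def)
qed

section \<open>Tangent vectors of the parametrization\<close>

text \<open>The parameter that the \<open>J\<close>-th rank one term reads at a multi-index from
  position \<open>i\<close> of factor \<open>k\<close>; position \<open>length ns\<close> is the
  coefficient, whose last index is 0.\<close>

definition slot :: "nat list \<Rightarrow> (nat \<Rightarrow> nat \<Rightarrow> nat) \<Rightarrow> nat \<Rightarrow> nat list \<Rightarrow> nat \<times> nat \<Rightarrow> param" where
  "slot ns dig J is = (\<lambda>(k, i). (k, dig k J, i, if i < length ns then is ! i else 0))"

text \<open>
  Multiplying out, the Hadamard product is a sum of \<open>prod_list rs\<close> rank one tensors, numbered by
  \<open>J\<close> whose digits \<open>dig k J\<close> tell which summand is taken from the \<open>k\<close>-th factor.
\<close>

lemma hadamard_param_expand: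
  assumes dig: "bij_betw (\<lambda>J. \<lambda>k\<in>{..<length rs}. dig k J) {..<R} (PiE {..<length rs} (\<lambda>k. {..<rs ! k}))"
    and idx: "idx \<in> multi_indices ns"
  shows "hadamard_param ns rs u idx =
    (\<Sum>J<R. \<Prod>y\<in>{..<length rs} \<times> {..<Suc (length ns)}. u (slot ns dig J idx y))"
proof -
  have "hadamard_param ns rs u idx = (\<Sum>g\<in>PiE {..<length rs} (\<lambda>k. {..<rs ! k}). \<Prod>k<length rs.
      u (k, g k, length ns, 0) * (\<Prod>i<length ns. u (k, g k, i, idx ! i)))"
    using idx by (simp add: hadamard_param_def rank_sum_def prod_sum_PiE)
  also have "\<dots> = (\<Sum>J<R. \<Prod>k<length rs.
      u (k, dig k J, length ns, 0) * (\<Prod>i<length ns. u (k, dig k J, i, idx ! i)))"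
    by (subst sum.reindex_bij_betw[OF dig, symmetric]) (auto intro!: sum.cong prod.cong)
  also have "\<dots> = (\<Sum>J<R. \<Prod>k<length rs. \<Prod>i<Suc (length ns). u (slot ns dig J idx (k, i)))"
    by (intro sum.cong prod.cong refl) (simp add: slot_def mult.commute)
  finally show ?thesis by (simp add: prod.cartesian_product case_prod_unfold del: prod.lessThan_Suc)
qed

text \<open>Logarithmic derivatives: \<open>p\<close> has no zero coordinate, so the product over
  all slots but one is the full product divided by the omitted entry, and the value of each term
  becomes a common factor.\<close>

lemma has_jet_hadamard_param:
  fixes p :: "param \<Rightarrow> 'a::field_char_0"
  assumes V: "finite V"
    and dig: "bij_betw (\<lambda>J. \<lambda>k\<in>{..<length rs}. dig k J) {..<R} (PiE {..<length rs} (\<lambda>k. {..<rs ! k}))"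
    and idx: "idx \<in> multi_indices ns" and p: "\<And>v. p v \<noteq> 0"
  shows "has_jet p V (\<lambda>u. hadamard_param ns rs u idx)
    (\<lambda>w. \<Sum>J<R. (\<Prod>y\<in>{..<length rs} \<times> {..<Suc (length ns)}. p (slot ns dig J idx y)) *
      (\<Sum>y\<in>{..<length rs} \<times> {..<Suc (length ns)}. if w = slot ns dig J idx y then 1 / p w else 0))"
proof -
  let ?Y = "{..<length rs} \<times> {..<Suc (length ns)}"
  have "has_jet p V (\<lambda>u. \<Prod>y\<in>?Y. u (slot ns dig J idx y))
      (\<lambda>w. (\<Prod>y\<in>?Y. p (slot ns dig J idx y)) *
        (\<Sum>y\<in>?Y. if w = slot ns dig J idx y then 1 / p w else 0))" for J
  proof -
    have "has_jet p V (\<lambda>u. \<Prod>y\<in>?Y. u (slot ns dig J idx y))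
      (\<lambda>w. \<Sum>y\<in>?Y. (if w = slot ns dig J idx y then 1 else 0) *
        (\<Prod>y'\<in>?Y - {y}. p (slot ns dig J idx y')))"
      by (intro has_jet_prod has_jet_coord V) auto
    moreover have "(if w = slot ns dig J idx y then 1 else 0) * (\<Prod>y'\<in>?Y - {y}. p (slot ns dig J idx y')) =
        (\<Prod>y\<in>?Y. p (slot ns dig J idx y)) * (if w = slot ns dig J idx y then 1 / p w else 0)"
      if "y \<in> ?Y" for w y
      using p[of "slot ns dig J idx y"] prod.remove[OF _ that, of "\<lambda>y. p (slot ns dig J idx y)"] by simp
    ultimately show ?thesis by (simp add: sum_distrib_left)
  qed
  then have "has_jet p V (\<lambda>u. \<Sum>J<R. \<Prod>y\<in>?Y. u (slot ns dig J idx y))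
    (\<lambda>w. \<Sum>J<R. (\<Prod>y\<in>?Y. p (slot ns dig J idx y)) *
      (\<Sum>y\<in>?Y. if w = slot ns dig J idx y then 1 / p w else 0))"
    by (intro has_jet_sum)
  then show ?thesis unfolding hadamard_param_expand[OF dig idx] .
qed

lemma digits_bij_betw:
  assumes "\<And>a. a < R \<Longrightarrow> (\<Sum>k\<in>A. w k * dig k a) = (a :: nat)"
    and "\<And>a k. a < R \<Longrightarrow> k \<in> A \<Longrightarrow> dig k a < (n k :: nat)"
    and "\<And>x. (\<forall>k\<in>A. x k < n k) \<Longrightarrow> \<exists>a < R. \<forall>k\<in>A. dig k a = x k"
  shows "bij_betw (\<lambda>a. \<lambda>k\<in>A. dig k a) {..<R} (PiE A (\<lambda>k. {..<n k}))"
  unfolding bij_betw_def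
proof
  show "inj_on (\<lambda>a. \<lambda>k\<in>A. dig k a) {..<R}"
  proof (rule inj_onI)
    fix a b assume ab: "a \<in> {..<R}" "b \<in> {..<R}" and eq: "(\<lambda>k\<in>A. dig k a) = (\<lambda>k\<in>A. dig k b)"
    have "dig k a = dig k b" if "k \<in> A" for k using fun_cong[OF eq, of k] that by simp
    then have "(\<Sum>k\<in>A. w k * dig k a) = (\<Sum>k\<in>A. w k * dig k b)" by simp
    then show "a = b" using assms(1) ab by simp
  qed
  show "(\<lambda>a. \<lambda>k\<in>A. dig k a) ` {..<R} = PiE A (\<lambda>k. {..<n k})"
  proof (intro subset_antisym subsetI)
    fix x assume x: "x \<in> PiE A (\<lambda>k. {..<n k})"
    then have "\<forall>k\<in>A. x k < n k" by (auto simp: PiE_mem)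
    then obtain a where a: "a < R" "\<forall>k\<in>A. dig k a = x k" using assms(3) by blast
    then have "x = (\<lambda>k\<in>A. dig k a)"
      using x by (intro extensionalityI[where A = A]) (auto simp: PiE_def)
    then show "x \<in> (\<lambda>a. \<lambda>k\<in>A. dig k a) ` {..<R}" using a by blast
  qed (use assms(2) in auto)
qed

text \<open>A sum of functions of separate digits, or of separate index entries, determines them
  only up to constants moved between the summands. The zeros of \<open>G\<close> outside the free
  parameters remove this ambiguity; the relation is tested on tuples and multi-indices that are zero
  except in one place.\<close>

lemma separate_summand_contributions:
  fixes G :: "param \<Rightarrow> 'a::field"
  assumes rs: "length rs \<ge> 1" "\<forall>k<length rs. rs ! k \<ge> 1" and ns: "\<forall>i<length ns. ns ! i \<ge> 1"
    and G0: "\<And>v. v \<notin> free_params ns rs \<Longrightarrow> G v = 0"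
    and zero: "\<And>x idx. (\<forall>k<length rs. x k < rs ! k) \<Longrightarrow> idx \<in> multi_indices ns \<Longrightarrow>
      c + (\<Sum>k<length rs. G (k, x k, length ns, 0) + (\<Sum>i<length ns. G (k, x k, i, idx ! i))) = 0"
  shows "c = 0 \<and> (\<forall>v\<in>free_params ns rs. G v = 0)"
proof -
  let ?d = "length ns"
  define h where "h k j idx = G (k, j, ?d, 0) + (\<Sum>i<?d. G (k, j, i, idx ! i))" for k j and idx :: "nat list"
  have zero': "c + (\<Sum>k<length rs. h k (x k) idx) = 0"
    if "\<forall>k<length rs. x k < rs ! k" "idx \<in> multi_indices ns" for x idx
    unfolding h_def using zero[OF that] .
  define o0 where "o0 = replicate ?d (0::nat)"
  have o0: "o0 \<in> multi_indices ns" "\<And>i. i < ?d \<Longrightarrow> o0 ! i = 0"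
    using ns by (auto simp: o0_def multi_indices_def Suc_le_eq)
  have Glead: "G (k, j, i, 0) = 0" if "i < ?d" for k j i
    using that by (intro G0) (auto simp: free_params_def free_factor_params_def)
  have ho0: "h k j o0 = G (k, j, ?d, 0)" for k j
    using o0 Glead by (simp add: h_def)
  have hk0: "h k 0 idx = 0" if "k \<noteq> 0" for k idx
  proof -
    have "G (k, 0, i, l) = 0" for i l
      using that by (intro G0) (auto simp: free_params_def summand_indices_def)
    then show ?thesis by (simp add: h_def)
  qed
  have G00: "G (0, 0, ?d, 0) = 0" by (intro G0) (auto simp: free_params_def)
  have r0: "\<forall>k<length rs. 0 < rs ! k" using rs(2) by (auto simp: Suc_le_eq)
  have r00: "0 < rs ! 0" using r0[rule_format, of 0] rs(1) by (cases rs) auto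
  have h0: "c + h 0 j idx = 0" if j: "j < rs ! 0" and idx: "idx \<in> multi_indices ns" for j idx
  proof -
    let ?x = "\<lambda>k. if k = 0 then j else 0"
    have "(\<Sum>k<length rs. h k (?x k) idx) = (\<Sum>k\<in>{0}. h k (?x k) idx)"
      using rs hk0 by (intro sum.mono_neutral_right) auto
    moreover have "c + (\<Sum>k<length rs. h k (?x k) idx) = 0"
      by (rule zero') (use r0 j idx in auto)
    ultimately show ?thesis by simp
  qed
  have "c + h 0 0 o0 = 0" using r00 by (intro h0 o0)
  then have c: "c = 0" by (simp add: ho0 G00)
  have h: "h k j idx = 0" if k: "k < length rs" and j: "j < rs ! k" and idx: "idx \<in> multi_indices ns" for k j idx
  proof (cases "k = 0")
    case True
    then show ?thesis using h0 j idx c by simp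
  next
    case False
    let ?x = "\<lambda>k'. if k' = k then j else 0"
    have "h 0 0 idx = 0" using h0[OF r00 idx] c by simp
    then have "h k' 0 idx = 0" for k' using hk0 by (cases "k' = 0") auto
    then have "(\<Sum>k'<length rs. h k' (?x k') idx) = (\<Sum>k'\<in>{k}. h k' (?x k') idx)"
      using k by (intro sum.mono_neutral_right) auto
    moreover have "c + (\<Sum>k'<length rs. h k' (?x k') idx) = 0"
      by (rule zero') (use r0 j idx in auto)
    ultimately show ?thesis using c by simp
  qed
  have "G (k, j, i, l) = 0" if mem: "(k, j, i, l) \<in> free_params ns rs" for k j i l
  proof -
    have kj: "k < length rs" "j < rs ! k" using mem by (auto simp: free_params_def summand_indices_def)
    have d0: "G (k, j, ?d, 0) = 0" using h[OF kj o0(1)] by (simp add: ho0)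
    consider "i = ?d" "l = 0" | "i < ?d" "l < ns ! i"
      using mem by (auto simp: free_params_def free_factor_params_def)
    then show ?thesis
    proof cases
      case 1
      then show ?thesis using d0 by simp
    next
      case 2
      define idx where "idx = o0[i := l]"
      have "length o0 = ?d" by (simp add: o0_def)
      then have nth: "idx ! i' = (if i' = i then l else 0)" if "i' < ?d" for i'
        using that o0(2) by (simp add: idx_def nth_list_update)
      have "idx \<in> multi_indices ns"
        using 2 o0(1) by (auto simp: idx_def multi_indices_def nth_list_update)
      then have "0 = h k j idx" using h[OF kj] by simp
      also have "\<dots> = (\<Sum>i'<?d. if i' = i then G (k, j, i, l) else 0)"
      proof -
        have "(\<Sum>i'<?d. G (k, j, i', idx ! i')) = (\<Sum>i'<?d. if i' = i then G (k, j, i, l) else 0)"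
          by (intro sum.cong refl) (simp add: nth Glead)
        then show ?thesis unfolding h_def d0 by simp
      qed
      also have "\<dots> = G (k, j, i, l)" using 2 by simp
      finally show ?thesis by simp
    qed
  qed
  then show ?thesis using c by auto
qed

text \<open>In a linear relation every term \<open>J\<close> contributes its value times a bracket
  whose summands each depend on at most one index entry. Grouped along the partition, the bracket is
  a sum of functions of a, b and c separately, hence a tangent vector of the three-factor Segre
  variety. So every bracket vanishes, and the brackets for all \<open>J\<close> together determine
  the coefficients.\<close>

lemma hadamard_param_tangent_independent:
  assumes rs: "length rs \<ge> 1" "\<forall>k<length rs. rs ! k \<ge> 1" and ns: "\<forall>i<length ns. ns ! i \<ge> 1"
    and part: "I1 \<union> I2 \<union> I3 = {..<length ns}" "I1 \<inter> I2 = {}" "I1 \<inter> I3 = {}" "I2 \<inter> I3 = {}"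
    and P: "P = (\<Prod>i\<in>I1. ns ! i)" "Q = (\<Prod>i\<in>I2. ns ! i)" "S = (\<Prod>i\<in>I3. ns ! i)"
    and R: "R = prod_list rs" and range: "R = 1 \<or> (R - P) + (R - Q) + (R - S) + 2 \<le> R"
  shows "\<exists>p D. (\<forall>v. v \<notin> free_params ns rs \<longrightarrow> p v = 1) \<and>
    (\<forall>idx\<in>multi_indices ns. has_jet p (free_params ns rs)
      (\<lambda>u :: param \<Rightarrow> 'a::field_char_0. hadamard_param ns rs u idx) (\<lambda>w. D w idx)) \<and>
    independent_family (multi_indices ns) (insert None (Some ` free_params ns rs))
      (case_option (hadamard_param ns rs p) D)"
proof -
  let ?d = "length ns" and ?m = "length rs"
  let ?V = "free_params ns rs" and ?Y = "{..<length rs} \<times> {..<Suc (length ns)}"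
  have fin: "finite I1" "finite I2" "finite I3"
    using part(1) by (auto intro: finite_subset[of _ "{..<?d}"])
  have split: "(\<Sum>i<?d. F i) = (\<Sum>i\<in>I1. F i) + (\<Sum>i\<in>I2. F i) + (\<Sum>i\<in>I3. F i)"
    for F :: "nat \<Rightarrow> 'b::comm_monoid_add"
  proof -
    have "(I1 \<union> I2) \<inter> I3 = {}" using part by blast
    then show ?thesis
      unfolding part(1)[symmetric] using fin part(2) by (simp add: sum.union_disjoint)
  qed
  have Rprod: "(\<Prod>k<?m. rs ! k) = R"
    by (simp add: R prod.list_conv_set_nth lessThan_atLeast0)
  obtain s dig where dig: "\<And>a. a < R \<Longrightarrow> (\<Sum>k<?m. s k * dig k a) = a"
    "\<And>a k. a < R \<Longrightarrow> k \<in> {..<?m} \<Longrightarrow> dig k a < rs ! k"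
    "\<And>x. (\<forall>k\<in>{..<?m}. x k < rs ! k) \<Longrightarrow> \<exists>a < R. \<forall>k\<in>{..<?m}. dig k a = x k"
    using mixed_radix[of "{..<?m}" "\<lambda>k. rs ! k"] unfolding Rprod by auto
  note bij = digits_bij_betw[OF dig]
  have "\<exists>w dg. (\<forall>a < prod ((!) ns) A. (\<Sum>i\<in>A. w i * dg i a) = a \<and> (\<forall>i\<in>A. dg i a < ns ! i)) \<and>
    (\<forall>x. (\<forall>i\<in>A. x i < ns ! i) \<longrightarrow> (\<exists>a < prod ((!) ns) A. \<forall>i\<in>A. dg i a = x i))"
    if "finite A" for A using mixed_radix[OF that, of "(!) ns"] .
  note radix = this
  obtain w1 d1 where d1: "\<And>a. a < P \<Longrightarrow> (\<Sum>i\<in>I1. w1 i * d1 i a) = a"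
    "\<And>a i. a < P \<Longrightarrow> i \<in> I1 \<Longrightarrow> d1 i a < ns ! i"
    "\<And>x. (\<forall>i\<in>I1. x i < ns ! i) \<Longrightarrow> \<exists>a < P. \<forall>i\<in>I1. d1 i a = x i"
    using radix[OF fin(1)] unfolding P by auto
  obtain w2 d2 where d2: "\<And>a. a < Q \<Longrightarrow> (\<Sum>i\<in>I2. w2 i * d2 i a) = a"
    "\<And>a i. a < Q \<Longrightarrow> i \<in> I2 \<Longrightarrow> d2 i a < ns ! i"
    "\<And>x. (\<forall>i\<in>I2. x i < ns ! i) \<Longrightarrow> \<exists>a < Q. \<forall>i\<in>I2. d2 i a = x i"
    using radix[OF fin(2)] unfolding P by auto
  obtain w3 d3 where d3: "\<And>a. a < S \<Longrightarrow> (\<Sum>i\<in>I3. w3 i * d3 i a) = a"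
    "\<And>a i. a < S \<Longrightarrow> i \<in> I3 \<Longrightarrow> d3 i a < ns ! i"
    "\<And>x. (\<forall>i\<in>I3. x i < ns ! i) \<Longrightarrow> \<exists>a < S. \<forall>i\<in>I3. d3 i a = x i"
    using radix[OF fin(3)] unfolding P by auto
  \<comment> \<open>Place values inside the three groups: the weighted index sum of
    \<open>pick a b c\<close> is \<open>a + b + c\<close>.\<close>
  define W where "W i = (if i \<in> I1 then w1 i else if i \<in> I2 then w2 i else w3 i)" for i
  define pick where "pick a b c = map (\<lambda>i. if i \<in> I1 then d1 i a else if i \<in> I2 then d2 i b else d3 i c) [0..<?d]"
    for a b c
  have lt: "i < ?d" if "i \<in> I1 \<or> i \<in> I2 \<or> i \<in> I3" for i using that part(1) by blast
  have disj: "i \<in> I2 \<Longrightarrow> i \<notin> I1" "i \<in> I3 \<Longrightarrow> i \<notin> I1" "i \<in> I3 \<Longrightarrow> i \<notin> I2" for i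
    using part(2-4) by blast+
  have pick1: "pick a b c ! i = d1 i a" if "i \<in> I1" for a b c i
    using that lt[of i] by (simp add: pick_def)
  have pick2: "pick a b c ! i = d2 i b" if "i \<in> I2" for a b c i
    using that lt[of i] disj[of i] by (simp add: pick_def)
  have pick3: "pick a b c ! i = d3 i c" if "i \<in> I3" for a b c i
    using that lt[of i] disj[of i] by (simp add: pick_def)
  have cover: "i \<in> I1 \<or> i \<in> I2 \<or> i \<in> I3" if "i < ?d" for i using that part(1) by blast
  have pick_mem: "pick a b c \<in> multi_indices ns" if abc: "a < P" "b < Q" "c < S" for a b c
  proof -
    have "pick a b c ! i < ns ! i" if "i < ?d" for i
      using cover[OF that] by (elim disjE) (simp_all add: pick1 pick2 pick3 d1(2) d2(2) d3(2) abc)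
    then show ?thesis by (simp add: multi_indices_def) (simp add: pick_def)
  qed
  have pick_weight: "(\<Sum>i<?d. W i * pick a b c ! i) = a + b + c" if "a < P" "b < Q" "c < S" for a b c
  proof -
    have "(\<Sum>i\<in>I1. W i * pick a b c ! i) = (\<Sum>i\<in>I1. w1 i * d1 i a)"
      by (intro sum.cong) (auto simp: W_def pick1)
    moreover have "(\<Sum>i\<in>I2. W i * pick a b c ! i) = (\<Sum>i\<in>I2. w2 i * d2 i b)"
      by (intro sum.cong) (auto simp: W_def pick2 dest: disj)
    moreover have "(\<Sum>i\<in>I3. W i * pick a b c ! i) = (\<Sum>i\<in>I3. w3 i * d3 i c)"
      by (intro sum.cong) (auto simp: W_def pick3 dest: disj)
    ultimately show ?thesis using that by (simp add: split d1(1) d2(1) d3(1))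
  qed
  have pick_surj: "\<exists>a b c. a < P \<and> b < Q \<and> c < S \<and> idx = pick a b c" if idx: "idx \<in> multi_indices ns" for idx
  proof -
    have bound: "idx ! i < ns ! i" if "i < ?d" for i using idx that by (simp add: multi_indices_def)
    have "\<exists>a < P. \<forall>i\<in>I1. d1 i a = idx ! i" using lt by (intro d1(3) ballI bound) blast
    moreover have "\<exists>a < Q. \<forall>i\<in>I2. d2 i a = idx ! i" using lt by (intro d2(3) ballI bound) blast
    moreover have "\<exists>a < S. \<forall>i\<in>I3. d3 i a = idx ! i" using lt by (intro d3(3) ballI bound) blast
    ultimately obtain a b c where abc: "a < P" "b < Q" "c < S" "\<forall>i\<in>I1. d1 i a = idx ! i"
      "\<forall>i\<in>I2. d2 i b = idx ! i" "\<forall>i\<in>I3. d3 i c = idx ! i" by blast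
    have "idx = pick a b c"
    proof (rule nth_equalityI)
      show "length idx = length (pick a b c)" using idx by (simp add: pick_def multi_indices_def)
      fix i assume "i < length idx"
      then have "i < ?d" using idx by (simp add: multi_indices_def)
      then show "idx ! i = pick a b c ! i" using cover[of i] abc pick1 pick2 pick3 by metis
    qed
    then show ?thesis using abc by blast
  qed
  \<comment> \<open>The exponent is bilinear in the digit \<open>j\<close> and the entry
    \<open>l\<close>, so over all factors and positions the exponents add up to \<open>J\<close>
    times the weighted index sum.\<close>
  define p :: "param \<Rightarrow> 'a" where
    "p = (\<lambda>(k, j, i, l). if (k, j, i, l) \<in> ?V then 2 ^ (s k * j * (W i * l)) else 1)"
  have pnz: "p v \<noteq> 0" for v by (cases v) (auto simp: p_def)
  have p1: "p v = 1" if "v \<notin> ?V" for v using that by (cases v) (auto simp: p_def)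
  \<comment> \<open>The formula also covers the parameters fixed to 1, since \<open>j = 0\<close> or
    \<open>l = 0\<close> there.\<close>
  have pslot: "p (k, j, i, l) = 2 ^ (s k * j * (W i * l))" if "(k, j, i, l) \<in> all_params ns rs" for k j i l
    using that by (auto simp: p_def all_params_def factor_params_def free_params_def
        summand_indices_def free_factor_params_def)
  define X where "X J idx = (\<Prod>y\<in>?Y. p (slot ns dig J idx y))" for J idx
  have X: "X J idx = (2 ^ J) ^ (\<Sum>i<?d. W i * idx ! i)" if J: "J < R" and idx: "idx \<in> multi_indices ns" for J idx
  proof -
    have mem: "slot ns dig J idx (k, i) \<in> all_params ns rs" if "k < ?m" "i < Suc ?d" for k i
      using that dig(2)[OF J, of k] idx
      by (auto simp: slot_def all_params_def factor_params_def multi_indices_def)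
    have "X J idx = (\<Prod>k<?m. \<Prod>i<Suc ?d. p (slot ns dig J idx (k, i)))"
      unfolding X_def by (simp add: prod.cartesian_product case_prod_unfold del: prod.lessThan_Suc)
    also have "\<dots> = (\<Prod>k<?m. \<Prod>i<Suc ?d. 2 ^ (s k * dig k J * (if i < ?d then W i * idx ! i else 0)))"
    proof (intro prod.cong refl)
      fix k i assume "k \<in> {..<?m}" "i \<in> {..<Suc ?d}"
      then have "slot ns dig J idx (k, i) \<in> all_params ns rs" by (intro mem) auto
      then show "p (slot ns dig J idx (k, i)) = 2 ^ (s k * dig k J * (if i < ?d then W i * idx ! i else 0))"
        unfolding slot_def by (auto simp: pslot)
    qed
    also have "\<dots> = 2 ^ (\<Sum>k<?m. \<Sum>i<?d. s k * dig k J * (W i * idx ! i))"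
      by (simp add: power_sum)
    also have "(\<Sum>k<?m. \<Sum>i<?d. s k * dig k J * (W i * idx ! i)) = J * (\<Sum>i<?d. W i * idx ! i)"
      unfolding sum_product[symmetric] dig(1)[OF J] ..
    finally show ?thesis by (simp add: power_mult)
  qed
  define D where "D w idx = (\<Sum>J<R. X J idx * (\<Sum>y\<in>?Y. if w = slot ns dig J idx y then 1 / p w else 0))"
    for w idx
  have jet: "has_jet p ?V (\<lambda>u. hadamard_param ns rs u idx) (\<lambda>w. D w idx)" if "idx \<in> multi_indices ns" for idx
    unfolding D_def X_def by (rule has_jet_hadamard_param[OF finite_free_params bij that pnz])
  have "independent_family (multi_indices ns) (insert None (Some ` ?V)) (case_option (hadamard_param ns rs p) D)"
    unfolding independent_family_def
  proof (intro allI impI)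
    fix c
    assume rel: "\<forall>idx\<in>multi_indices ns.
      (\<Sum>b\<in>insert None (Some ` ?V). c b * case_option (hadamard_param ns rs p) D b idx) = 0"
    define G where "G v = (if v \<in> ?V then c (Some v) / p v else 0)" for v
    define h where "h k j idx = G (k, j, ?d, 0) + (\<Sum>i<?d. G (k, j, i, idx ! i))" for k j and idx :: "nat list"
    have rel': "(\<Sum>J<R. X J idx * (c None + (\<Sum>k<?m. h k (dig k J) idx))) = 0"
      if idx: "idx \<in> multi_indices ns" for idx
    proof -
      have "(\<Sum>w\<in>?V. c (Some w) * D w idx) =
          (\<Sum>J<R. \<Sum>w\<in>?V. X J idx * (\<Sum>y\<in>?Y. if w = slot ns dig J idx y then c (Some w) / p w else 0))"
        unfolding D_def sum_distrib_left by (subst sum.swap) (auto intro!: sum.cong)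
      also have "\<dots> = (\<Sum>J<R. X J idx * (\<Sum>y\<in>?Y. G (slot ns dig J idx y)))"
      proof (intro sum.cong refl)
        fix J
        have "(\<Sum>w\<in>?V. \<Sum>y\<in>?Y. if w = slot ns dig J idx y then c (Some w) / p w else 0) =
            (\<Sum>y\<in>?Y. G (slot ns dig J idx y))"
          by (subst sum.swap) (simp add: G_def finite_free_params)
        then show "(\<Sum>w\<in>?V. X J idx * (\<Sum>y\<in>?Y. if w = slot ns dig J idx y then c (Some w) / p w else 0)) =
            X J idx * (\<Sum>y\<in>?Y. G (slot ns dig J idx y))"
          unfolding sum_distrib_left[symmetric] by simp
      qed
      also have "\<dots> = (\<Sum>J<R. X J idx * (\<Sum>k<?m. h k (dig k J) idx))"
      proof (intro sum.cong refl arg_cong2[where f = "(*)"])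
        fix J
        have "(\<Sum>y\<in>?Y. G (slot ns dig J idx y)) = (\<Sum>k<?m. \<Sum>i<Suc ?d. G (slot ns dig J idx (k, i)))"
          by (simp add: sum.cartesian_product case_prod_unfold del: sum.lessThan_Suc)
        then show "(\<Sum>y\<in>?Y. G (slot ns dig J idx y)) = (\<Sum>k<?m. h k (dig k J) idx)"
          by (simp add: h_def slot_def add.commute)
      qed
      finally have "(\<Sum>w\<in>?V. c (Some w) * D w idx) = (\<Sum>J<R. X J idx * (\<Sum>k<?m. h k (dig k J) idx))" .
      moreover have "c None * hadamard_param ns rs p idx = (\<Sum>J<R. X J idx * c None)"
      proof -
        have "hadamard_param ns rs p idx = (\<Sum>J<R. X J idx)"
          unfolding X_def by (rule hadamard_param_expand[OF bij idx])
        then show ?thesis by (simp add: sum_distrib_left mult.commute)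
      qed
      moreover have "c None * hadamard_param ns rs p idx + (\<Sum>w\<in>?V. c (Some w) * D w idx) = 0"
        using rel idx by (simp add: finite_free_params sum.reindex)
      ultimately show ?thesis by (simp add: distrib_left sum.distrib)
    qed
    \<comment> \<open>\<open>c None\<close> and the coefficient terms do not depend on the index;
      they could go to any of the three groups.\<close>
    define \<rho> where "\<rho> J a = c None + (\<Sum>k<?m. G (k, dig k J, ?d, 0)) + (\<Sum>i\<in>I1. \<Sum>k<?m. G (k, dig k J, i, d1 i a))"
      for J a
    define \<sigma> where "\<sigma> J b = (\<Sum>i\<in>I2. \<Sum>k<?m. G (k, dig k J, i, d2 i b))" for J b
    define \<tau> where "\<tau> J e = (\<Sum>i\<in>I3. \<Sum>k<?m. G (k, dig k J, i, d3 i e))" for J e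
    have total: "c None + (\<Sum>k<?m. h k (dig k J) (pick a b e)) = \<rho> J a + \<sigma> J b + \<tau> J e" for J a b e
    proof -
      have "(\<Sum>k<?m. h k (dig k J) (pick a b e)) = (\<Sum>k<?m. G (k, dig k J, ?d, 0)) +
          (\<Sum>i<?d. \<Sum>k<?m. G (k, dig k J, i, pick a b e ! i))"
        unfolding h_def sum.distrib by (subst (2) sum.swap) simp
      then show ?thesis
        unfolding split by (simp add: \<rho>_def \<sigma>_def \<tau>_def pick1 pick2 pick3)
    qed
    have pos: "P > 0" "Q > 0" "S > 0"
      unfolding P using ns part(1) fin by (auto simp: Suc_le_eq intro!: prod_pos)
    have inj: "inj (\<lambda>j. 2 ^ j :: 'a)"
    proof (rule injI)
      fix i j :: nat assume "2 ^ i = (2 ^ j :: 'a)"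
      then have "of_nat (2 ^ i) = (of_nat (2 ^ j) :: 'a)" by simp
      then show "i = j" by (simp only: of_nat_eq_iff) simp
    qed
    have zero: "(\<Sum>J<R. (2 ^ J) ^ (a + b + e) * (\<rho> J a + \<sigma> J b + \<tau> J e)) = 0"
      if "a < P" "b < Q" "e < S" for a b e
    proof -
      have "(\<Sum>J<R. X J (pick a b e) * (\<rho> J a + \<sigma> J b + \<tau> J e)) = 0"
        using rel'[OF pick_mem[OF that]] by (simp add: total)
      then show ?thesis by (simp add: X pick_mem pick_weight that)
    qed
    have tangent: "\<rho> J a + \<sigma> J b + \<tau> J e = 0" if "J < R" "a < P" "b < Q" "e < S" for J a b e
      using tangent_spaces_independent[OF inj _ zero pos range that] by simp
    have "c None = 0 \<and> (\<forall>v\<in>?V. G v = 0)"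
    proof (rule separate_summand_contributions[OF rs ns])
      show "G v = 0" if "v \<notin> ?V" for v using that by (simp add: G_def)
      fix x idx assume x: "\<forall>k<?m. x k < rs ! k" and idx: "idx \<in> multi_indices ns"
      obtain J where J: "J < R" "\<forall>k\<in>{..<?m}. dig k J = x k" using dig(3)[of x] x by auto
      obtain a b e where abe: "a < P" "b < Q" "e < S" "idx = pick a b e" using pick_surj[OF idx] by blast
      have "(\<Sum>k<?m. h k (x k) idx) = (\<Sum>k<?m. h k (dig k J) idx)" using J by (intro sum.cong) auto
      then show "c None + (\<Sum>k<?m. G (k, x k, ?d, 0) + (\<Sum>i<?d. G (k, x k, i, idx ! i))) = 0"
        using total[of J a b e] tangent[OF J(1) abe(1-3)] abe(4) by (simp add: h_def)
    qed
    then show "\<forall>b\<in>insert None (Some ` ?V). c b = 0" using pnz by (auto simp: G_def split: if_splits)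
  qed
  then show ?thesis using p1 jet by blast
qed

section \<open>Dimensions\<close>

text \<open>A nonzero coefficient is absorbed into the first vector of its summand; a summand with
  coefficient 0 is dropped, because \<open>rank_one\<close> demands nonzero vectors.\<close>

lemma rank_at_most_sum_outer_products:
  assumes d: "length ns \<ge> 1" and nz: "\<And>j i. j < r \<Longrightarrow> i < length ns \<Longrightarrow> \<exists>l<ns ! i. a j i l \<noteq> 0"
  shows "rank_at_most ns r (\<lambda>is. \<Sum>j<r. c j * outer_product ns (a j) is)"
  using nz
proof (induction r)
  case 0
  then show ?case by (auto simp: rank_at_most_def)
next
  case (Suc r)
  then have "rank_at_most ns r (\<lambda>is. \<Sum>j<r. c j * outer_product ns (a j) is)" by simp
  then obtain s A where A: "s \<le> r" "\<And>j. j < s \<Longrightarrow> rank_one ns (A j)"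
      "(\<lambda>is. \<Sum>j<r. c j * outer_product ns (a j) is) = (\<lambda>is. \<Sum>j<s. A j is)"
    unfolding rank_at_most_def by blast
  show ?case
  proof (cases "c r = 0")
    case True
    then show ?thesis using A unfolding rank_at_most_def
      by (intro exI[of _ s] conjI exI[of _ A]) auto
  next
    case False
    define a' where "a' i l = (if i = 0 then c r * a r i l else a r i l)" for i l
    have "{..<length ns} = insert 0 {1..<length ns}" using d by auto
    then have "(\<Prod>i<length ns. a' i (is ! i)) = c r * (\<Prod>i<length ns. a r i (is ! i))" for "is"
      by (simp add: a'_def)
    then have outer: "outer_product ns a' = (\<lambda>is. c r * outer_product ns (a r) is)"
      by (auto simp: outer_product_def fun_eq_iff)
    have "rank_one ns (outer_product ns a')"
      unfolding rank_one_def using Suc.prems[of r] False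
      by (intro exI[of _ a'] conjI allI impI refl) (auto simp: a'_def)
    then have "\<forall>j<Suc s. rank_one ns ((A(s := outer_product ns a')) j)"
      using A(2) by (auto simp: less_Suc_eq)
    moreover have "(\<lambda>is. \<Sum>j<Suc r. c j * outer_product ns (a j) is) =
        (\<lambda>is. \<Sum>j<Suc s. (A(s := outer_product ns a')) j is)"
      using fun_cong[OF A(3)] by (simp add: outer fun_eq_iff)
    ultimately show ?thesis using A(1) unfolding rank_at_most_def
      by (intro exI[of _ "Suc s"] conjI exI[of _ "A(s := outer_product ns a')"]) auto
  qed
qed

definition hadamard_tensors :: "nat list \<Rightarrow> nat list \<Rightarrow> 'a::field tensor set" where
  "hadamard_tensors ns rs = {T. \<exists>Ts. (\<forall>k<length rs. rank_at_most ns (rs ! k) (Ts k)) \<and>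
     T = (\<lambda>is. \<Prod>k<length rs. Ts k is)}"

text \<open>The leading entries 1 of normalized parameters keep all vectors nonzero, as
  \<open>rank_one\<close> demands.\<close>

lemma hadamard_param_in_hadamard_tensors:
  fixes u :: "param \<Rightarrow> 'a::field"
  assumes d: "length ns \<ge> 1" and m: "length rs \<ge> 1" and ns: "\<forall>i<length ns. ns ! i \<ge> 1"
    and u: "u \<in> affine_chart (\<lambda>_. 1) (free_params ns rs)"
  shows "hadamard_param ns rs u \<in> hadamard_tensors ns rs"
proof -
  define T where "T k is = (\<Sum>j<rs ! k. u (k, j, length ns, 0) *
      outer_product ns (\<lambda>i l. u (k, j, i, l)) is)" for k "is"
  have "\<exists>l<ns ! i. u (k, j, i, l) \<noteq> 0" if "i < length ns" for k j i
  proof -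
    have "(k, j, i, 0) \<notin> free_params ns rs"
      using that by (auto simp: free_params_def free_factor_params_def)
    then have "u (k, j, i, 0) = 1" using u by (simp add: affine_chart_def)
    then show ?thesis using ns[rule_format, OF that] by (intro exI[of _ 0]) auto
  qed
  then have "rank_at_most ns (rs ! k) (T k)" for k
    unfolding T_def by (intro rank_at_most_sum_outer_products[OF d])
  moreover have "hadamard_param ns rs u = (\<lambda>is. \<Prod>k<length rs. T k is)"
  proof
    fix idx
    show "hadamard_param ns rs u idx = (\<Prod>k<length rs. T k idx)"
    proof (cases "idx \<in> multi_indices ns")
      case True
      then show ?thesis by (simp add: hadamard_param_def rank_sum_def T_def outer_product_def)
    next
      case False
      then show ?thesis using m
        by (cases rs) (simp_all add: hadamard_param_def T_def outer_product_def)
    qed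
  qed
  ultimately show ?thesis unfolding hadamard_tensors_def by blast
qed

lemma hadamard_tensors_subset_param:
  fixes T :: "'a::field tensor"
  assumes m: "length rs \<ge> 1" and T: "T \<in> hadamard_tensors ns rs"
  shows "\<exists>u. T = hadamard_param ns rs u"
proof -
  obtain Ts where Ts: "\<And>k. k < length rs \<Longrightarrow> rank_at_most ns (rs ! k) (Ts k)"
    and T: "T = (\<lambda>is. \<Prod>k<length rs. Ts k is)"
    using T unfolding hadamard_tensors_def by blast
  have "\<exists>s a. s \<le> rs ! k \<and> Ts k = (\<lambda>is. \<Sum>j<s. outer_product ns (a j) is)" if k: "k < length rs" for k
  proof -
    obtain s A where sA: "s \<le> rs ! k" "\<And>j. j < s \<Longrightarrow> rank_one ns (A j)" "Ts k = (\<lambda>is. \<Sum>j<s. A j is)"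
      using Ts[OF k] unfolding rank_at_most_def by blast
    then have "\<forall>j. \<exists>a. j < s \<longrightarrow> A j = outer_product ns a" unfolding rank_one_def by blast
    then obtain a where a: "\<And>j. j < s \<Longrightarrow> A j = outer_product ns (a j)" by metis
    have "Ts k = (\<lambda>is. \<Sum>j<s. outer_product ns (a j) is)"
      unfolding sA(3) using a by (intro ext sum.cong) auto
    then show ?thesis using sA(1) by blast
  qed
  then obtain s a where sa: "\<And>k. k < length rs \<Longrightarrow> s k \<le> rs ! k"
    "\<And>k. k < length rs \<Longrightarrow> Ts k = (\<lambda>is. \<Sum>j<s k. outer_product ns (a k j) is)" by metis
  \<comment> \<open>Tensors with fewer than \<open>rs ! k\<close> summands are padded with
    coefficients 0.\<close>
  define u where "u = (\<lambda>(k, j, i, l). if i = length ns then (if j < s k then 1 else 0) else a k j i l)"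
  have "T idx = hadamard_param ns rs u idx" for idx
  proof (cases "idx \<in> multi_indices ns")
    case True
    have "Ts k idx = rank_sum ns u k (rs ! k) idx" if k: "k < length rs" for k
    proof -
      have "rank_sum ns u k (rs ! k) idx =
          (\<Sum>j<rs ! k. if j < s k then \<Prod>i<length ns. a k j i (idx ! i) else 0)"
        unfolding rank_sum_def by (intro sum.cong) (auto simp: u_def)
      also have "\<dots> = (\<Sum>j<s k. \<Prod>i<length ns. a k j i (idx ! i))"
        using sa(1)[OF k] by (intro sum.mono_neutral_cong_right) auto
      finally show ?thesis using True by (simp add: sa(2)[OF k] outer_product_def)
    qed
    then show ?thesis using True by (simp add: T hadamard_param_def)
  next
    case False
    then have "Ts 0 idx = 0" using sa(2)[of 0] m by (simp add: outer_product_def Suc_le_eq)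
    then show ?thesis using False m by (auto simp: T hadamard_param_def Suc_le_eq)
  qed
  then show ?thesis by blast
qed

text \<open>
  The bound of Kruskal's theorem, with truncated subtractions, for a partition into groups with
  index ranges of sizes \<open>P\<close>, \<open>Q\<close>, \<open>S\<close>.
\<close>

definition tangent_range :: "nat list \<Rightarrow> nat \<Rightarrow> bool" where
  "tangent_range ns R \<longleftrightarrow> (\<exists>I1 I2 I3. I1 \<union> I2 \<union> I3 = {..<length ns} \<and>
    I1 \<inter> I2 = {} \<and> I1 \<inter> I3 = {} \<and> I2 \<inter> I3 = {} \<and>
    (R = 1 \<or> (R - (\<Prod>i\<in>I1. ns ! i)) + (R - (\<Prod>i\<in>I2. ns ! i)) + (R - (\<Prod>i\<in>I3. ns ! i)) + 2 \<le> R))"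

text \<open>The truncated differences give four cases. If all three sizes are below
  \<open>R\<close>, the claim is 2R + 2 \<le> P + Q + S, from the branch \<delta>/2 of the minimum;
  if only P reaches \<open>R\<close>, it is R + 2 \<le> Q + S, from the branch \<delta>; if P and Q
  do, it is S \<ge> 2; if all do, \<open>R\<close> is 1 or at least 2. Each bound passes to smaller
  \<open>R\<close>.\<close>

lemma kruskal_range_imp_tangent_range:
  assumes "kruskal_range ns R0" "1 \<le> R" "R \<le> R0"
  shows "tangent_range ns R"
proof -
  obtain I J K where part: "I \<union> J \<union> K = {..<length ns}" "I \<inter> J = {}" "I \<inter> K = {}" "J \<inter> K = {}"
    and "(let p = (\<lambda>X. \<Prod>x\<in>X. ns ! x); \<delta> = real (p J) + real (p K) - real (p I) - 2
        in p I \<ge> p J \<and> p J \<ge> p K \<and> p K \<ge> 2 \<and> real R0 \<le> real (p I) + min (\<delta> / 2) \<delta>)"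
    using assms(1) unfolding kruskal_range_def by blast
  moreover define P Q S where "P = (\<Prod>i\<in>I. ns ! i)" "Q = (\<Prod>i\<in>J. ns ! i)" "S = (\<Prod>i\<in>K. ns ! i)"
  ultimately have ord: "Q \<le> P" "S \<le> Q" "2 \<le> S"
    and le: "real R0 \<le> real P + min ((real Q + real S - real P - 2) / 2) (real Q + real S - real P - 2)"
    unfolding Let_def by auto
  have "real R0 \<le> real P + (real Q + real S - real P - 2) / 2" using le by linarith
  then have "2 * real R0 + 2 \<le> real P + real Q + real S" by (simp add: field_simps)
  then have r1: "2 * R0 + 2 \<le> P + Q + S" by linarith
  have "real R0 + 2 \<le> real Q + real S" using le by linarith
  then have r2: "R0 + 2 \<le> Q + S" by linarith
  have "R = 1 \<or> (R - P) + (R - Q) + (R - S) + 2 \<le> R"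
    using ord r1 r2 assms(2,3) by linarith
  then show ?thesis using part unfolding tangent_range_def P_Q_S_def by blast
qed

lemma kruskal_range_nth_pos:
  assumes "kruskal_range ns R" "i < length ns"
  shows "ns ! i \<ge> 1"
proof -
  obtain I J K where part: "I \<union> J \<union> K = {..<length ns}"
    and "(\<Prod>x\<in>K. ns ! x) \<ge> 2" "(\<Prod>x\<in>J. ns ! x) \<ge> (\<Prod>x\<in>K. ns ! x)" "(\<Prod>x\<in>I. ns ! x) \<ge> (\<Prod>x\<in>J. ns ! x)"
    using assms(1) unfolding kruskal_range_def Let_def by blast
  then have pos: "(\<Prod>x\<in>I. ns ! x) \<noteq> 0" "(\<Prod>x\<in>J. ns ! x) \<noteq> 0" "(\<Prod>x\<in>K. ns ! x) \<noteq> 0" by linarith+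
  have fin: "finite I" "finite J" "finite K"
    using part by (auto intro: finite_subset[of _ "{..<length ns}"])
  have "i \<in> I \<or> i \<in> J \<or> i \<in> K" using part assms(2) by blast
  then have "ns ! i \<noteq> 0" using pos fin by (metis prod_zero_iff)
  then show ?thesis by simp
qed

section \<open>Dimensions of the Hadamard secant, secant and Segre varieties\<close>

text \<open>\<open>X\<close> only has to lie between the image of the chart and the closure of the
  full image, so \<open>segre\<close>, defined without a closure, is treated like
  \<open>hadamard_secant\<close>. The second conjunct counts independent vectors in the tensor
  space.\<close>

lemma krull_dim_parametrized:
  fixes X :: "'a::field_char_0 tensor set set"
  assumes rs: "length rs \<ge> 1" "\<forall>k<length rs. rs ! k \<ge> 1" and ns: "\<forall>i<length ns. ns ! i \<ge> 1"
    and range: "tangent_range ns (prod_list rs)"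
    and X: "X \<subseteq> proj_space (multi_indices ns)"
    and image: "projectivization (hadamard_param ns rs ` affine_chart (\<lambda>_. 1) (free_params ns rs)) \<subseteq> X"
    and dense: "\<And>e f x. form e f \<Longrightarrow> (\<And>u. poly_eval (hadamard_param ns rs u) f = 0) \<Longrightarrow>
      x \<in> \<Union>X \<Longrightarrow> poly_eval x f = 0"
  shows "krull_dim (subtopology (zariski (multi_indices ns)) X) = ereal (real (card (free_params ns rs)))
    \<and> card (free_params ns rs) + 1 \<le> prod_list ns"
proof -
  let ?V = "free_params ns rs"
  note lp = line_poly_hadamard_param[of rs ns]
  obtain I1 I2 I3 where part: "I1 \<union> I2 \<union> I3 = {..<length ns}" "I1 \<inter> I2 = {}" "I1 \<inter> I3 = {}" "I2 \<inter> I3 = {}"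
    and rng: "prod_list rs = 1 \<or> (prod_list rs - (\<Prod>i\<in>I1. ns ! i)) + (prod_list rs - (\<Prod>i\<in>I2. ns ! i)) +
      (prod_list rs - (\<Prod>i\<in>I3. ns ! i)) + 2 \<le> prod_list rs"
    using range unfolding tangent_range_def by blast
  obtain p :: "param \<Rightarrow> 'a" and D where p: "\<And>v. v \<notin> ?V \<Longrightarrow> p v = 1"
    and jet: "\<And>idx. idx \<in> multi_indices ns \<Longrightarrow>
      has_jet p ?V (\<lambda>u. hadamard_param ns rs u idx) (\<lambda>w. D w idx)"
    and ind: "independent_family (multi_indices ns) (insert None (Some ` ?V))
      (case_option (hadamard_param ns rs p) D)"
    using hadamard_param_tangent_independent[OF rs ns part refl refl refl refl rng, where 'a = 'a]
    by blast
  have chart: "affine_chart p ?V = affine_chart (\<lambda>_. 1) ?V" using p by (auto simp: affine_chart_def)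
  have le: "krull_dim (subtopology (zariski (multi_indices ns)) X) \<le> ereal (real (card ?V))"
  proof (rule krull_dim_le_card_parameters[OF X finite_free_params lp])
    fix e and x :: "'a tensor" and f :: "(nat list, 'a) mpoly"
    assume f: "form e f" and zero: "\<And>u. u \<in> affine_chart (\<lambda>_. 1) ?V \<Longrightarrow> poly_eval (hadamard_param ns rs u) f = 0"
      and x: "x \<in> \<Union>X"
    show "poly_eval x f = 0"
      by (rule dense[OF f _ x]) (rule form_zero_on_chart_imp_zero[OF rs ns f zero])
  qed
  have "ereal (real (card ?V)) \<le> krull_dim (subtopology (zariski (multi_indices ns)) X)"
    by (rule card_parameters_le_krull_dim[OF X finite_free_params finite_multi_indices lp _ jet ind])
      (use image chart in auto)
  moreover have "card (insert None (Some ` ?V)) \<le> card (multi_indices ns)"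
    by (rule independent_family_card_le[OF ind finite_multi_indices]) (simp add: finite_free_params)
  ultimately show ?thesis
    using le by (simp add: card_multi_indices finite_free_params card_image)
qed

lemma hadamard_param_in_coord_space: "hadamard_param ns rs u \<in> coord_space (multi_indices ns)"
  by (simp add: coord_space_def hadamard_param_def)

lemma hadamard_secant_eq:
  "hadamard_secant ns rs = zariski (multi_indices ns) closure_of projectivization (hadamard_tensors ns rs)"
  by (simp add: hadamard_secant_def hadamard_tensors_def)

lemma secant_eq_hadamard_secant: "secant ns r = hadamard_secant ns [r]"
proof -
  have "{T :: 'a tensor. rank_at_most ns r T} = hadamard_tensors ns [r]"
    unfolding hadamard_tensors_def by (auto intro: exI[of _ "\<lambda>_. _"])
  then show ?thesis by (simp add: secant_def hadamard_secant_eq)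
qed

lemma var_dim_hadamard_secant:
  assumes d: "length ns \<ge> 1" and rs: "length rs \<ge> 1" "\<forall>k<length rs. rs ! k \<ge> 1"
    and ns: "\<forall>i<length ns. ns ! i \<ge> 1" and range: "tangent_range ns (prod_list rs)"
  shows "var_dim ns (hadamard_secant ns rs :: 'a::field_char_0 tensor set set) =
      ereal (real (card (free_params ns rs)))
    \<and> card (free_params ns rs) + 1 \<le> prod_list ns"
  unfolding var_dim_def
proof (rule krull_dim_parametrized[OF rs ns range])
  let ?I = "multi_indices ns"
  let ?Y = "projectivization (hadamard_tensors ns rs) :: 'a tensor set set"
  have H: "hadamard_tensors ns rs \<subseteq> (coord_space ?I :: 'a tensor set)"
    using hadamard_tensors_subset_param[OF rs(1)] hadamard_param_in_coord_space by blast
  then have Y: "?Y \<subseteq> proj_space ?I" unfolding projectivization_def by blast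
  show "(hadamard_secant ns rs :: 'a tensor set set) \<subseteq> proj_space ?I"
    unfolding hadamard_secant_eq topspace_zariski[symmetric] by (rule closure_of_subset_topspace)
  have "?Y \<subseteq> hadamard_secant ns rs"
    unfolding hadamard_secant_eq using Y by (intro closure_of_subset) (simp add: topspace_zariski)
  moreover have "projectivization (hadamard_param ns rs ` affine_chart (\<lambda>_. 1) (free_params ns rs)) \<subseteq> ?Y"
    unfolding projectivization_def using hadamard_param_in_hadamard_tensors[OF d rs(1) ns] by blast
  ultimately show "projectivization (hadamard_param ns rs ` affine_chart (\<lambda>_. 1) (free_params ns rs))
      \<subseteq> (hadamard_secant ns rs :: 'a tensor set set)" by blast
  fix e and x :: "'a tensor" and f :: "(nat list, 'a) mpoly"
  assume f: "form e f" and zero: "\<And>u. poly_eval (hadamard_param ns rs u) f = 0"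
    and x: "x \<in> \<Union>(hadamard_secant ns rs)"
  have "poly_eval y f = 0" if y: "y \<in> Q" and Q: "Q \<in> ?Y" for y Q
  proof -
    obtain c T where T: "T \<in> hadamard_tensors ns rs" "y = (\<lambda>v. c * T v)"
      using y Q unfolding projectivization_def proj_class_def by blast
    then obtain u where "T = hadamard_param ns rs u"
      using hadamard_tensors_subset_param[OF rs(1)] by blast
    then show ?thesis using T zero f by (simp add: form_eval_scale)
  qed
  then have "?Y \<subseteq> proj_zeros ?I {f}" using Y by (auto simp: proj_zeros_def)
  moreover have "closedin (zariski ?I) (proj_zeros ?I {f})"
    unfolding closedin_zariski using f homogeneous_iff_form by (intro exI[of _ "{f}"]) blast
  ultimately have "hadamard_secant ns rs \<subseteq> proj_zeros ?I {f}"
    unfolding hadamard_secant_eq by (rule closure_of_minimal)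
  then show "poly_eval x f = 0" using x by (auto simp: proj_zeros_def)
qed

text \<open>For \<open>rs = [1]\<close> the only coefficient is normalized to 1, so normalized
  parameters yield rank one tensors themselves and \<open>segre\<close> contains their
  classes.\<close>

lemma var_dim_segre:
  assumes d: "length ns \<ge> 1" and ns: "\<forall>i<length ns. ns ! i \<ge> 1" and range: "tangent_range ns 1"
  shows "var_dim ns (segre ns :: 'a::field_char_0 tensor set set) = ereal (real (card (free_params ns [1])))"
proof -
  have rs: "length [1::nat] \<ge> 1" "\<forall>k<length [1::nat]. [1::nat] ! k \<ge> 1" by auto
  have range': "tangent_range ns (prod_list [1])" using range by simp
  have param: "hadamard_param ns [1] u = (\<lambda>is. u (0, 0, length ns, 0) * outer_product ns (\<lambda>i l. u (0, 0, i, l)) is)"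
    for u :: "param \<Rightarrow> 'a"
    by (auto simp: hadamard_param_def rank_sum_def outer_product_def fun_eq_iff)
  have onto: "\<exists>u. T = hadamard_param ns [1] u" if T: "rank_one ns T" for T :: "'a tensor"
  proof -
    obtain a where a: "T = outer_product ns a" using T unfolding rank_one_def by blast
    have "T = hadamard_param ns [1] (\<lambda>(k, j, i, l). if i = length ns then 1 else a i l)"
      unfolding param a by (auto simp: outer_product_def fun_eq_iff intro!: prod.cong)
    then show ?thesis by blast
  qed
  have "krull_dim (subtopology (zariski (multi_indices ns)) (segre ns :: 'a tensor set set)) =
      ereal (real (card (free_params ns [1]))) \<and> card (free_params ns [1]) + 1 \<le> prod_list ns"
  proof (rule krull_dim_parametrized[OF rs ns range'])
    show "(segre ns :: 'a tensor set set) \<subseteq> proj_space (multi_indices ns)"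
      unfolding segre_def projectivization_def using onto hadamard_param_in_coord_space by blast
    have "rank_one ns (hadamard_param ns [1] u)"
      if u: "u \<in> affine_chart (\<lambda>_. 1) (free_params ns [1])" for u :: "param \<Rightarrow> 'a"
    proof -
      have one: "u (0, 0, length ns, 0) = 1" "\<And>i. i < length ns \<Longrightarrow> u (0, 0, i, 0) = 1"
        using u by (auto simp: affine_chart_def free_params_def free_factor_params_def)
      have "\<exists>l<ns ! i. u (0, 0, i, l) \<noteq> 0" if "i < length ns" for i
        using one(2)[OF that] ns[rule_format, OF that] by (intro exI[of _ 0]) auto
      then show ?thesis unfolding rank_one_def param one(1)
        by (intro exI[of _ "\<lambda>i l. u (0, 0, i, l)"]) auto
    qed
    then show "projectivization (hadamard_param ns [1] ` affine_chart (\<lambda>_. 1) (free_params ns [1]))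
        \<subseteq> (segre ns :: 'a tensor set set)"
      unfolding segre_def projectivization_def by blast
    fix e and x :: "'a tensor" and f :: "(nat list, 'a) mpoly"
    assume f: "form e f" and zero: "\<And>u. poly_eval (hadamard_param ns [1] u) f = 0"
      and x: "x \<in> \<Union>(segre ns)"
    obtain c T where T: "rank_one ns T" "x = (\<lambda>v. c * T v)"
      using x unfolding segre_def projectivization_def proj_class_def by blast
    then obtain u where "T = hadamard_param ns [1] u" using onto by blast
    then show "poly_eval x f = 0" using T zero f by (simp add: form_eval_scale)
  qed
  then show ?thesis by (simp add: var_dim_def)
qed

theorem corollary4p8:
  fixes ns rs :: "nat list"
  assumes "length ns \<ge> 3"
    and "length rs \<ge> 1"
    and "\<forall>r\<in>set rs. r \<ge> 2"
    and "kruskal_range ns (prod_list rs)"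
  shows "var_dim ns (hadamard_secant ns rs :: 'a::field_char_0 tensor set set) =
    min ((\<Sum>j<length rs. var_dim ns (secant ns (rs ! j) :: 'a tensor set set))
           - ereal (real (length rs) - 1) * var_dim ns (segre ns :: 'a tensor set set))
        (ereal (real (prod_list ns) - 1))"
proof -
  have d: "length ns \<ge> 1" using assms(1) by simp
  have ns: "\<forall>i<length ns. ns ! i \<ge> 1" using kruskal_range_nth_pos[OF assms(4)] by blast
  have rs: "\<forall>k<length rs. rs ! k \<ge> 1"
    using assms(3) by (meson nth_mem one_le_numeral order_trans)
  have pos: "prod_list rs \<noteq> 0" using assms(3) by (auto simp: prod_list_zero_iff)
  have range: "tangent_range ns R" if "1 \<le> R" "R \<le> prod_list rs" for R
    using kruskal_range_imp_tangent_range[OF assms(4) that] .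
  \<comment> \<open>\<open>g\<close> is dim S + 1, so that a secant variety of r summands has
    dimension r g - 1.\<close>
  define g where "g = real (card (free_factor_params ns))"
  have dim: "real (card (free_params ns qs)) = real (card (summand_indices qs)) * g - 1"
    if "length qs \<ge> 1" "qs ! 0 \<ge> 1" for qs
    using card_free_params[OF that, of ns] unfolding g_def by (metis add_diff_cancel_right' of_nat_1 of_nat_add of_nat_mult)
  have dim1: "real (card (free_params ns [r])) = real r * g - 1" if "r \<ge> 1" for r
    using dim[of "[r]"] card_summand_indices[of "[r]"] that by simp
  have "length rs > 0" using assms(2) by linarith
  then have rs0: "rs ! 0 \<ge> 1" using rs by blast
  have main: "var_dim ns (hadamard_secant ns rs :: 'a tensor set set) = ereal (real (card (free_params ns rs)))"
    "card (free_params ns rs) + 1 \<le> prod_list ns"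
    using var_dim_hadamard_secant[OF d assms(2) rs ns range[of "prod_list rs"], where 'a = 'a] pos by auto
  have sec: "var_dim ns (secant ns (rs ! j) :: 'a tensor set set) = ereal (real (rs ! j) * g - 1)"
    if j: "j < length rs" for j
  proof -
    have r: "rs ! j \<ge> 1" using rs j by blast
    have "rs ! j dvd prod_list rs" using j by (intro prod_list_dvd) auto
    then have "rs ! j \<le> prod_list rs" using pos by (intro dvd_imp_le) auto
    then have "tangent_range ns (prod_list [rs ! j])" using range r by simp
    then show ?thesis
      using var_dim_hadamard_secant[OF d _ _ ns, of "[rs ! j]", where 'a = 'a] r dim1[OF r]
      by (simp add: secant_eq_hadamard_secant)
  qed
  have seg: "var_dim ns (segre ns :: 'a tensor set set) = ereal (g - 1)"
    using var_dim_segre[OF d ns range, where 'a = 'a] dim1[of 1] pos by (simp add: Suc_le_eq)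
  have "(\<Sum>j<length rs. var_dim ns (secant ns (rs ! j) :: 'a tensor set set)) =
      ereal (\<Sum>j<length rs. real (rs ! j) * g - 1)"
    unfolding sum_ereal[symmetric] using sec by (intro sum.cong) auto
  \<comment> \<open>Both sides equal (\<Sum>r_j - (m - 1)) g - 1.\<close>
  moreover have "(\<Sum>j<length rs. real (rs ! j) * g - 1) - (real (length rs) - 1) * (g - 1) =
      real (card (free_params ns rs))"
    unfolding dim[OF assms(2) rs0] card_summand_indices[OF assms(2) rs]
    by (simp add: sum_subtractf sum_distrib_left algebra_simps)
  moreover have "real (card (free_params ns rs)) \<le> real (prod_list ns) - 1"
    using main(2) by linarith
  ultimately show ?thesis unfolding main(1) seg by (simp add: min_def)
qed

end
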